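(* Let $\pi:A\to M$ be an affine bundle of rank $n>0$. There exists a one-to-one correspondence, determined by $$\widetilde{\{a,b\}_{(\Lambda_A,E_A)}}=[\![\tilde a,\tilde b]\!]^+\quad\text{for all affine functions } a,b:A\to\mathbb{R},$$ between strongly-affine Jacobi structures $(\Lambda_A,E_A)$ on $A$ and almost-special Lie algebroid structures $([\![\cdot,\cdot]\!]^+,\rho^+)$ on $A^+$.
   Context: Everything is smooth. A Jacobi structure on a manifold $N$ is a pair $(\Lambda,E)$ of a bivector field and a vector field such that the Jacobi bracket $\{f,g\}_{(\Lambda,E)}=\Lambda(df,dg)+fE(g)-gE(f)$ satisfies the Jacobi identity. The hamiltonian vector field of $f$ is $X_f^{(\Lambda,E)}=\#_\Lambda(df)+fE$, where $\#_\Lambda(\alpha)(\beta)=\Lambda(\alpha,\beta)$. An affine bundle $\pi:A\to M$ is a locally trivial bundle whose fibres $A_p$ are affine spaces modelled on the fibres of a vector bundle, with affine transition maps. A function on $A$ is affine if it is smooth and affine on fibres. A Jacobi structure on $A$ is affine if the Jacobi bracket of two affine functions is affine; it is strongly-affine if it is affine and, for every affine function $a$, the vector field $X_a^{(\Lambda_A,E_A)}$ maps affine functions to affine functions. $A^+=\bigcup_{p\in M}\mathrm{Aff}(A_p,\mathbb{R})\to M$ is the vector bundle of affine functions on the fibres; $\tilde a\in\Gamma(A^+)$ is the section corresponding to the affine function $a$ on $A$, and $\tilde 1$ corresponds to the constant function $1$. A Lie algebroid structure on a vector bundle $V\to M$ is a Lie bracket on $\Gamma(V)$ together with a vector bundle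 morphism $\rho:V\to TM$ such that $[\![X,fY]\!]=f[\![X,Y]\!]+\rho(X)(f)Y$. A Lie algebroid structure on $A^+$ is almost-special if the $C^\infty(M,\mathbb{R})$-submodule of $\Gamma(A^+)$ generated by $\tilde 1$ is an ideal of the Lie algebra $(\Gamma(A^+),[\![\cdot,\cdot]\!]^+)$. *)

theory Defs
  imports "HOL-Analysis.Analysis"
begin

section \<open>Smooth maps and smooth manifolds\<close>

text \<open>
  \<open>C\<^sup>k\<close> and smooth maps on open subsets of a finite-dimensional space, by iterating directional
  derivatives.
\<close>

primrec Ck_on :: "nat \<Rightarrow> 'x::real_normed_vector set \<Rightarrow> ('x \<Rightarrow> 'y::real_normed_vector) \<Rightarrow> bool" where
  "Ck_on 0 S f \<longleftrightarrow> continuous_on S f"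
| "Ck_on (Suc k) S f \<longleftrightarrow>
     (\<forall>x\<in>S. f differentiable (at x)) \<and> (\<forall>v. Ck_on k S (\<lambda>x. frechet_derivative f (at x) v))"

definition smooth_on :: "'x::real_normed_vector set \<Rightarrow> ('x \<Rightarrow> 'y::real_normed_vector) \<Rightarrow> bool" where
  "smooth_on S f \<longleftrightarrow> (\<forall>k. Ck_on k S f)"

type_synonym ('m, 'e) chart = "'m set \<times> ('m \<Rightarrow> 'e)"

text \<open>
  A manifold is a whole Hausdorff second countable type with an atlas.  The model space is a
  finite-dimensional inner product space rather than a type of class \<open>euclidean_space\<close>, since
  the latter excludes dimension 0.
\<close>

definition smooth_manifold ::
    "('m::{t2_space, second_countable_topology}, 'e::real_inner) chart set \<Rightarrow> bool" where
  "smooth_manifold \<A> \<longleftrightarrow>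
     (\<exists>B::'e set. finite B \<and> span B = UNIV) \<and>
     (\<Union>(U, \<phi>)\<in>\<A>. U) = UNIV \<and>
     (\<forall>(U, \<phi>)\<in>\<A>. open U \<and> open (\<phi> ` U) \<and> homeomorphism U (\<phi> ` U) \<phi> (inv_into U \<phi>)) \<and>
     (\<forall>(U, \<phi>)\<in>\<A>. \<forall>(W, \<psi>)\<in>\<A>. smooth_on (\<phi> ` (U \<inter> W)) (\<psi> \<circ> inv_into U \<phi>))"

definition smooth_fun_on ::
    "('m, 'e::real_normed_vector) chart set \<Rightarrow> 'm set \<Rightarrow> ('m \<Rightarrow> 'k::real_normed_vector) \<Rightarrow> bool" where
  "smooth_fun_on \<A> S f \<longleftrightarrow> (\<forall>(U, \<phi>)\<in>\<A>. smooth_on (\<phi> ` (U \<inter> S)) (f \<circ> inv_into U \<phi>))"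

definition C_infinity :: "('m, 'e::real_normed_vector) chart set \<Rightarrow> ('m \<Rightarrow> real) set" where
  "C_infinity \<A> = {f. smooth_fun_on \<A> UNIV f}"

definition smooth_map_on ::
    "('m::topological_space, 'e::real_normed_vector) chart set \<Rightarrow>
     ('n::topological_space, 'g::real_normed_vector) chart set \<Rightarrow> 'm set \<Rightarrow> ('m \<Rightarrow> 'n) \<Rightarrow> bool" where
  "smooth_map_on \<A> \<B> S h \<longleftrightarrow>
     continuous_on S h \<and>
     (\<forall>(U, \<phi>)\<in>\<A>. \<forall>(W, \<psi>)\<in>\<B>. smooth_on (\<phi> ` (U \<inter> S \<inter> h -` W)) (\<psi> \<circ> h \<circ> inv_into U \<phi>))"

definition diffeomorphism_on ::
    "('m::topological_space, 'e::real_normed_vector) chart set \<Rightarrow>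
     ('n::topological_space, 'g::real_normed_vector) chart set \<Rightarrow>
     'm set \<Rightarrow> 'n set \<Rightarrow> ('m \<Rightarrow> 'n) \<Rightarrow> bool" where
  "diffeomorphism_on \<A> \<B> S T h \<longleftrightarrow>
     open S \<and> open T \<and> bij_betw h S T \<and>
     smooth_map_on \<A> \<B> S h \<and> smooth_map_on \<B> \<A> T (inv_into S h)"

definition times_atlas ::
    "('m, 'e) chart set \<Rightarrow> ('m \<times> 'f::real_normed_vector, 'e \<times> 'f) chart set" where
  "times_atlas \<A> = (\<lambda>(U, \<phi>). (U \<times> UNIV, \<lambda>(p, k). (\<phi> p, k))) ` \<A>"


section \<open>Tangent vectors, one-forms, bivector fields\<close>

text \<open>
  Tangent vectors at \<open>p\<close> are the derivations at \<open>p\<close> of the algebra of smooth functions.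
  Functionals are \<open>extensional\<close> (that is, \<open>undefined\<close> outside their domain) throughout, so that
  HOL equality is equality on the intended domain.
\<close>

definition tangent_space ::
    "('m, 'e::real_normed_vector) chart set \<Rightarrow> 'm \<Rightarrow> (('m \<Rightarrow> real) \<Rightarrow> real) set" where
  "tangent_space \<A> p = {v \<in> C_infinity \<A> \<rightarrow>\<^sub>E UNIV.
     (\<forall>f\<in>C_infinity \<A>. \<forall>g\<in>C_infinity \<A>. v (\<lambda>q. f q + g q) = v f + v g) \<and>
     (\<forall>c. \<forall>f\<in>C_infinity \<A>. v (\<lambda>q. c * f q) = c * v f) \<and>
     (\<forall>f\<in>C_infinity \<A>. \<forall>g\<in>C_infinity \<A>. v (\<lambda>q. f q * g q) = f p * v g + g p * v f)}"

definition tangent_add where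
  "tangent_add \<A> v w = (\<lambda>f\<in>C_infinity \<A>. v f + w f)"

definition tangent_scale where
  "tangent_scale \<A> (c::real) v = (\<lambda>f\<in>C_infinity \<A>. c * v f)"

definition cotangent_space ::
    "('m, 'e::real_normed_vector) chart set \<Rightarrow> 'm \<Rightarrow> ((('m \<Rightarrow> real) \<Rightarrow> real) \<Rightarrow> real) set" where
  "cotangent_space \<A> p = {\<alpha> \<in> tangent_space \<A> p \<rightarrow>\<^sub>E UNIV.
     (\<forall>v\<in>tangent_space \<A> p. \<forall>w\<in>tangent_space \<A> p. \<alpha> (tangent_add \<A> v w) = \<alpha> v + \<alpha> w) \<and>
     (\<forall>c. \<forall>v\<in>tangent_space \<A> p. \<alpha> (tangent_scale \<A> c v) = c * \<alpha> v)}"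

definition cotangent_add where
  "cotangent_add \<A> p \<alpha> \<beta> = (\<lambda>v\<in>tangent_space \<A> p. \<alpha> v + \<beta> v)"

definition cotangent_scale where
  "cotangent_scale \<A> p (c::real) \<alpha> = (\<lambda>v\<in>tangent_space \<A> p. c * \<alpha> v)"

definition differential ::
    "('m, 'e::real_normed_vector) chart set \<Rightarrow> ('m \<Rightarrow> real) \<Rightarrow> 'm \<Rightarrow> (('m \<Rightarrow> real) \<Rightarrow> real) \<Rightarrow> real" where
  "differential \<A> f p = (\<lambda>v\<in>tangent_space \<A> p. v f)"

definition vector_fields ::
    "('m, 'e::real_normed_vector) chart set \<Rightarrow> ('m \<Rightarrow> ('m \<Rightarrow> real) \<Rightarrow> real) set" where
  "vector_fields \<A> = {X. (\<forall>p. X p \<in> tangent_space \<A> p) \<and>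
     (\<forall>f\<in>C_infinity \<A>. (\<lambda>p. X p f) \<in> C_infinity \<A>)}"

definition one_forms ::
    "('m, 'e::real_normed_vector) chart set \<Rightarrow> ('m \<Rightarrow> (('m \<Rightarrow> real) \<Rightarrow> real) \<Rightarrow> real) set" where
  "one_forms \<A> = {\<alpha>. (\<forall>p. \<alpha> p \<in> cotangent_space \<A> p) \<and>
     (\<forall>X\<in>vector_fields \<A>. (\<lambda>p. \<alpha> p (X p)) \<in> C_infinity \<A>)}"

type_synonym 'm bivector_field =
  "'m \<Rightarrow> ((('m \<Rightarrow> real) \<Rightarrow> real) \<Rightarrow> real) \<Rightarrow> ((('m \<Rightarrow> real) \<Rightarrow> real) \<Rightarrow> real) \<Rightarrow> real"

text \<open>Linearity in the second argument follows from linearity in the first and skew-symmetry.\<close>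

definition bivector_fields ::
    "('m, 'e::real_normed_vector) chart set \<Rightarrow> 'm bivector_field set" where
  "bivector_fields \<A> = {\<Lambda>.
     (\<forall>p. \<Lambda> p \<in> cotangent_space \<A> p \<rightarrow>\<^sub>E cotangent_space \<A> p \<rightarrow>\<^sub>E UNIV) \<and>
     (\<forall>p. \<forall>\<alpha>\<in>cotangent_space \<A> p. \<forall>\<beta>\<in>cotangent_space \<A> p.
        (\<forall>\<gamma>\<in>cotangent_space \<A> p. \<Lambda> p (cotangent_add \<A> p \<alpha> \<gamma>) \<beta> = \<Lambda> p \<alpha> \<beta> + \<Lambda> p \<gamma> \<beta>) \<and>
        (\<forall>c. \<Lambda> p (cotangent_scale \<A> p c \<alpha>) \<beta> = c * \<Lambda> p \<alpha> \<beta>) \<and>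
        \<Lambda> p \<alpha> \<beta> = - \<Lambda> p \<beta> \<alpha>) \<and>
     (\<forall>\<alpha>\<in>one_forms \<A>. \<forall>\<beta>\<in>one_forms \<A>. (\<lambda>p. \<Lambda> p (\<alpha> p) (\<beta> p)) \<in> C_infinity \<A>)}"


section \<open>Jacobi structures\<close>

definition jacobi_bracket where
  "jacobi_bracket \<A> \<Lambda> E f g =
     (\<lambda>p. \<Lambda> p (differential \<A> f p) (differential \<A> g p) + f p * E p g - g p * E p f)"

definition jacobi_structure ::
    "('m, 'e::real_normed_vector) chart set \<Rightarrow> 'm bivector_field \<Rightarrow> ('m \<Rightarrow> ('m \<Rightarrow> real) \<Rightarrow> real) \<Rightarrow> bool" where
  "jacobi_structure \<A> \<Lambda> E \<longleftrightarrow> \<Lambda> \<in> bivector_fields \<A> \<and> E \<in> vector_fields \<A> \<and>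
     (\<forall>f\<in>C_infinity \<A>. \<forall>g\<in>C_infinity \<A>. \<forall>h\<in>C_infinity \<A>. \<forall>p.
        jacobi_bracket \<A> \<Lambda> E f (jacobi_bracket \<A> \<Lambda> E g h) p +
        jacobi_bracket \<A> \<Lambda> E g (jacobi_bracket \<A> \<Lambda> E h f) p +
        jacobi_bracket \<A> \<Lambda> E h (jacobi_bracket \<A> \<Lambda> E f g) p = 0)"

text \<open>
  \<open>#\<^sub>\<Lambda>(\<alpha>)\<close> is the vector field with \<open>\<beta>(#\<^sub>\<Lambda>(\<alpha>)) = \<Lambda>(\<alpha>, \<beta>)\<close>; as a derivation, it sends \<open>g\<close> to
  \<open>dg(#\<^sub>\<Lambda>(\<alpha>)) = \<Lambda>(\<alpha>, dg)\<close>.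
\<close>

definition sharp where
  "sharp \<A> \<Lambda> \<alpha> p = (\<lambda>g\<in>C_infinity \<A>. \<Lambda> p (\<alpha> p) (differential \<A> g p))"

definition hamiltonian_vf where
  "hamiltonian_vf \<A> \<Lambda> E f p =
     tangent_add \<A> (sharp \<A> \<Lambda> (differential \<A> f) p) (tangent_scale \<A> (f p) (E p))"


section \<open>Vector bundles\<close>

text \<open>
  A vector bundle over \<open>M\<close> with typical fibre \<open>'k\<close>, given by its fibres and a set of local
  trivializations; the pair \<open>(U, t)\<close> is the trivialization \<open>x \<mapsto> (p, t p x)\<close>, \<open>x\<close> in the fibre
  over \<open>p \<in> U\<close>.  The manifold structure of the total space is the one induced by
  the trivializations.  The vector space axioms for the fibres are not listed: they are
  transported by the bijections \<open>t p\<close>.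
\<close>

record ('m, 'v, 'k) vbundle =
  fibre :: "'m \<Rightarrow> 'v set"
  vzero :: "'m \<Rightarrow> 'v"
  vadd :: "'m \<Rightarrow> 'v \<Rightarrow> 'v \<Rightarrow> 'v"
  vscale :: "'m \<Rightarrow> real \<Rightarrow> 'v \<Rightarrow> 'v"
  trivs :: "('m set \<times> ('m \<Rightarrow> 'v \<Rightarrow> 'k)) set"

definition linear_triv ::
    "('m::topological_space, 'v, 'k::real_normed_vector) vbundle \<Rightarrow>
     'm set \<times> ('m \<Rightarrow> 'v \<Rightarrow> 'k) \<Rightarrow> bool" where
  "linear_triv V = (\<lambda>(U, t). open U \<and> (\<forall>p\<in>U.
     bij_betw (t p) (fibre V p) UNIV \<and>
     t p (vzero V p) = 0 \<and>
     (\<forall>x\<in>fibre V p. \<forall>y\<in>fibre V p. t p (vadd V p x y) = t p x + t p y) \<and>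
     (\<forall>c. \<forall>x\<in>fibre V p. t p (vscale V p c x) = c *\<^sub>R t p x)))"

text \<open>
  Since the typical fibre is finite-dimensional, it suffices to ask that the matrix-valued
  transition function be smooth when applied to each fixed vector.
\<close>

definition smooth_transition ::
    "('m, 'e::real_normed_vector) chart set \<Rightarrow> ('m, 'v, 'k::real_normed_vector) vbundle \<Rightarrow>
     'm set \<times> ('m \<Rightarrow> 'v \<Rightarrow> 'k) \<Rightarrow> 'm set \<times> ('m \<Rightarrow> 'v \<Rightarrow> 'k) \<Rightarrow> bool" where
  "smooth_transition \<A> V = (\<lambda>(U, t) (W, s).
     \<forall>k. smooth_fun_on \<A> (U \<inter> W) (\<lambda>p. s p (inv_into (fibre V p) (t p) k)))"

definition vector_bundle ::
    "('m::topological_space, 'e::real_normed_vector) chart set \<Rightarrow>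
     ('m, 'v, 'k::euclidean_space) vbundle \<Rightarrow> bool" where
  "vector_bundle \<A> V \<longleftrightarrow>
     (\<forall>p. vzero V p \<in> fibre V p \<and>
        (\<forall>x\<in>fibre V p. \<forall>y\<in>fibre V p. vadd V p x y \<in> fibre V p) \<and>
        (\<forall>c. \<forall>x\<in>fibre V p. vscale V p c x \<in> fibre V p)) \<and>
     (\<Union>(U, t)\<in>trivs V. U) = UNIV \<and>
     (\<forall>T\<in>trivs V. linear_triv V T) \<and>
     (\<forall>T\<in>trivs V. \<forall>T'\<in>trivs V. smooth_transition \<A> V T T')"

text \<open>Members of the maximal set of trivializations compatible with \<open>trivs V\<close>.\<close>

definition vb_triv ::
    "('m::topological_space, 'e::real_normed_vector) chart set \<Rightarrow>
     ('m, 'v, 'k::euclidean_space) vbundle \<Rightarrow> 'm set \<times> ('m \<Rightarrow> 'v \<Rightarrow> 'k) \<Rightarrow> bool" where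
  "vb_triv \<A> V T \<longleftrightarrow> linear_triv V T \<and>
     (\<forall>T'\<in>trivs V. smooth_transition \<A> V T T' \<and> smooth_transition \<A> V T' T)"

definition sections ::
    "('m, 'e::real_normed_vector) chart set \<Rightarrow> ('m, 'v, 'k::real_normed_vector) vbundle \<Rightarrow>
     ('m \<Rightarrow> 'v) set" where
  "sections \<A> V = {s. (\<forall>p. s p \<in> fibre V p) \<and>
     (\<forall>(U, t)\<in>trivs V. smooth_fun_on \<A> U (\<lambda>p. t p (s p)))}"

definition sec_add where
  "sec_add V X Y = (\<lambda>p. vadd V p (X p) (Y p))"

definition sec_scale :: "('m, 'v, 'k) vbundle \<Rightarrow> ('m \<Rightarrow> real) \<Rightarrow> ('m \<Rightarrow> 'v) \<Rightarrow> 'm \<Rightarrow> 'v" where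
  "sec_scale V f X = (\<lambda>p. vscale V p (f p) (X p))"

definition generated_submodule where
  "generated_submodule \<A> V X = {sec_scale V f X | f. f \<in> C_infinity \<A>}"


section \<open>Lie algebroids\<close>

definition lie_bracket ::
    "('m, 'e::real_normed_vector) chart set \<Rightarrow> ('m, 'v, 'k::real_normed_vector) vbundle \<Rightarrow>
     (('m \<Rightarrow> 'v) \<Rightarrow> ('m \<Rightarrow> 'v) \<Rightarrow> 'm \<Rightarrow> 'v) \<Rightarrow> bool" where
  "lie_bracket \<A> V br \<longleftrightarrow>
     br \<in> sections \<A> V \<rightarrow>\<^sub>E sections \<A> V \<rightarrow>\<^sub>E sections \<A> V \<and>
     (\<forall>X\<in>sections \<A> V. \<forall>Y\<in>sections \<A> V. \<forall>Z\<in>sections \<A> V.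
        br (sec_add V X Y) Z = sec_add V (br X Z) (br Y Z) \<and>
        (\<forall>c. br (sec_scale V (\<lambda>_. c) X) Z = sec_scale V (\<lambda>_. c) (br X Z)) \<and>
        br X Y = sec_scale V (\<lambda>_. - 1) (br Y X) \<and>
        sec_add V (br X (br Y Z)) (sec_add V (br Y (br Z X)) (br Z (br X Y))) = vzero V)"

text \<open>
  An anchor is a fibrewise linear map into the tangent bundle, covering the identity; its
  smoothness is expressed by its sending smooth sections to smooth vector fields.
\<close>

definition anchor_map ::
    "('m, 'e::real_normed_vector) chart set \<Rightarrow> ('m, 'v, 'k::real_normed_vector) vbundle \<Rightarrow>
     ('m \<Rightarrow> 'v \<Rightarrow> ('m \<Rightarrow> real) \<Rightarrow> real) \<Rightarrow> bool" where
  "anchor_map \<A> V \<rho> \<longleftrightarrow>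
     (\<forall>p. \<rho> p \<in> fibre V p \<rightarrow>\<^sub>E tangent_space \<A> p \<and>
        (\<forall>x\<in>fibre V p. \<forall>y\<in>fibre V p. \<rho> p (vadd V p x y) = tangent_add \<A> (\<rho> p x) (\<rho> p y)) \<and>
        (\<forall>c. \<forall>x\<in>fibre V p. \<rho> p (vscale V p c x) = tangent_scale \<A> c (\<rho> p x))) \<and>
     (\<forall>X\<in>sections \<A> V. (\<lambda>p. \<rho> p (X p)) \<in> vector_fields \<A>)"

definition lie_algebroid ::
    "('m, 'e::real_normed_vector) chart set \<Rightarrow> ('m, 'v, 'k::real_normed_vector) vbundle \<Rightarrow>
     (('m \<Rightarrow> 'v) \<Rightarrow> ('m \<Rightarrow> 'v) \<Rightarrow> 'm \<Rightarrow> 'v) \<Rightarrow> ('m \<Rightarrow> 'v \<Rightarrow> ('m \<Rightarrow> real) \<Rightarrow> real) \<Rightarrow> bool" where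
  "lie_algebroid \<A> V br \<rho> \<longleftrightarrow> lie_bracket \<A> V br \<and> anchor_map \<A> V \<rho> \<and>
     (\<forall>X\<in>sections \<A> V. \<forall>Y\<in>sections \<A> V. \<forall>f\<in>C_infinity \<A>.
        br X (sec_scale V f Y) =
        sec_add V (sec_scale V f (br X Y)) (sec_scale V (\<lambda>p. \<rho> p (X p) f) Y))"


section \<open>Affine bundles\<close>

text \<open>
  The affine bundle \<open>proj : A \<rightarrow> M\<close>, modelled on the vector bundle \<open>model\<close>; \<open>transl x v\<close> is \<open>x + v\<close>, for
  \<open>x\<close> in the fibre of \<open>A\<close> and \<open>v\<close> in the fibre of the model over the same point.
\<close>

record ('a, 'm, 'v, 'e, 'f) abundle =
  base_atlas :: "('m, 'e) chart set"
  total_atlas :: "('a, 'e \<times> 'f) chart set"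
  proj :: "'a \<Rightarrow> 'm"
  model :: "('m, 'v, 'f) vbundle"
  transl :: "'a \<Rightarrow> 'v \<Rightarrow> 'a"

definition afibre :: "('a, 'm, 'v, 'e, 'f) abundle \<Rightarrow> 'm \<Rightarrow> 'a set" where
  "afibre B p = proj B -` {p}"

text \<open>
  Affine trivializations \<open>x \<mapsto> (proj x, \<tau> x)\<close> over \<open>U\<close>: diffeomorphisms whose restriction to each
  fibre is affine, the linear parts forming a trivialization of the model vector bundle.
\<close>

definition affine_triv ::
    "('a::topological_space, 'm::topological_space, 'v, 'e::real_normed_vector,
      'f::euclidean_space) abundle \<Rightarrow> 'm set \<times> ('a \<Rightarrow> 'f) \<Rightarrow> bool" where
  "affine_triv B = (\<lambda>(U, \<tau>). open U \<and>
     diffeomorphism_on (total_atlas B) (times_atlas (base_atlas B))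
       (proj B -` U) (U \<times> UNIV) (\<lambda>x. (proj B x, \<tau> x)) \<and>
     (\<exists>t. vb_triv (base_atlas B) (model B) (U, t) \<and>
        (\<forall>p\<in>U. \<forall>x\<in>afibre B p. \<forall>v\<in>fibre (model B) p. \<tau> (transl B x v) = \<tau> x + t p v)))"

definition affine_bundle ::
    "nat \<Rightarrow> ('a::{t2_space, second_countable_topology}, 'm::{t2_space, second_countable_topology},
      'v, 'e::real_inner, 'f::euclidean_space) abundle \<Rightarrow> bool" where
  "affine_bundle n B \<longleftrightarrow>
     DIM('f) = n \<and>
     smooth_manifold (base_atlas B) \<and> smooth_manifold (total_atlas B) \<and>
     smooth_map_on (total_atlas B) (base_atlas B) UNIV (proj B) \<and>
     vector_bundle (base_atlas B) (model B) \<and>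
     (\<forall>p. \<forall>x\<in>afibre B p.
        transl B x (vzero (model B) p) = x \<and>
        (\<forall>v\<in>fibre (model B) p. transl B x v \<in> afibre B p) \<and>
        (\<forall>v\<in>fibre (model B) p. \<forall>w\<in>fibre (model B) p.
           transl B (transl B x v) w = transl B x (vadd (model B) p v w)) \<and>
        (\<forall>y\<in>afibre B p. \<exists>!v. v \<in> fibre (model B) p \<and> transl B x v = y)) \<and>
     (\<forall>p. \<exists>U \<tau>. p \<in> U \<and> affine_triv B (U, \<tau>))"

definition affine_on_fibre :: "('a, 'm, 'v, 'e, 'f) abundle \<Rightarrow> 'm \<Rightarrow> ('a \<Rightarrow> real) \<Rightarrow> bool" where
  "affine_on_fibre B p a \<longleftrightarrow> (\<exists>l.
     (\<forall>v\<in>fibre (model B) p. \<forall>w\<in>fibre (model B) p. l (vadd (model B) p v w) = l v + l w) \<and>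
     (\<forall>c. \<forall>v\<in>fibre (model B) p. l (vscale (model B) p c v) = c * l v) \<and>
     (\<forall>x\<in>afibre B p. \<forall>v\<in>fibre (model B) p. a (transl B x v) = a x + l v))"

definition affine_functions ::
    "('a, 'm, 'v, 'e::real_normed_vector, 'f::real_normed_vector) abundle \<Rightarrow> ('a \<Rightarrow> real) set" where
  "affine_functions B = {a \<in> C_infinity (total_atlas B). \<forall>p. affine_on_fibre B p a}"

text \<open>
  The vector bundle \<open>A\<^sup>+\<close>.  An affine trivialization \<open>(U, \<tau>)\<close> of \<open>A\<close> yields the one of \<open>A\<^sup>+\<close>
  that sends \<open>x \<mapsto> w \<bullet> \<tau> x + c\<close>, on the fibre of \<open>A\<close> over \<open>p \<in> U\<close>, to \<open>(w, c)\<close>.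
\<close>

definition aff_dual ::
    "('a::topological_space, 'm::topological_space, 'v, 'e::real_normed_vector,
      'f::euclidean_space) abundle \<Rightarrow> ('m, 'a \<Rightarrow> real, 'f \<times> real) vbundle" where
  "aff_dual B = \<lparr>
     fibre = (\<lambda>p. {\<alpha> \<in> afibre B p \<rightarrow>\<^sub>E UNIV. affine_on_fibre B p \<alpha>}),
     vzero = (\<lambda>p. \<lambda>x\<in>afibre B p. 0),
     vadd = (\<lambda>p \<alpha> \<beta>. \<lambda>x\<in>afibre B p. \<alpha> x + \<beta> x),
     vscale = (\<lambda>p c \<alpha>. \<lambda>x\<in>afibre B p. c * \<alpha> x),
     trivs = {(U, \<lambda>p \<alpha>. THE (w, c). \<forall>x\<in>afibre B p. \<alpha> x = w \<bullet> \<tau> x + c) | U \<tau>.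
                affine_triv B (U, \<tau>)} \<rparr>"

definition tilde :: "('a, 'm, 'v, 'e, 'f) abundle \<Rightarrow> ('a \<Rightarrow> real) \<Rightarrow> 'm \<Rightarrow> 'a \<Rightarrow> real" where
  "tilde B a = (\<lambda>p. restrict a (afibre B p))"


section \<open>Strongly-affine and almost-special structures\<close>

definition affine_jacobi where
  "affine_jacobi B \<Lambda> E \<longleftrightarrow> jacobi_structure (total_atlas B) \<Lambda> E \<and>
     (\<forall>a\<in>affine_functions B. \<forall>b\<in>affine_functions B.
        jacobi_bracket (total_atlas B) \<Lambda> E a b \<in> affine_functions B)"

definition strongly_affine_jacobi where
  "strongly_affine_jacobi B \<Lambda> E \<longleftrightarrow> affine_jacobi B \<Lambda> E \<and>
     (\<forall>a\<in>affine_functions B. \<forall>b\<in>affine_functions B.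
        (\<lambda>x. hamiltonian_vf (total_atlas B) \<Lambda> E a x b) \<in> affine_functions B)"

definition almost_special where
  "almost_special B br \<rho> \<longleftrightarrow> lie_algebroid (base_atlas B) (aff_dual B) br \<rho> \<and>
     (let I = generated_submodule (base_atlas B) (aff_dual B) (tilde B (\<lambda>_. 1))
      in \<forall>X\<in>sections (base_atlas B) (aff_dual B). \<forall>Y\<in>I. br X Y \<in> I)"

end

theory Submission
  imports Defs
begin

text \<open>
  For affine functions \<open>a, b\<close> write \<open>X\<^sub>a(b) = {a, b} + b E(a)\<close>. If the Jacobi structure is strongly affine, then for
  a basic function \<open>f\<close> the function \<open>g = X\<^sub>a(f)\<close> is affine, and so is \<open>g\<^sup>2 = X\<^sub>a(f g) - f X\<^sub>a(g)\<close>; hence \<open>g\<close> is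
  basic, and likewise \<open>E(a)\<close> is basic. This gives the anchor \<open>\<rho>(a)(f) = X\<^sub>a(f)\<close>; it is tensorial in \<open>a\<close>
  because \<open>\<Lambda>(df, dg) = 0\<close> for basic \<open>f, g\<close>: since \<open>X\<^sub>f\<^sub>a(g) = f X\<^sub>a(g) + a \<Lambda>(df, dg)\<close>, the function
  \<open>a \<Lambda>(df, dg)\<close> is basic for every affine \<open>a\<close>.

  Conversely, the differentials of affine functions exhaust every cotangent space of \<open>A\<close>, and a
  linear functional on affine functions that satisfies the Leibniz rule for products with basic
  functions is the restriction of a unique tangent vector. Hence \<open>E(a) = {1, a}\<close> and
  \<open>\<Lambda>(da, db) = {a, b} - a {1, b} + b {1, a}\<close> define a vector field and a bivector field, and the
  Jacobi identity extends from affine to all smooth functions because the Jacobiator is of first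
  order in each argument.
\<close>

section \<open>Calculus of smooth maps\<close>

text \<open>The two adjectives meet in {a, 1} = - E(a). If the multiples of 1 form an ideal, then
  E(a) is basic and b E(a) is affine along with b; in the other direction {a, f} = X_a(f) - f E(a)
  is basic for basic f, because both terms are.

  The obstacle on the way back is that affine functions form no algebra. Hadamard's lemma writes a
  function through products of coordinates with arbitrary smooth remainders, so it cannot be fed to
  a functional that is only controlled on affine functions. It is applied to tangent vectors of A
  and, on the base, to basic functions; affine functions are handled through a local frame, where
  only products of a basic with an affine function occur.

  Tangent vectors are derivations of globally defined functions, so every coordinate has to carry a
  cutoff. Cutoffs are always pulled back from M, which keeps functions affine on fibres.\<close>

lemma Ck_on_SucI:
  fixes f :: "'x::real_normed_vector \<Rightarrow> 'y::real_normed_vector"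
  assumes "open S" and "\<And>x. x \<in> S \<Longrightarrow> (f has_derivative f' x) (at x)"
    and "\<And>v. Ck_on k S (\<lambda>x. f' x v)"
    and cong: "\<And>g h :: 'x \<Rightarrow> 'y. (\<And>x. x \<in> S \<Longrightarrow> g x = h x) \<Longrightarrow> Ck_on k S g \<Longrightarrow> Ck_on k S h"
  shows "Ck_on (Suc k) S f"
proof -
  have *: "f' x = frechet_derivative f (at x)" if "x \<in> S" for x
    using frechet_derivative_at assms(2) that by blast
  have "Ck_on k S (\<lambda>x. frechet_derivative f (at x) v)" for v
  proof (rule cong)
    show "f' x v = frechet_derivative f (at x) v" if "x \<in> S" for x
      using *[OF that] by simp
  qed (rule assms(3))
  then show ?thesis
    using assms(2) unfolding Ck_on.simps differentiable_def by blast
qed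

text \<open>Since \<open>Ck_on\<close> fixes the operator \<open>frechet_derivative\<close>,
  replacing a derivative by an equal one already needs congruence one level lower. That is why
  \<open>Ck_on_SucI\<close> carries congruence as a hypothesis: the induction hypothesis supplies it
  here.\<close>

lemma Ck_on_cong:
  assumes "open S" "\<And>x. x \<in> S \<Longrightarrow> f x = g x" "Ck_on k S f"
  shows "Ck_on k S g"
  using assms(2,3)
proof (induction k arbitrary: f g)
  case 0
  then show ?case by (simp cong: continuous_on_cong)
next
  case (Suc k)
  have *: "(g has_derivative frechet_derivative f (at x)) (at x)" if "x \<in> S" for x
  proof -
    have "(f has_derivative frechet_derivative f (at x)) (at x)"
      using Suc.prems(2) that by (simp flip: frechet_derivative_works)
    then show ?thesis
      using has_derivative_transform_within_open[OF _ \<open>open S\<close> that] Suc.prems(1) by metis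
  qed
  show ?case
    using Suc.prems(2)
    by (intro Ck_on_SucI[OF \<open>open S\<close> *]) (auto intro: Suc.IH)
qed

text \<open>Any derivative on S will do, in whatever form the derivative rules produce it; the
  inductions for sums, pairs, products and compositions need not mention
  \<open>frechet_derivative\<close>.\<close>

lemma Ck_on_Suc_iff:
  assumes "open S"
  shows "Ck_on (Suc k) S f \<longleftrightarrow>
    (\<exists>f'. (\<forall>x\<in>S. (f has_derivative f' x) (at x)) \<and> (\<forall>v. Ck_on k S (\<lambda>x. f' x v)))"
    (is "?L \<longleftrightarrow> ?R")
proof
  assume ?L
  then show ?R
    by (intro exI[of _ "\<lambda>x. frechet_derivative f (at x)"]) (simp flip: frechet_derivative_works)
next
  assume ?R
  then obtain f' where "\<forall>x\<in>S. (f has_derivative f' x) (at x)" "\<forall>v. Ck_on k S (\<lambda>x. f' x v)"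
    by blast
  then show ?L
    by (intro Ck_on_SucI[OF assms, of f f']) (auto intro: Ck_on_cong[OF assms])
qed

lemma Ck_on_Suc_intro:
  assumes "open S" and "\<And>x. x \<in> S \<Longrightarrow> (f has_derivative f' x) (at x)"
    and "\<And>v. Ck_on k S (\<lambda>x. f' x v)"
  shows "Ck_on (Suc k) S f"
  unfolding Ck_on_Suc_iff[OF assms(1)] using assms(2,3) by blast

lemma Ck_on_subset: "Ck_on k S f \<Longrightarrow> T \<subseteq> S \<Longrightarrow> Ck_on k T f"
proof (induction k arbitrary: f)
  case 0
  then show ?case by (simp add: continuous_on_subset)
qed (auto simp: subset_eq)

lemma Ck_on_SucD: "Ck_on (Suc k) S f \<Longrightarrow> Ck_on k S f"
proof (induction k arbitrary: f)
  case 0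
  then show ?case
    by (auto intro!: continuous_at_imp_continuous_on differentiable_imp_continuous_within)
next
  case (Suc k)
  have "Ck_on k S (\<lambda>x. frechet_derivative f (at x) v)" for v
    using Suc.IH Suc.prems by (subst (asm) (2) Ck_on.simps(2)) blast
  then show ?case using Suc.prems by auto
qed

text \<open>Derivatives are taken in the full space and not within S, so open neighbourhoods decide,
  whatever their position relative to S.\<close>

lemma Ck_on_local:
  assumes "\<And>x. x \<in> S \<Longrightarrow> \<exists>T. open T \<and> x \<in> T \<and> Ck_on k T f"
  shows "Ck_on k S f"
  using assms
proof (induction k arbitrary: f)
  case 0
  then show ?case
    by (metis Ck_on.simps(1) at_within_open continuous_at_imp_continuous_on
        continuous_on_eq_continuous_within)
next
  case (Suc k)
  have "f differentiable at x" if "x \<in> S" for x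
    using Suc.prems[OF that] by auto
  moreover have "Ck_on k S (\<lambda>x. frechet_derivative f (at x) v)" for v
    by (rule Suc.IH) (use Suc.prems in fastforce)
  ultimately show ?case by auto
qed

lemma Ck_on_const [simp]: "open S \<Longrightarrow> Ck_on k S (\<lambda>_. c)"
proof (induction k arbitrary: c)
  case (Suc k)
  then show ?case
    by (subst Ck_on_Suc_iff) (auto intro!: exI[of _ "\<lambda>x v. 0"])
qed auto

lemma Ck_on_linear_comp:
  assumes "bounded_linear L" "open S" "Ck_on k S f"
  shows "Ck_on k S (\<lambda>x. L (f x))"
  using assms(3)
proof (induction k arbitrary: f)
  case 0
  then show ?case
    by (simp add: bounded_linear.continuous_on[OF assms(1)])
next
  case (Suc k)
  then obtain f' where "\<forall>x\<in>S. (f has_derivative f' x) (at x)" "\<forall>v. Ck_on k S (\<lambda>x. f' x v)"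
    by (auto simp only: Ck_on_Suc_iff[OF assms(2)])
  then show ?case
    using Suc.IH bounded_linear.has_derivative[OF assms(1)]
    by (subst Ck_on_Suc_iff[OF assms(2)]) (blast intro: exI[of _ "\<lambda>x v. L (f' x v)"])
qed

lemma Ck_on_id: "open S \<Longrightarrow> Ck_on k S (\<lambda>x. x)"
proof (cases k)
  case (Suc l)
  assume "open S"
  then show ?thesis unfolding Suc
    by (subst Ck_on_Suc_iff) (auto intro!: exI[of _ "\<lambda>x v. v"] derivative_intros)
qed auto

lemma Ck_on_add:
  assumes "open S" "Ck_on k S f" "Ck_on k S g"
  shows "Ck_on k S (\<lambda>x. f x + g x)"
  using assms(2,3)
proof (induction k arbitrary: f g)
  case 0
  then show ?case by (auto intro: continuous_intros)
next
  case (Suc k)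
  obtain f' where f: "\<forall>x\<in>S. (f has_derivative f' x) (at x)" "\<forall>v. Ck_on k S (\<lambda>x. f' x v)"
    using Suc.prems by (auto simp only: Ck_on_Suc_iff[OF assms(1)])
  obtain g' where g: "\<forall>x\<in>S. (g has_derivative g' x) (at x)" "\<forall>v. Ck_on k S (\<lambda>x. g' x v)"
    using Suc.prems by (auto simp only: Ck_on_Suc_iff[OF assms(1)])
  show ?case
    using f g by (subst Ck_on_Suc_iff[OF assms(1)])
      (auto intro!: exI[of _ "\<lambda>x v. f' x v + g' x v"] derivative_eq_intros Suc.IH)
qed

lemma Ck_on_Pair:
  assumes "open S" "Ck_on k S f" "Ck_on k S g"
  shows "Ck_on k S (\<lambda>x. (f x, g x))"
  using assms(2,3)
proof (induction k arbitrary: f g)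
  case 0
  then show ?case by (auto intro: continuous_intros)
next
  case (Suc k)
  obtain f' where f: "\<forall>x\<in>S. (f has_derivative f' x) (at x)" "\<forall>v. Ck_on k S (\<lambda>x. f' x v)"
    using Suc.prems by (auto simp only: Ck_on_Suc_iff[OF assms(1)])
  obtain g' where g: "\<forall>x\<in>S. (g has_derivative g' x) (at x)" "\<forall>v. Ck_on k S (\<lambda>x. g' x v)"
    using Suc.prems by (auto simp only: Ck_on_Suc_iff[OF assms(1)])
  show ?case
    using f g by (subst Ck_on_Suc_iff[OF assms(1)])
      (auto intro!: exI[of _ "\<lambda>x v. (f' x v, g' x v)"] has_derivative_Pair Suc.IH)
qed

lemma Ck_on_bilinear:
  assumes "bounded_bilinear pr" "open S" "Ck_on k S f" "Ck_on k S g"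
  shows "Ck_on k S (\<lambda>x. pr (f x) (g x))"
  using assms(3,4)
proof (induction k arbitrary: f g)
  case 0
  then show ?case by (auto intro: bounded_bilinear.continuous_on[OF assms(1)])
next
  case (Suc k)
  obtain f' where f: "\<forall>x\<in>S. (f has_derivative f' x) (at x)" "\<forall>v. Ck_on k S (\<lambda>x. f' x v)"
    using Suc.prems by (auto simp only: Ck_on_Suc_iff[OF assms(2)])
  obtain g' where g: "\<forall>x\<in>S. (g has_derivative g' x) (at x)" "\<forall>v. Ck_on k S (\<lambda>x. g' x v)"
    using Suc.prems by (auto simp only: Ck_on_Suc_iff[OF assms(2)])
  show ?case
    \<comment> \<open>In each product one factor stays undifferentiated, and it is needed at level k
      only.\<close>
    using f g Suc.prems[THEN Ck_on_SucD]
    by (subst Ck_on_Suc_iff[OF assms(2)])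
      (auto intro!: exI[of _ "\<lambda>x v. pr (f x) (g' x v) + pr (f' x v) (g x)"]
        bounded_bilinear.FDERIV[OF assms(1)] Suc.IH Ck_on_add[OF assms(2)])
qed

lemmas Ck_on_mult = Ck_on_bilinear[OF bounded_bilinear_mult]
lemmas Ck_on_scaleR = Ck_on_bilinear[OF bounded_bilinear_scaleR]
lemmas Ck_on_inner = Ck_on_bilinear[OF bounded_bilinear_inner]

lemma Ck_on_sum:
  assumes "open S" "\<And>i. i \<in> I \<Longrightarrow> Ck_on k S (f i)"
  shows "Ck_on k S (\<lambda>x. \<Sum>i\<in>I. f i x)"
  using assms(2)
  by (induction I rule: infinite_finite_induct) (auto intro: Ck_on_add simp: assms(1))

section \<open>Orthonormal bases and the chain rule\<close>

definition orthonormal_basis :: "'g::real_inner set \<Rightarrow> bool" where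
  "orthonormal_basis C \<longleftrightarrow> finite C \<and> (\<forall>b\<in>C. \<forall>c\<in>C. b \<bullet> c = (if b = c then 1 else 0)) \<and>
     (\<forall>x. x = (\<Sum>b\<in>C. (x \<bullet> b) *\<^sub>R b))"

text \<open>Gram-Schmidt for one vector at a time: the residual y = x - p is normalised and added,
  unless it vanishes because x already lies in the span.\<close>

lemma orthonormal_set_exists:
  "finite S \<Longrightarrow> \<exists>C. finite C \<and> (\<forall>b\<in>C. \<forall>c\<in>C. b \<bullet> c = (if b = c then 1 else 0)) \<and>
     span C = span (S :: 'g::real_inner set)"
proof (induction S rule: finite_induct)
  case empty
  then show ?case by (intro exI[of _ "{}"]) auto
next
  case (insert x S)
  then obtain C where C: "finite C" "\<forall>b\<in>C. \<forall>c\<in>C. b \<bullet> c = (if b = c then 1 else 0)"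
    "span C = span S" by blast
  define p where "p = (\<Sum>b\<in>C. (x \<bullet> b) *\<^sub>R b)"
  define y where "y = x - p"
  have p: "p \<in> span C" unfolding p_def by (auto intro: span_sum span_scale span_base)
  have orth: "y \<bullet> c = 0" if "c \<in> C" for c
  proof -
    have "p \<bullet> c = (\<Sum>b\<in>C. (x \<bullet> b) * (if b = c then 1 else 0))"
      unfolding p_def inner_sum_left using C(2) that by (intro sum.cong) auto
    also have "\<dots> = x \<bullet> c"
      using C(1) that by (simp add: if_distrib cong: if_cong)
    finally show ?thesis by (simp add: y_def inner_diff_left)
  qed
  have span_insert_p: "span (insert (x - p) C) = span (insert x S)"
  proof -
    have "span (insert (x - p) C) = span (insert x C)"
      using eq_span_insert_eq[of "x - p" x C] span_neg[OF p] by simp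
    also have "\<dots> = span (insert x S)"
      using C(3) by (simp add: span_insert)
    finally show ?thesis .
  qed
  show ?case
  proof (cases "y = 0")
    case True
    then have "span (insert x S) = span C"
      using span_insert_p by (simp add: y_def span_insert_0)
    then show ?thesis using C by blast
  next
    case False
    let ?u = "y /\<^sub>R norm y"
    have "span (insert ?u C) = span (insert y C)"
    proof -
      have "y \<in> span (insert ?u C)"
        using span_scale[OF span_base[of ?u "insert ?u C"], of "norm y"] False by simp
      moreover have "?u \<in> span (insert y C)"
        by (intro span_scale span_base) simp
      ultimately show ?thesis
        unfolding span_eq by (auto intro: span_base)
    qed
    moreover have "?u \<notin> C"
    proof
      assume "?u \<in> C"
      then have "?u \<bullet> y = 0" using orth by (metis inner_commute)
      then show False using False by simp
    qed
    moreover have "?u \<bullet> ?u = 1"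
      using False by (simp add: dot_square_norm power2_eq_square)
    moreover have "?u \<bullet> c = 0 \<and> c \<bullet> ?u = 0" if "c \<in> C" for c
      using orth[OF that] by (simp add: inner_commute)
    ultimately show ?thesis
      using C span_insert_p unfolding y_def[symmetric]
      by (intro exI[of _ "insert ?u C"]) auto
  qed
qed

lemma orthonormal_basis_exists:
  assumes "\<exists>B::'g::real_inner set. finite B \<and> span B = UNIV"
  obtains C :: "'g::real_inner set" where "orthonormal_basis C"
proof -
  obtain B :: "'g set" where "finite B" "span B = UNIV" using assms by blast
  then obtain C :: "'g set" where C: "finite C"
    "\<forall>b\<in>C. \<forall>c\<in>C. b \<bullet> c = (if b = c then 1 else 0)" "span C = UNIV"
    using orthonormal_set_exists by metis
  have "x = (\<Sum>b\<in>C. (x \<bullet> b) *\<^sub>R b)" for x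
  proof -
    have "x \<in> span C" using C by simp
    then obtain u where u: "x = (\<Sum>b\<in>C. u b *\<^sub>R b)"
      unfolding span_finite[OF C(1)] by blast
    have "x \<bullet> c = u c" if "c \<in> C" for c
    proof -
      have "x \<bullet> c = (\<Sum>b\<in>C. u b * (if b = c then 1 else 0))"
        unfolding u inner_sum_left using C(2) that by (intro sum.cong) auto
      then show ?thesis using C(1) that by (simp add: if_distrib cong: if_cong)
    qed
    then have "(\<Sum>b\<in>C. (x \<bullet> b) *\<^sub>R b) = (\<Sum>b\<in>C. u b *\<^sub>R b)"
      by (intro sum.cong) auto
    then show ?thesis using u by simp
  qed
  with C that show ?thesis unfolding orthonormal_basis_def by blast
qed

lemma orthonormal_basis_Basis: "orthonormal_basis (Basis :: 'f::euclidean_space set)"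
  unfolding orthonormal_basis_def by (auto simp: inner_Basis euclidean_representation)

text \<open>In g'(f x)(f' x v) the direction depends on x, whereas the induction hypothesis speaks
  of derivatives of g in fixed directions. Expanding f' x v in the orthonormal basis leaves the
  fixed directions b with scalar coefficients.\<close>

lemma Ck_on_compose:
  fixes f :: "'x::real_normed_vector \<Rightarrow> 'g::real_inner"
  assumes C: "orthonormal_basis (C :: 'g set)" and "open S" "open T" and "f ` S \<subseteq> T"
    and "Ck_on k S f" "Ck_on k T g"
  shows "Ck_on k S (\<lambda>x. g (f x))"
  using assms(5,6)
proof (induction k arbitrary: g)
  case 0
  then show ?case using continuous_on_compose2[of T g S f] assms(4) by auto
next
  case (Suc k)
  obtain f' where f: "\<forall>x\<in>S. (f has_derivative f' x) (at x)" "\<forall>v. Ck_on k S (\<lambda>x. f' x v)"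
    using Suc.prems by (auto simp only: Ck_on_Suc_iff[OF assms(2)])
  obtain g' where g: "\<forall>x\<in>T. (g has_derivative g' x) (at x)" "\<forall>v. Ck_on k T (\<lambda>x. g' x v)"
    using Suc.prems by (auto simp only: Ck_on_Suc_iff[OF assms(3)])
  have "((\<lambda>x. g (f x)) has_derivative (\<lambda>v. \<Sum>b\<in>C. (f' x v \<bullet> b) *\<^sub>R g' (f x) b)) (at x)"
    if "x \<in> S" for x
  proof -
    have *: "(g has_derivative g' (f x)) (at (f x))" using g that assms(4) by auto
    have "((\<lambda>x. g (f x)) has_derivative (\<lambda>v. g' (f x) (f' x v))) (at x)"
      using has_derivative_compose[OF f(1)[rule_format, OF that] *] .
    moreover have "g' (f x) w = (\<Sum>b\<in>C. (w \<bullet> b) *\<^sub>R g' (f x) b)" for w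
    proof -
      interpret bounded_linear "g' (f x)" using * by (rule has_derivative_bounded_linear)
      have "g' (f x) w = g' (f x) (\<Sum>b\<in>C. (w \<bullet> b) *\<^sub>R b)"
        using C unfolding orthonormal_basis_def by metis
      then show ?thesis by (simp add: sum scaleR)
    qed
    then have "(\<lambda>v. g' (f x) (f' x v)) = (\<lambda>v. \<Sum>b\<in>C. (f' x v \<bullet> b) *\<^sub>R g' (f x) b)"
      by blast
    ultimately show ?thesis by (simp only:)
  qed
  moreover have "Ck_on k S (\<lambda>x. \<Sum>b\<in>C. (f' x v \<bullet> b) *\<^sub>R g' (f x) b)" for v
    using f g Suc.prems
    by (intro Ck_on_sum Ck_on_scaleR Ck_on_inner Suc.IH)
      (auto intro: Ck_on_SucD simp: assms(2) simp del: Ck_on.simps)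
  ultimately show ?case
    by (subst Ck_on_Suc_iff[OF assms(2)])
      (auto intro!: exI[of _ "\<lambda>x v. \<Sum>b\<in>C. (f' x v \<bullet> b) *\<^sub>R g' (f x) b"])
qed

lemma smooth_on_cong:
  "open S \<Longrightarrow> (\<And>x. x \<in> S \<Longrightarrow> f x = g x) \<Longrightarrow> smooth_on S f \<Longrightarrow> smooth_on S g"
  unfolding smooth_on_def using Ck_on_cong by metis

lemma smooth_on_subset: "smooth_on S f \<Longrightarrow> T \<subseteq> S \<Longrightarrow> smooth_on T f"
  unfolding smooth_on_def using Ck_on_subset by metis

lemma smooth_on_local:
  "(\<And>x. x \<in> S \<Longrightarrow> \<exists>T. open T \<and> x \<in> T \<and> smooth_on T f) \<Longrightarrow> smooth_on S f"
  unfolding smooth_on_def by (meson Ck_on_local)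

lemma smooth_on_const [simp]: "open S \<Longrightarrow> smooth_on S (\<lambda>_. c)"
  unfolding smooth_on_def by simp

lemma smooth_on_id: "open S \<Longrightarrow> smooth_on S (\<lambda>x. x)"
  unfolding smooth_on_def by (simp add: Ck_on_id)

lemma smooth_on_linear_comp:
  "bounded_linear L \<Longrightarrow> open S \<Longrightarrow> smooth_on S f \<Longrightarrow> smooth_on S (\<lambda>x. L (f x))"
  unfolding smooth_on_def by (simp add: Ck_on_linear_comp)

lemma smooth_on_add:
  "open S \<Longrightarrow> smooth_on S f \<Longrightarrow> smooth_on S g \<Longrightarrow> smooth_on S (\<lambda>x. f x + g x)"
  unfolding smooth_on_def by (simp add: Ck_on_add)

lemma smooth_on_Pair:
  "open S \<Longrightarrow> smooth_on S f \<Longrightarrow> smooth_on S g \<Longrightarrow> smooth_on S (\<lambda>x. (f x, g x))"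
  unfolding smooth_on_def by (simp add: Ck_on_Pair)

lemma smooth_on_bilinear:
  "bounded_bilinear pr \<Longrightarrow> open S \<Longrightarrow> smooth_on S f \<Longrightarrow> smooth_on S g
    \<Longrightarrow> smooth_on S (\<lambda>x. pr (f x) (g x))"
  unfolding smooth_on_def by (simp add: Ck_on_bilinear)

lemma smooth_on_sum:
  "open S \<Longrightarrow> (\<And>i. i \<in> I \<Longrightarrow> smooth_on S (f i)) \<Longrightarrow> smooth_on S (\<lambda>x. \<Sum>i\<in>I. f i x)"
  unfolding smooth_on_def by (simp add: Ck_on_sum)

lemma smooth_on_compose:
  fixes f :: "'x::real_normed_vector \<Rightarrow> 'g::real_inner"
  assumes "orthonormal_basis (C :: 'g set)" "open S" "open T" "f ` S \<subseteq> T"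
    and "smooth_on S f" "smooth_on T g"
  shows "smooth_on S (\<lambda>x. g (f x))"
  using assms(5,6) Ck_on_compose[OF assms(1-4)] unfolding smooth_on_def by blast

lemma smooth_on_imp_continuous_on: "smooth_on S f \<Longrightarrow> continuous_on S f"
  unfolding smooth_on_def using Ck_on.simps(1) by blast

lemma smooth_on_imp_differentiable: "smooth_on S f \<Longrightarrow> x \<in> S \<Longrightarrow> f differentiable at x"
  unfolding smooth_on_def using Ck_on.simps(2) by blast

lemma smooth_on_derivative: "smooth_on S f \<Longrightarrow> smooth_on S (\<lambda>x. frechet_derivative f (at x) v)"
  unfolding smooth_on_def using Ck_on.simps(2) by blast

section \<open>Bump functions on the model space\<close>

lemma DERIV_power_inverse:
  assumes "x \<noteq> (0::real)"
  shows "((\<lambda>x. inverse x ^ n) has_field_derivative - real n * inverse x ^ (n + 1)) (at x)"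
proof (cases n)
  case (Suc m)
  have "((\<lambda>x. inverse x) has_field_derivative - (inverse x ^ 2)) (at x)"
    using DERIV_inverse[OF assms] by (simp add: numeral_2_eq_2)
  from DERIV_power_Suc[OF this, of m] show ?thesis
    unfolding Suc by (simp add: power2_eq_square algebra_simps del: power_inverse)
qed auto

lemma smooth_on_power_inverse: "smooth_on (- {0::real}) (\<lambda>x. inverse x ^ n)"
proof -
  have "Ck_on k (- {0::real}) (\<lambda>x. inverse x ^ n)" for k
  proof (induction k arbitrary: n)
    case 0
    then show ?case by (auto intro!: continuous_intros)
  next
    case (Suc k)
    have "Ck_on k (- {0}) (\<lambda>x::real. (- real n * inverse x ^ (n + 1)) * v)" for v
      by (intro Ck_on_mult Ck_on_const Suc.IH) auto
    then show ?case
      using DERIV_power_inverse[unfolded has_field_derivative_def]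
      by (intro Ck_on_Suc_intro) auto
  qed
  then show ?thesis unfolding smooth_on_def by blast
qed

text \<open>For m = 0 this is e^(-1/t), continued by 0. The powers of 1/t are included because
  differentiation produces them: the derivative of a member combines the members m + 1 and m + 2, so
  smoothness can be proved by induction for all m at once.\<close>

definition exp_flat :: "nat \<Rightarrow> real \<Rightarrow> real" where
  "exp_flat m t = (if t > 0 then inverse t ^ m * exp (- inverse t) else 0)"

lemma exp_flat_has_derivative:
  "(exp_flat m has_field_derivative exp_flat (m + 2) t - real m * exp_flat (m + 1) t) (at t)"
proof -
  consider "t > 0" | "t < 0" | "t = 0" by linarith
  then show ?thesis
  proof cases
    case 1
    have "((\<lambda>t. exp (- inverse t)) has_field_derivative exp (- inverse t) * inverse t ^ 2) (at t)"
      using 1 by (auto intro!: derivative_eq_intros simp: power2_eq_square)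
    from DERIV_mult[OF DERIV_power_inverse this, of m]
    have "((\<lambda>t. inverse t ^ m * exp (- inverse t)) has_field_derivative
        exp_flat (m + 2) t - real m * exp_flat (m + 1) t) (at t)"
      using 1 by (simp add: exp_flat_def power_add algebra_simps power2_eq_square)
    then show ?thesis
      by (rule has_field_derivative_transform_within_open[of _ _ _ "{0<..}"])
        (use 1 in \<open>auto simp: exp_flat_def\<close>)
  next
    case 2
    have "((\<lambda>t. 0) has_field_derivative exp_flat (m + 2) t - real m * exp_flat (m + 1) t) (at t)"
      using 2 by (simp add: exp_flat_def)
    then show ?thesis
      by (rule has_field_derivative_transform_within_open[of _ _ _ "{..<0}"])
        (use 2 in \<open>auto simp: exp_flat_def\<close>)
  next
    case 3
    have "((\<lambda>h. exp_flat m h / h) \<longlongrightarrow> 0) (at 0)"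
    proof (rule filterlim_split_at)
      \<comment> \<open>Dividing by h raises the exponent to \<open>Suc m\<close>; with s = 1/h the
        quotient is s^(m+1) / e^s, which tends to 0 as s grows.\<close>
      have "((\<lambda>h::real. inverse h ^ m * exp (- inverse h) / h) \<longlongrightarrow> 0) (at_right 0)"
      proof (rule Lim_transform_eventually)
        show "((\<lambda>h::real. inverse h ^ Suc m / exp (inverse h)) \<longlongrightarrow> 0) (at_right 0)"
          by (rule filterlim_compose[OF tendsto_power_div_exp_0 filterlim_inverse_at_top_right])
      qed (auto simp: eventually_at_filter exp_minus field_simps)
      then show "((\<lambda>h. exp_flat m h / h) \<longlongrightarrow> 0) (at_right 0)"
        by (rule Lim_transform_eventually)
          (auto simp: exp_flat_def eventually_at_filter)
      show "((\<lambda>h. exp_flat m h / h) \<longlongrightarrow> 0) (at_left 0)"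
        by (rule tendsto_eventually) (auto simp: exp_flat_def eventually_at_filter)
    qed
    then show ?thesis
      using 3 by (simp add: has_field_derivative_iff exp_flat_def)
  qed
qed

lemma smooth_on_exp_flat: "smooth_on UNIV (exp_flat m)"
proof -
  have "Ck_on k UNIV (exp_flat m)" for k
  proof (induction k arbitrary: m)
    case 0
    then show ?case
      using DERIV_continuous_on[OF has_field_derivative_at_within[OF exp_flat_has_derivative]]
      by auto
  next
    case (Suc k)
    have "(exp_flat m has_derivative (\<lambda>v. v * exp_flat (m + 2) t + (- real m * v) * exp_flat (m + 1) t)) (at t)"
      for t
      using exp_flat_has_derivative[of m t] unfolding has_field_derivative_def
      by (rule has_derivative_eq_rhs) (auto simp: algebra_simps)
    moreover have "Ck_on k UNIV (\<lambda>t. v * exp_flat (m + 2) t + (- real m * v) * exp_flat (m + 1) t)"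
      for v
      by (intro Ck_on_add Ck_on_mult Ck_on_const Suc.IH) auto
    ultimately show ?case
      by (rule Ck_on_Suc_intro[OF open_UNIV])
  qed
  then show ?thesis unfolding smooth_on_def by blast
qed

text \<open>The denominator vanishes nowhere, as t and 1 - t are not both \<le> 0. The exponent 1
  brings the reciprocal into the form of \<open>smooth_on_power_inverse\<close>.\<close>

definition smooth_step :: "real \<Rightarrow> real" where
  "smooth_step t = exp_flat 0 t * inverse (exp_flat 0 t + exp_flat 0 (1 - t)) ^ 1"

lemma smooth_step_0: "t \<le> 0 \<Longrightarrow> smooth_step t = 0"
  and smooth_step_1: "t \<ge> 1 \<Longrightarrow> smooth_step t = 1"
  by (auto simp: smooth_step_def exp_flat_def)

lemma orthonormal_basis_real: "orthonormal_basis {1::real}"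
  unfolding orthonormal_basis_def by auto

lemma smooth_on_smooth_step: "smooth_on UNIV smooth_step"
proof -
  have pos: "exp_flat 0 t + exp_flat 0 (1 - t) \<noteq> 0" for t
    by (cases "t > 0") (auto simp: exp_flat_def add_pos_pos
        intro!: less_imp_neq[THEN not_sym])
  have 0: "smooth_on UNIV (\<lambda>t::real. 1 + (- 1) * t)"
    by (intro smooth_on_add smooth_on_bilinear[OF bounded_bilinear_mult] smooth_on_id
        smooth_on_const open_UNIV)
  have 1: "smooth_on UNIV (\<lambda>t. exp_flat 0 (1 + (-1) * t))"
    by (rule smooth_on_compose[OF orthonormal_basis_real _ _ _ 0 smooth_on_exp_flat]) auto
  have "smooth_on UNIV (\<lambda>t. exp_flat 0 t + exp_flat 0 (1 - t))"
    using smooth_on_add[OF open_UNIV smooth_on_exp_flat[of 0] 1] by simp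
  then have "smooth_on UNIV (\<lambda>t. inverse (exp_flat 0 t + exp_flat 0 (1 - t)) ^ 1)"
    by (rule smooth_on_compose[OF orthonormal_basis_real _ _ _ _ smooth_on_power_inverse, rotated 3])
      (use pos in auto)
  from smooth_on_bilinear[OF bounded_bilinear_mult _ smooth_on_exp_flat this]
  show ?thesis unfolding smooth_step_def by simp
qed

lemma bump_on_inner_space:
  fixes y0 :: "'g::real_inner"
  assumes "r > 0"
  obtains f :: "'g \<Rightarrow> real" where "smooth_on UNIV f" "\<And>y. dist y0 y \<ge> r \<Longrightarrow> f y = 0"
    "\<And>y. dist y0 y \<le> r / 2 \<Longrightarrow> f y = 1"
proof
  \<comment> \<open>The constants are those of the function 4/3 - 4/3 (d/r)^2 of the distance d,
    which is 0 at d = r and 1 at d = r/2. The squared distance is used because the norm is not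
    smooth at 0.\<close>
  define q where "q y = 4/3 + (- (4 / (3 * r\<^sup>2))) * ((y - y0) \<bullet> (y - y0))" for y
  have "smooth_on UNIV (\<lambda>y. y + (- y0))"
    by (intro smooth_on_add smooth_on_id) auto
  then have "smooth_on UNIV q"
    unfolding q_def
    by (intro smooth_on_add smooth_on_bilinear[OF bounded_bilinear_mult]
        smooth_on_bilinear[OF bounded_bilinear_inner]) auto
  then show "smooth_on UNIV (\<lambda>y. smooth_step (q y))"
    by (rule smooth_on_compose[OF orthonormal_basis_real _ _ _ _ smooth_on_smooth_step, rotated 3])
      auto
  have q: "q y = 4/3 - 4/3 * (dist y0 y / r)\<^sup>2" for y
    using assms by (simp add: q_def power2_norm_eq_inner[symmetric] dist_norm norm_minus_commute
        power_divide)
  show "smooth_step (q y) = 0" if "dist y0 y \<ge> r" for y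
  proof (rule smooth_step_0)
    have "1 \<le> (dist y0 y / r)\<^sup>2" using that assms by (intro one_le_power) simp
    then show "q y \<le> 0" unfolding q by simp
  qed
  show "smooth_step (q y) = 1" if "dist y0 y \<le> r / 2" for y
  proof (rule smooth_step_1)
    have "(dist y0 y / r)\<^sup>2 \<le> (1/2)\<^sup>2" using that assms by (intro power_mono) (auto simp: field_simps)
    then show "q y \<ge> 1" unfolding q by (simp add: power2_eq_square)
  qed
qed

lemma linear_orthonormal_expansion:
  assumes "orthonormal_basis C" "bounded_linear L"
  shows "L w = (\<Sum>b\<in>C. (w \<bullet> b) *\<^sub>R L b)"
proof -
  interpret bounded_linear L by fact
  have "L w = L (\<Sum>b\<in>C. (w \<bullet> b) *\<^sub>R b)"
    using assms(1) unfolding orthonormal_basis_def by metis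
  then show ?thesis by (simp add: sum scaleR)
qed

lemma orthonormal_basis_finite: "orthonormal_basis C \<Longrightarrow> finite C"
  unfolding orthonormal_basis_def by blast

lemma orthonormal_basis_inner:
  "orthonormal_basis C \<Longrightarrow> b \<in> C \<Longrightarrow> c \<in> C \<Longrightarrow> b \<bullet> c = (if b = c then 1 else 0)"
  unfolding orthonormal_basis_def by blast

lemma orthonormal_basis_norm: "orthonormal_basis C \<Longrightarrow> b \<in> C \<Longrightarrow> norm b = 1"
  using orthonormal_basis_inner[of C b b] by (simp add: norm_eq_1)

lemma orthonormal_expansion: "orthonormal_basis C \<Longrightarrow> (\<Sum>b\<in>C. (x \<bullet> b) *\<^sub>R b) = x"
  unfolding orthonormal_basis_def by metis

text \<open>The ball is a closed subset of a cube of vectors with bounded coefficients, and the cube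
  is compact as a sum of segments, one for each basis vector. Compactness is what later makes the
  preimage of a ball under a chart closed in the whole manifold.\<close>

lemma compact_cball_orthonormal:
  assumes C: "orthonormal_basis (C :: 'g::real_inner set)"
  shows "compact (cball (y :: 'g) r)"
proof -
  have "compact {\<Sum>b\<in>D. c b *\<^sub>R b | c. \<forall>b\<in>D. \<bar>c b\<bar> \<le> R}" if "finite D" for D :: "'g set" and R :: real
    using that
  proof (induction D rule: finite_induct)
    case empty
    have "{\<Sum>b\<in>{}. c b *\<^sub>R b | c. \<forall>b\<in>{}. \<bar>c b\<bar> \<le> R} = {0::'g}" by auto
    then show ?case by simp
  next
    case (insert d D)
    let ?X = "{\<Sum>b\<in>D. c b *\<^sub>R b | c. \<forall>b\<in>D. \<bar>c b\<bar> \<le> R}"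
    have "compact ((\<lambda>t. t *\<^sub>R d) ` {-R..R})"
      by (intro compact_continuous_image continuous_intros) auto
    then have "compact {x + y | x y. x \<in> (\<lambda>t. t *\<^sub>R d) ` {-R..R} \<and> y \<in> ?X}"
      using insert.IH by (rule compact_sums)
    moreover have "{x + y | x y. x \<in> (\<lambda>t. t *\<^sub>R d) ` {-R..R} \<and> y \<in> ?X} =
      {\<Sum>b\<in>insert d D. c b *\<^sub>R b | c. \<forall>b\<in>insert d D. \<bar>c b\<bar> \<le> R}" (is "?L = ?M")
    proof (intro equalityI subsetI)
      fix z assume "z \<in> ?L"
      then obtain t c where z: "z = t *\<^sub>R d + (\<Sum>b\<in>D. c b *\<^sub>R b)" "\<bar>t\<bar> \<le> R"
        "\<forall>b\<in>D. \<bar>c b\<bar> \<le> R" by auto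
      have "(\<Sum>b\<in>D. (c(d := t)) b *\<^sub>R b) = (\<Sum>b\<in>D. c b *\<^sub>R b)"
        using insert.hyps by (intro sum.cong) auto
      then have "z = (\<Sum>b\<in>insert d D. (c(d := t)) b *\<^sub>R b)"
        using insert.hyps z by simp
      moreover have "\<forall>b\<in>insert d D. \<bar>(c(d := t)) b\<bar> \<le> R" using z by auto
      ultimately show "z \<in> ?M" by blast
    next
      fix z assume "z \<in> ?M"
      then obtain c where "z = (\<Sum>b\<in>insert d D. c b *\<^sub>R b)" "\<forall>b\<in>insert d D. \<bar>c b\<bar> \<le> R" by auto
      then have "z = c d *\<^sub>R d + (\<Sum>b\<in>D. c b *\<^sub>R b)" "c d \<in> {-R..R}" "\<forall>b\<in>D. \<bar>c b\<bar> \<le> R"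
        using insert.hyps by auto
      then show "z \<in> ?L" by blast
    qed
    ultimately show ?case by simp
  qed
  then have comp: "compact {\<Sum>b\<in>C. c b *\<^sub>R b | c. \<forall>b\<in>C. \<bar>c b\<bar> \<le> r + norm y}"
    using orthonormal_basis_finite[OF C] by blast
  have "cball y r \<subseteq> {\<Sum>b\<in>C. c b *\<^sub>R b | c. \<forall>b\<in>C. \<bar>c b\<bar> \<le> r + norm y}"
  proof
    fix x assume "x \<in> cball y r"
    then have "norm x \<le> r + norm y"
      using norm_triangle_sub[of x y] by (simp add: dist_norm norm_minus_commute)
    then have "\<forall>b\<in>C. \<bar>x \<bullet> b\<bar> \<le> r + norm y"
      using Cauchy_Schwarz_ineq2[of x] orthonormal_basis_norm[OF C]
      by (metis mult.right_neutral order_trans)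
    then show "x \<in> {\<Sum>b\<in>C. c b *\<^sub>R b | c. \<forall>b\<in>C. \<bar>c b\<bar> \<le> r + norm y}"
      using orthonormal_expansion[OF C, of x] by (auto intro!: exI[of _ "\<lambda>b. x \<bullet> b"])
  qed
  then show ?thesis
    using compact_Int_closed[OF comp closed_cball[of y r]] by (simp add: Int_absorb1)
qed

section \<open>Hadamard's lemma\<close>

text \<open>The mean value theorem on the segment from y to z gives the increment as a derivative at
  an intermediate point in the direction z - y; continuity of the \<open>\<Gamma> b\<close> compares
  it with the derivative at y. Derivatives in one real parameter, as obtained under an integral,
  thereby become Frechet derivatives.\<close>

lemma has_derivative_of_line_derivatives:
  fixes f :: "'g::real_inner \<Rightarrow> real"
  assumes C: "orthonormal_basis C" and S: "open S" and y: "y \<in> S"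
    and \<Gamma>: "\<And>b. b \<in> C \<Longrightarrow> continuous_on S (\<Gamma> b)"
    and line: "\<And>z h. z \<in> S \<Longrightarrow>
      ((\<lambda>s. f (z + s *\<^sub>R h)) has_real_derivative (\<Sum>b\<in>C. (h \<bullet> b) * \<Gamma> b z)) (at 0)"
  shows "(f has_derivative (\<lambda>h. \<Sum>b\<in>C. (h \<bullet> b) * \<Gamma> b y)) (at y)"
  unfolding has_derivative_at_alt
proof (intro conjI allI impI)
  show "bounded_linear (\<lambda>h. \<Sum>b\<in>C. (h \<bullet> b) * \<Gamma> b y)"
    by (intro bounded_linear_sum bounded_linear_compose[OF bounded_linear_mult_left]
        bounded_linear_inner_left)
next
  fix e :: real assume "e > 0"
  let ?G = "\<lambda>z. \<Sum>b\<in>C. \<bar>\<Gamma> b z - \<Gamma> b y\<bar>"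
  have "continuous_on S ?G" by (intro continuous_intros \<Gamma>)
  then have "isCont ?G y" using S y continuous_on_eq_continuous_at by blast
  then have "(?G \<longlongrightarrow> 0) (at y)" by (simp add: isCont_def)
  then have "\<forall>\<^sub>F z in at y. ?G z < e" using \<open>e > 0\<close> by (rule order_tendstoD)
  then obtain d1 where d1: "d1 > 0" "\<And>z. z \<noteq> y \<Longrightarrow> dist z y < d1 \<Longrightarrow> ?G z < e"
    unfolding eventually_at by auto
  obtain d2 where d2: "d2 > 0" "ball y d2 \<subseteq> S" using S y openE by blast
  show "\<exists>d>0. \<forall>z. norm (z - y) < d \<longrightarrow>
      norm (f z - f y - (\<Sum>b\<in>C. ((z - y) \<bullet> b) * \<Gamma> b y)) \<le> e * norm (z - y)"
  proof (intro exI[of _ "min d1 d2"] conjI allI impI)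
    fix z assume z: "norm (z - y) < min d1 d2"
    define h where "h = z - y"
    have near: "norm (s *\<^sub>R h) \<le> norm h" if "0 \<le> s" "s \<le> 1" for s
      using that by (simp add: mult_left_le_one_le)
    have in_S: "y + s *\<^sub>R h \<in> S" if "0 \<le> s" "s \<le> 1" for s
      using near[OF that] z d2(2) by (auto simp: h_def dist_norm subset_eq)
    have "((\<lambda>s. f (y + s *\<^sub>R h)) has_real_derivative (\<Sum>b\<in>C. (h \<bullet> b) * \<Gamma> b (y + s *\<^sub>R h))) (at s)"
      if "0 \<le> s" "s \<le> 1" for s
    proof -
      have "((\<lambda>t. f (y + s *\<^sub>R h + (t - s) *\<^sub>R h)) has_real_derivative
          (\<Sum>b\<in>C. (h \<bullet> b) * \<Gamma> b (y + s *\<^sub>R h))) (at s)"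
        using DERIV_shift[of "\<lambda>t. f (y + s *\<^sub>R h + (t - s) *\<^sub>R h)" _ 0 s] line[OF in_S[OF that], of h]
        by simp
      then show ?thesis by (simp add: algebra_simps)
    qed
    from MVT2[of 0 1 "\<lambda>s. f (y + s *\<^sub>R h)", OF _ this]
    obtain s where s: "0 < s" "s < 1"
      "f (y + h) - f y = (\<Sum>b\<in>C. (h \<bullet> b) * \<Gamma> b (y + s *\<^sub>R h))"
      by auto
    have "f z - f y - (\<Sum>b\<in>C. (h \<bullet> b) * \<Gamma> b y) =
        (\<Sum>b\<in>C. (h \<bullet> b) * (\<Gamma> b (y + s *\<^sub>R h) - \<Gamma> b y))"
      using s(3) by (simp add: h_def sum_subtractf right_diff_distrib)
    also have "norm \<dots> \<le> (\<Sum>b\<in>C. norm h * \<bar>\<Gamma> b (y + s *\<^sub>R h) - \<Gamma> b y\<bar>)"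
    proof (rule sum_norm_le)
      fix b assume "b \<in> C"
      then have "\<bar>h \<bullet> b\<bar> \<le> norm h"
        using Cauchy_Schwarz_ineq2[of h b] orthonormal_basis_norm[OF C] by simp
      then show "norm ((h \<bullet> b) * (\<Gamma> b (y + s *\<^sub>R h) - \<Gamma> b y)) \<le>
          norm h * \<bar>\<Gamma> b (y + s *\<^sub>R h) - \<Gamma> b y\<bar>"
        by (simp add: abs_mult mult_right_mono)
    qed
    also have "\<dots> = ?G (y + s *\<^sub>R h) * norm h"
      by (subst mult.commute) (rule sum_distrib_left[symmetric])
    also have "\<dots> \<le> e * norm h"
    proof (cases "h = 0")
      case False
      then have "?G (y + s *\<^sub>R h) < e"
        using le_less_trans[OF near[of s], of d1] s z by (intro d1) (auto simp: h_def dist_norm)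
      then show ?thesis by (simp add: mult_right_mono)
    qed simp
    finally show "norm (f z - f y - (\<Sum>b\<in>C. ((z - y) \<bullet> b) * \<Gamma> b y)) \<le> e * norm (z - y)"
      unfolding h_def .
  qed (use d1 d2 in auto)
qed

text \<open>Hadamard's remainders are the case j = 0. The weight t^j is there because each
  differentiation in y releases a factor t, so that the family is closed under differentiation, with
  j replaced by \<open>Suc j\<close>.\<close>

definition radial_integral :: "'g::real_inner \<Rightarrow> nat \<Rightarrow> ('g \<Rightarrow> real) \<Rightarrow> 'g \<Rightarrow> real" where
  "radial_integral y0 j F y = integral (cbox 0 1) (\<lambda>t. t ^ j * F (y0 + t *\<^sub>R (y - y0)))"

context
  fixes S :: "'g::real_inner set" and y0 :: 'g and C :: "'g set"
  assumes S: "open S" "convex S" and y0: "y0 \<in> S" and C: "orthonormal_basis C"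
begin

lemma radial_in: "y \<in> S \<Longrightarrow> t \<in> cbox 0 1 \<Longrightarrow> y0 + t *\<^sub>R (y - y0) \<in> S"
  using convexD_alt[OF S(2) y0, of y t] by (simp add: algebra_simps)

lemma radial_integrand_continuous:
  assumes "continuous_on S F"
  shows "continuous_on (S \<times> cbox 0 1) (\<lambda>(y, t). t ^ j * F (y0 + t *\<^sub>R (y - y0)))"
  unfolding split_beta
  by (intro continuous_intros continuous_on_compose2[OF assms]) (use radial_in in auto)

lemma radial_integral_continuous:
  assumes "continuous_on S F"
  shows "continuous_on S (radial_integral y0 j F)"
  unfolding radial_integral_def
  by (intro integral_continuous_on_param radial_integrand_continuous assms)

lemma radial_integrable:
  assumes "continuous_on S F" "y \<in> S"
  shows "(\<lambda>t. t ^ j * F (y0 + t *\<^sub>R (y - y0))) integrable_on cbox 0 1"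
proof (rule integrable_continuous)
  show "continuous_on (cbox 0 1) (\<lambda>t. t ^ j * F (y0 + t *\<^sub>R (y - y0)))"
    using continuous_on_compose2[OF radial_integrand_continuous[OF assms(1), of j],
        of "cbox 0 1" "\<lambda>t. (y, t)",
        OF continuous_on_Pair[OF continuous_on_const continuous_on_id]] assms(2) by auto
qed

lemma radial_integral_line_derivative:
  assumes diff: "\<And>z. z \<in> S \<Longrightarrow> F differentiable at z"
    and cont: "\<And>b. b \<in> C \<Longrightarrow> continuous_on S (\<lambda>z. frechet_derivative F (at z) b)"
    and z: "z \<in> S"
  shows "((\<lambda>s. radial_integral y0 j F (z + s *\<^sub>R h)) has_real_derivative
    (\<Sum>b\<in>C. (h \<bullet> b) * radial_integral y0 (Suc j) (\<lambda>w. frechet_derivative F (at w) b) z)) (at 0)"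
proof -
  \<comment> \<open>The parameters for which the line stays in S. Convexity is a premise of the
    Leibniz rule, and openness turns the derivative within U into a plain one.\<close>
  define U where "U = (\<lambda>s. z + s *\<^sub>R h) -` S"
  let ?D = "\<lambda>b w. frechet_derivative F (at w) b"
  have U: "open U" "0 \<in> U"
    unfolding U_def using z by (auto intro!: open_vimage S continuous_intros)
  have "convex U"
  proof (rule convexI)
    fix a b u v :: real assume *: "a \<in> U" "b \<in> U" "0 \<le> u" "0 \<le> v" "u + v = 1"
    have "u *\<^sub>R (z + a *\<^sub>R h) + v *\<^sub>R (z + b *\<^sub>R h) = (u + v) *\<^sub>R z + (u * a + v * b) *\<^sub>R h"
      by (simp add: algebra_simps)
    then show "u *\<^sub>R a + v *\<^sub>R b \<in> U"
      using convexD[OF S(2), of "z + a *\<^sub>R h" "z + b *\<^sub>R h" u v] * by (simp add: U_def)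
  qed
  have Fcont: "continuous_on S F"
    using diff by (auto intro!: continuous_at_imp_continuous_on differentiable_imp_continuous_within)
  define p where "p s t = y0 + t *\<^sub>R (z + s *\<^sub>R h - y0)" for s t :: real
  have pS: "p s t \<in> S" if "s \<in> U" "t \<in> cbox 0 1" for s t
    using radial_in[of "z + s *\<^sub>R h" t] that by (simp add: p_def U_def)
  let ?fx = "\<lambda>s t. \<Sum>b\<in>C. (h \<bullet> b) * (t ^ Suc j * ?D b (p s t))"
  have "((\<lambda>s. integral (cbox 0 1) (\<lambda>t. t ^ j * F (p s t))) has_field_derivative
      integral (cbox 0 1) (?fx 0)) (at 0 within U)"
  proof (rule leibniz_rule_field_derivative[OF _ _ _ U(2) \<open>convex U\<close>])
    fix s t :: real assume st: "s \<in> U" "t \<in> cbox 0 1"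
    have "((\<lambda>s. p s t) has_derivative (\<lambda>r. (r * t) *\<^sub>R h)) (at s)"
      unfolding p_def by (auto intro!: derivative_eq_intros simp: algebra_simps)
    moreover have F: "(F has_derivative frechet_derivative F (at (p s t))) (at (p s t))"
      using diff[OF pS[OF st]] by (simp flip: frechet_derivative_works)
    ultimately have "((\<lambda>s. F (p s t)) has_derivative
        (\<lambda>r. frechet_derivative F (at (p s t)) ((r * t) *\<^sub>R h))) (at s)"
      by (rule has_derivative_compose)
    then have "((\<lambda>s. t ^ j * F (p s t)) has_derivative
        (\<lambda>r. t ^ j * frechet_derivative F (at (p s t)) ((r * t) *\<^sub>R h))) (at s)"
      by (rule has_derivative_mult_right)
    moreover have "t ^ j * frechet_derivative F (at (p s t)) ((r * t) *\<^sub>R h) = ?fx s t * r" for r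
      unfolding linear_orthonormal_expansion[OF C has_derivative_bounded_linear[OF F], of "(r * t) *\<^sub>R h"]
      by (simp add: sum_distrib_left sum_distrib_right algebra_simps)
    ultimately have "((\<lambda>s. t ^ j * F (p s t)) has_field_derivative ?fx s t) (at s)"
      unfolding has_field_derivative_def by (simp only:)
    then show "((\<lambda>s. t ^ j * F (p s t)) has_field_derivative ?fx s t) (at s within U)"
      by (rule has_field_derivative_at_within)
  next
    fix s assume "s \<in> U"
    then show "(\<lambda>t. t ^ j * F (p s t)) integrable_on cbox 0 1"
      using radial_integrable[OF Fcont, of "z + s *\<^sub>R h"] by (simp add: p_def U_def)
  next
    have "continuous_on (U \<times> cbox 0 1) (\<lambda>x. ?D b (p (fst x) (snd x)))" if "b \<in> C" for b
      by (rule continuous_on_compose2[OF cont[OF that]])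
        (use pS in \<open>auto simp: p_def intro!: continuous_intros\<close>)
    then show "continuous_on (U \<times> cbox 0 1) (\<lambda>(s, t). ?fx s t)"
      unfolding split_beta by (intro continuous_intros) auto
  qed
  moreover have "integral (cbox 0 1) (?fx 0) =
      (\<Sum>b\<in>C. (h \<bullet> b) * radial_integral y0 (Suc j) (?D b) z)"
    using radial_integrable[OF cont z, of _ "Suc j"] unfolding radial_integral_def p_def
    by (subst integral_sum) (auto intro: integrable_on_mult_right orthonormal_basis_finite[OF C])
  ultimately show ?thesis
    unfolding radial_integral_def p_def by (simp only: at_within_open[OF U(2,1)])
qed

text \<open>The partial derivatives of a radial integral are radial integrals of the partial
  derivatives of F, so the induction leaves F and j free.\<close>

lemma radial_integral_Ck:
  "Ck_on k S F \<Longrightarrow> Ck_on k S (radial_integral y0 j F)"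
proof (induction k arbitrary: F j)
  case 0
  then show ?case by (simp add: radial_integral_continuous)
next
  case (Suc k)
  let ?D = "\<lambda>b w. frechet_derivative F (at w) b"
  have CD: "Ck_on k S (?D b)" for b using Suc.prems by auto
  have cont: "continuous_on S (?D b)" for b
    using CD[of b] by (induction k) (auto dest: Ck_on_SucD simp del: Ck_on.simps(2))
  have "(radial_integral y0 j F has_derivative
      (\<lambda>h. \<Sum>b\<in>C. (h \<bullet> b) * radial_integral y0 (Suc j) (?D b) y)) (at y)" if "y \<in> S" for y
    by (rule has_derivative_of_line_derivatives[OF C S(1) that])
      (use Suc.prems cont in \<open>auto intro!: radial_integral_line_derivative radial_integral_continuous\<close>)
  moreover have "Ck_on k S (\<lambda>y. \<Sum>b\<in>C. (h \<bullet> b) * radial_integral y0 (Suc j) (?D b) y)" for h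
    by (intro Ck_on_sum Ck_on_mult Ck_on_const Suc.IH CD S)
  ultimately show ?case by (rule Ck_on_Suc_intro[OF S(1)])
qed

text \<open>Integrate the derivative of F along the segment from y0 to y. At y = y0 the integrand is
  constant, which gives the value of G there.\<close>

lemma hadamard:
  assumes F: "smooth_on S F"
  obtains G where "\<And>b. smooth_on S (G b)" "\<And>b. G b y0 = frechet_derivative F (at y0) b"
    "\<And>y. y \<in> S \<Longrightarrow> F y = F y0 + (\<Sum>b\<in>C. ((y - y0) \<bullet> b) * G b y)"
proof
  let ?D = "\<lambda>b w. frechet_derivative F (at w) b"
  show "smooth_on S (radial_integral y0 0 (?D b))" for b
    using smooth_on_derivative[OF F, of b] unfolding smooth_on_def by (simp add: radial_integral_Ck)
  show "radial_integral y0 0 (?D b) y0 = ?D b y0" for b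
    by (simp add: radial_integral_def)
  fix y assume y: "y \<in> S"
  have "((\<lambda>t. F (y0 + t *\<^sub>R (y - y0))) has_vector_derivative
      (\<Sum>b\<in>C. ((y - y0) \<bullet> b) * ?D b (y0 + t *\<^sub>R (y - y0)))) (at t within {0..1})"
    if "t \<in> {0..1}" for t
  proof -
    let ?p = "y0 + t *\<^sub>R (y - y0)"
    have "?p \<in> S" using radial_in[OF y, of t] that by simp
    then have D: "(F has_derivative frechet_derivative F (at ?p)) (at ?p)"
      using smooth_on_imp_differentiable[OF F] by (simp flip: frechet_derivative_works)
    have "((\<lambda>t. y0 + t *\<^sub>R (y - y0)) has_derivative (\<lambda>r. r *\<^sub>R (y - y0))) (at t)"
      by (auto intro!: derivative_eq_intros)
    from has_derivative_compose[OF this D]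
    have "((\<lambda>t. F (y0 + t *\<^sub>R (y - y0))) has_derivative
      (\<lambda>r. frechet_derivative F (at ?p) (r *\<^sub>R (y - y0)))) (at t)" .
    moreover have "frechet_derivative F (at ?p) (r *\<^sub>R (y - y0)) =
        r *\<^sub>R (\<Sum>b\<in>C. ((y - y0) \<bullet> b) * ?D b ?p)" for r
      unfolding linear_orthonormal_expansion[OF C has_derivative_bounded_linear[OF D], of "r *\<^sub>R (y - y0)"]
      by (simp add: sum_distrib_left algebra_simps)
    ultimately show ?thesis
      unfolding has_vector_derivative_def
      by (simp only:) (rule has_derivative_at_withinI)
  qed
  then have "((\<lambda>t. \<Sum>b\<in>C. ((y - y0) \<bullet> b) * ?D b (y0 + t *\<^sub>R (y - y0))) has_integral
      F (y0 + 1 *\<^sub>R (y - y0)) - F (y0 + 0 *\<^sub>R (y - y0))) {0..1}"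
    by (intro fundamental_theorem_of_calculus) auto
  then have "F y - F y0 = integral {0..1} (\<lambda>t. \<Sum>b\<in>C. ((y - y0) \<bullet> b) * ?D b (y0 + t *\<^sub>R (y - y0)))"
    by (simp add: integral_unique)
  also have "\<dots> = (\<Sum>b\<in>C. ((y - y0) \<bullet> b) * radial_integral y0 0 (?D b) y)"
    using radial_integrable[OF smooth_on_imp_continuous_on[OF smooth_on_derivative[OF F]] y, of 0]
    unfolding radial_integral_def
    by (subst integral_sum) (auto intro: integrable_on_mult_right orthonormal_basis_finite[OF C])
  finally show "F y = F y0 + (\<Sum>b\<in>C. ((y - y0) \<bullet> b) * radial_integral y0 0 (?D b) y)"
    by simp
qed

end

section \<open>Smooth functions on manifolds\<close>

locale manifold =
  fixes \<A> :: "('m::{t2_space, second_countable_topology}, 'e::real_inner) chart set"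
  assumes manifold: "smooth_manifold \<A>"
begin

lemma model_basis: obtains C :: "'e set" where "orthonormal_basis C"
proof -
  have "\<exists>B::'e set. finite B \<and> span B = UNIV"
    using manifold unfolding smooth_manifold_def by (elim conjE)
  from orthonormal_basis_exists[OF this that] show ?thesis .
qed

lemmas charts_cover = manifold[unfolded smooth_manifold_def, THEN conjunct2, THEN conjunct1]
lemmas charts_homeo = manifold[unfolded smooth_manifold_def, THEN conjunct2, THEN conjunct2, THEN conjunct1]
lemmas charts_transition =
  manifold[unfolded smooth_manifold_def, THEN conjunct2, THEN conjunct2, THEN conjunct2]

lemma chart_at: obtains U \<phi> where "(U, \<phi>) \<in> \<A>" "p \<in> U"
proof -
  have "p \<in> (\<Union>(U, \<phi>)\<in>\<A>. U)" by (simp add: charts_cover)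
  then show ?thesis using that by auto
qed

context
  fixes U \<phi>
  assumes chart: "(U, \<phi>) \<in> \<A>"
begin

lemma chart_open: "open U" "open (\<phi> ` U)"
  and chart_homeomorphism: "homeomorphism U (\<phi> ` U) \<phi> (inv_into U \<phi>)"
  using charts_homeo[THEN bspec, OF chart] by simp_all

lemma chart_inv [simp]: "p \<in> U \<Longrightarrow> inv_into U \<phi> (\<phi> p) = p"
  using chart_homeomorphism unfolding homeomorphism_def by blast

lemma chart_continuous: "continuous_on U \<phi>" "continuous_on (\<phi> ` U) (inv_into U \<phi>)"
  using chart_homeomorphism unfolding homeomorphism_def by blast+

lemma chart_image_open: "open S \<Longrightarrow> S \<subseteq> U \<Longrightarrow> open (\<phi> ` S)"
proof -
  assume S: "open S" "S \<subseteq> U"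
  have "\<phi> ` S = inv_into U \<phi> -` S \<inter> \<phi> ` U"
    using S(2) by (auto simp: subset_eq image_iff)
  then show ?thesis
    using continuous_on_open_vimage[OF chart_open(2), THEN iffD1, rule_format,
        OF chart_continuous(2) S(1)] by simp
qed

lemma chart_transition:
  "(W, \<psi>) \<in> \<A> \<Longrightarrow> smooth_on (\<phi> ` (U \<inter> W)) (\<psi> \<circ> inv_into U \<phi>)"
  using charts_transition[THEN bspec, OF chart] by fastforce

end

lemma smooth_fun_onD:
  "smooth_fun_on \<A> S f \<Longrightarrow> (U, \<phi>) \<in> \<A> \<Longrightarrow> smooth_on (\<phi> ` (U \<inter> S)) (\<lambda>u. f (inv_into U \<phi> u))"
  unfolding smooth_fun_on_def comp_def by blast

lemma smooth_fun_onI: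
  "(\<And>U \<phi>. (U, \<phi>) \<in> \<A> \<Longrightarrow> smooth_on (\<phi> ` (U \<inter> S)) (\<lambda>u. f (inv_into U \<phi> u))) \<Longrightarrow> smooth_fun_on \<A> S f"
  unfolding smooth_fun_on_def comp_def by blast

lemma smooth_fun_on_subset: "smooth_fun_on \<A> S f \<Longrightarrow> T \<subseteq> S \<Longrightarrow> smooth_fun_on \<A> T f"
  by (rule smooth_fun_onI) (rule smooth_on_subset[OF smooth_fun_onD], auto)

lemma smooth_fun_on_cong:
  assumes "open S" "\<And>p. p \<in> S \<Longrightarrow> f p = g p" "smooth_fun_on \<A> S f"
  shows "smooth_fun_on \<A> S g"
proof (rule smooth_fun_onI)
  fix U \<phi> assume c: "(U, \<phi>) \<in> \<A>"
  show "smooth_on (\<phi> ` (U \<inter> S)) (\<lambda>u. g (inv_into U \<phi> u))"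
  proof (rule smooth_on_cong[OF _ _ smooth_fun_onD[OF assms(3) c]])
    show "open (\<phi> ` (U \<inter> S))"
      using chart_open(1)[OF c] assms(1) by (intro chart_image_open[OF c]) auto
    show "f (inv_into U \<phi> u) = g (inv_into U \<phi> u)" if "u \<in> \<phi> ` (U \<inter> S)" for u
      using that assms(2) chart_inv[OF c] by auto
  qed
qed

lemma smooth_fun_on_local:
  assumes "\<And>p. p \<in> S \<Longrightarrow> \<exists>T. open T \<and> p \<in> T \<and> smooth_fun_on \<A> T f"
  shows "smooth_fun_on \<A> S f"
proof (rule smooth_fun_onI, rule smooth_on_local)
  fix U \<phi> x assume c: "(U, \<phi>) \<in> \<A>" and "x \<in> \<phi> ` (U \<inter> S)"
  then obtain p where p: "p \<in> U" "p \<in> S" "x = \<phi> p" by blast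
  obtain T where T: "open T" "p \<in> T" "smooth_fun_on \<A> T f" using assms p(2) by blast
  show "\<exists>T. open T \<and> x \<in> T \<and> smooth_on T (\<lambda>u. f (inv_into U \<phi> u))"
    using smooth_fun_onD[OF T(3) c] chart_image_open[OF c, of "U \<inter> T"] chart_open(1)[OF c] T p
    by (intro exI[of _ "\<phi> ` (U \<inter> T)"]) auto
qed

lemma smooth_fun_on_const: "open S \<Longrightarrow> smooth_fun_on \<A> S (\<lambda>_. c)"
  by (rule smooth_fun_onI, rule smooth_on_const) (auto intro: chart_image_open dest: chart_open(1))

lemma smooth_fun_on_linear_comp:
  "bounded_linear L \<Longrightarrow> open S \<Longrightarrow> smooth_fun_on \<A> S f \<Longrightarrow> smooth_fun_on \<A> S (\<lambda>p. L (f p))"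
  by (rule smooth_fun_onI, rule smooth_on_linear_comp)
    (auto intro: chart_image_open smooth_fun_onD dest: chart_open(1))

lemma smooth_fun_on_add:
  "open S \<Longrightarrow> smooth_fun_on \<A> S f \<Longrightarrow> smooth_fun_on \<A> S g \<Longrightarrow> smooth_fun_on \<A> S (\<lambda>p. f p + g p)"
  by (rule smooth_fun_onI, rule smooth_on_add)
    (auto intro: chart_image_open smooth_fun_onD dest: chart_open(1))

lemma smooth_fun_on_Pair:
  "open S \<Longrightarrow> smooth_fun_on \<A> S f \<Longrightarrow> smooth_fun_on \<A> S g \<Longrightarrow> smooth_fun_on \<A> S (\<lambda>p. (f p, g p))"
  by (rule smooth_fun_onI, rule smooth_on_Pair)
    (auto intro: chart_image_open smooth_fun_onD dest: chart_open(1))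

lemma smooth_fun_on_bilinear:
  "bounded_bilinear pr \<Longrightarrow> open S \<Longrightarrow> smooth_fun_on \<A> S f \<Longrightarrow> smooth_fun_on \<A> S g
    \<Longrightarrow> smooth_fun_on \<A> S (\<lambda>p. pr (f p) (g p))"
  by (rule smooth_fun_onI, rule smooth_on_bilinear)
    (auto intro: chart_image_open smooth_fun_onD dest: chart_open(1))

lemmas smooth_fun_on_mult = smooth_fun_on_bilinear[OF bounded_bilinear_mult]
lemmas smooth_fun_on_inner = smooth_fun_on_bilinear[OF bounded_bilinear_inner]
lemmas smooth_fun_on_scaleR = smooth_fun_on_bilinear[OF bounded_bilinear_scaleR]

lemma smooth_fun_on_sum:
  "open S \<Longrightarrow> (\<And>i. i \<in> I \<Longrightarrow> smooth_fun_on \<A> S (f i)) \<Longrightarrow> smooth_fun_on \<A> S (\<lambda>p. \<Sum>i\<in>I. f i p)"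
  by (rule smooth_fun_onI, rule smooth_on_sum)
    (auto intro: chart_image_open smooth_fun_onD dest: chart_open(1))

lemma smooth_fun_on_compose:
  fixes f :: "'m \<Rightarrow> 'g::real_inner"
  assumes "orthonormal_basis (C :: 'g set)" "open S" "open T" "f ` S \<subseteq> T"
    and "smooth_fun_on \<A> S f" "smooth_on T G"
  shows "smooth_fun_on \<A> S (\<lambda>p. G (f p))"
proof (rule smooth_fun_onI, rule smooth_on_compose[OF assms(1) _ assms(3) _ _ assms(6)])
  fix U \<phi> assume c: "(U, \<phi>) \<in> \<A>"
  show "open (\<phi> ` (U \<inter> S))"
    using chart_open(1)[OF c] assms(2) by (intro chart_image_open[OF c]) auto
  show "(\<lambda>u. f (inv_into U \<phi> u)) ` \<phi> ` (U \<inter> S) \<subseteq> T"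
    using assms(4) chart_inv[OF c] by auto
qed (rule smooth_fun_onD[OF assms(5)])

lemma smooth_fun_on_chart:
  assumes "(U, \<phi>) \<in> \<A>" shows "smooth_fun_on \<A> U \<phi>"
proof (rule smooth_fun_onI)
  fix W \<psi> assume "(W, \<psi>) \<in> \<A>"
  from chart_transition[OF this assms] show "smooth_on (\<psi> ` (W \<inter> U)) (\<lambda>u. \<phi> (inv_into W \<psi> u))"
    by (simp add: comp_def)
qed

lemma C_infinityI: "smooth_fun_on \<A> UNIV f \<Longrightarrow> f \<in> C_infinity \<A>"
  and C_infinityD: "f \<in> C_infinity \<A> \<Longrightarrow> smooth_fun_on \<A> S f"
  unfolding C_infinity_def using smooth_fun_on_subset[of UNIV f S] by auto

lemma C_const [simp]: "(\<lambda>_. c) \<in> C_infinity \<A>"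
  by (intro C_infinityI smooth_fun_on_const) simp

lemma C_add: "f \<in> C_infinity \<A> \<Longrightarrow> g \<in> C_infinity \<A> \<Longrightarrow> (\<lambda>p. f p + g p) \<in> C_infinity \<A>"
  by (rule C_infinityI, rule smooth_fun_on_add) (auto intro: C_infinityD)

lemma C_mult: "f \<in> C_infinity \<A> \<Longrightarrow> g \<in> C_infinity \<A> \<Longrightarrow> (\<lambda>p. f p * g p) \<in> C_infinity \<A>"
  by (rule C_infinityI, rule smooth_fun_on_mult) (auto intro: C_infinityD)

lemma C_scale: "f \<in> C_infinity \<A> \<Longrightarrow> (\<lambda>p. c * f p) \<in> C_infinity \<A>"
  by (rule C_mult[OF C_const])

lemma C_uminus: "f \<in> C_infinity \<A> \<Longrightarrow> (\<lambda>p. - f p) \<in> C_infinity \<A>"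
  using C_scale[of f "-1"] by simp

lemma C_diff: "f \<in> C_infinity \<A> \<Longrightarrow> g \<in> C_infinity \<A> \<Longrightarrow> (\<lambda>p. f p - g p) \<in> C_infinity \<A>"
  using C_add[OF _ C_uminus, of f g] by simp

lemma C_sum: "(\<And>i. i \<in> I \<Longrightarrow> f i \<in> C_infinity \<A>) \<Longrightarrow> (\<lambda>p. \<Sum>i\<in>I. f i p) \<in> C_infinity \<A>"
  by (rule C_infinityI, rule smooth_fun_on_sum) (auto intro: C_infinityD)

lemma C_local:
  "(\<And>p. \<exists>T. open T \<and> p \<in> T \<and> smooth_fun_on \<A> T f) \<Longrightarrow> f \<in> C_infinity \<A>"
  by (intro C_infinityI smooth_fun_on_local) blast

section \<open>Cutoff functions on manifolds\<close>

text \<open>S and the complement of K are open and cover the manifold, and on the complement of K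
  the extension is 0. For this, K has to be closed in the manifold and not merely in S.\<close>

lemma bump_extend:
  assumes \<beta>: "\<beta> \<in> C_infinity \<A>" and K: "closed K" "K \<subseteq> S" "\<And>p. p \<notin> K \<Longrightarrow> \<beta> p = 0"
    and S: "open S" and f: "smooth_fun_on \<A> S f"
  shows "(\<lambda>p. if p \<in> S then \<beta> p * f p else 0) \<in> C_infinity \<A>"
proof (rule C_local)
  fix p
  let ?g = "\<lambda>p. if p \<in> S then \<beta> p * f p else 0"
  show "\<exists>T. open T \<and> p \<in> T \<and> smooth_fun_on \<A> T ?g"
  proof (cases "p \<in> S")
    case True
    have "smooth_fun_on \<A> S ?g"
      by (rule smooth_fun_on_cong[OF S _ smooth_fun_on_mult[OF S C_infinityD[OF \<beta>] f]]) simp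
    then show ?thesis using True S by blast
  next
    case False
    have "open (- K)" using K(1) by blast
    have "smooth_fun_on \<A> (- K) ?g"
      by (rule smooth_fun_on_cong[OF \<open>open (- K)\<close> _ smooth_fun_on_const[OF \<open>open (- K)\<close>, of 0]])
        (use K(3) in auto)
    then show ?thesis using False K by blast
  qed
qed

lemma bump_exists:
  assumes "open S" "p \<in> S"
  obtains \<beta> K V where "\<beta> \<in> C_infinity \<A>" "closed K" "K \<subseteq> S" "\<And>q. q \<notin> K \<Longrightarrow> \<beta> q = 0"
    "open V" "p \<in> V" "V \<subseteq> K" "\<And>q. q \<in> V \<Longrightarrow> \<beta> q = 1"
proof -
  obtain C :: "'e set" where C: "orthonormal_basis C" by (rule model_basis)
  obtain U \<phi> where c: "(U, \<phi>) \<in> \<A>" and p: "p \<in> U" by (rule chart_at)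
  note chart_inv[OF c, simp]
  have US: "open (U \<inter> S)" using chart_open(1)[OF c] assms(1) by blast
  then have "open (\<phi> ` (U \<inter> S))" using chart_image_open[OF c] by simp
  then obtain r where r: "r > 0" "cball (\<phi> p) r \<subseteq> \<phi> ` (U \<inter> S)"
    using open_contains_cball_eq p assms(2) by blast
  obtain f :: "'e \<Rightarrow> real" where f: "smooth_on UNIV f" "\<And>y. dist (\<phi> p) y \<ge> r \<Longrightarrow> f y = 0"
    "\<And>y. dist (\<phi> p) y \<le> r / 2 \<Longrightarrow> f y = 1"
    using bump_on_inner_space[OF r(1)] by metis
  define K where "K = inv_into U \<phi> ` cball (\<phi> p) r"
  define V where "V = \<phi> -` ball (\<phi> p) (r / 2) \<inter> U"
  define \<beta> where "\<beta> q = (if q \<in> U then f (\<phi> q) * indicator K q else 0)" for q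
  have K_iff: "q \<in> K \<longleftrightarrow> q \<in> U \<and> \<phi> q \<in> cball (\<phi> p) r" for q
  proof
    assume "q \<in> K"
    then obtain y where "y \<in> cball (\<phi> p) r" "q = inv_into U \<phi> y" by (auto simp: K_def)
    moreover from this r(2) obtain s where "s \<in> U" "y = \<phi> s" by blast
    ultimately show "q \<in> U \<and> \<phi> q \<in> cball (\<phi> p) r" by simp
  next
    assume "q \<in> U \<and> \<phi> q \<in> cball (\<phi> p) r"
    then show "q \<in> K" unfolding K_def by (metis chart_inv[OF c] imageI)
  qed
  have KS: "K \<subseteq> S"
  proof
    fix q assume "q \<in> K"
    then have "q \<in> U" "\<phi> q \<in> \<phi> ` (U \<inter> S)" using r(2) by (auto simp: K_iff)
    then obtain s where "s \<in> U \<inter> S" "\<phi> q = \<phi> s" by blast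
    then show "q \<in> S" using \<open>q \<in> U\<close> chart_inv[OF c] by (metis IntD1 IntD2)
  qed
  \<comment> \<open>As the image of a compact ball, K is closed in the manifold, which is Hausdorff.
    Closedness within U alone would not let 0 be a smooth continuation outside U.\<close>
  have "compact K"
    unfolding K_def
    by (intro compact_continuous_image compact_cball_orthonormal[OF C]
        continuous_on_subset[OF chart_continuous(2)[OF c]]) (use r(2) in auto)
  then have "closed K" by (rule compact_imp_closed)
  have V: "open V"
    unfolding V_def
    using continuous_on_open_vimage[OF chart_open(1)[OF c], THEN iffD1, rule_format,
        OF chart_continuous(1)[OF c] open_ball] .
  have \<beta>_eq: "\<beta> q = f (\<phi> q)" if "q \<in> U" for q
    using f(2)[of "\<phi> q"] that by (auto simp: \<beta>_def K_iff indicator_def)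
  have "\<beta> \<in> C_infinity \<A>"
  proof (rule C_local)
    fix q show "\<exists>T. open T \<and> q \<in> T \<and> smooth_fun_on \<A> T \<beta>"
    proof (cases "q \<in> U")
      case True
      have "smooth_fun_on \<A> U (\<lambda>q. f (\<phi> q))"
        by (rule smooth_fun_on_compose[OF C chart_open(1)[OF c] open_UNIV _ smooth_fun_on_chart[OF c] f(1)])
          simp
      then have "smooth_fun_on \<A> U \<beta>"
        by (rule smooth_fun_on_cong[OF chart_open(1)[OF c], rotated]) (simp add: \<beta>_eq)
      then show ?thesis using True chart_open(1)[OF c] by blast
    next
      case False
      have "open (- K)" using \<open>closed K\<close> by blast
      have "smooth_fun_on \<A> (- K) \<beta>"
        by (rule smooth_fun_on_cong[OF \<open>open (- K)\<close> _ smooth_fun_on_const[OF \<open>open (- K)\<close>, of 0]])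
          (auto simp: \<beta>_def)
      then show ?thesis using False \<open>open (- K)\<close> by (auto simp: K_iff)
    qed
  qed
  moreover have "\<beta> q = 0" if "q \<notin> K" for q using that by (simp add: \<beta>_def)
  moreover have "p \<in> V" "V \<subseteq> K" using p r by (auto simp: V_def K_iff)
  moreover have "\<beta> q = 1" if "q \<in> V" for q using that f(3)[of "\<phi> q"] by (auto simp: V_def \<beta>_eq)
  ultimately show ?thesis using that \<open>closed K\<close> KS V by blast
qed

end

section \<open>Smooth maps and product manifolds\<close>

lemma smooth_fun_on_map_compose:
  assumes "manifold \<A>" "manifold \<B>"
    and h: "smooth_map_on \<A> \<B> S h" and S: "open S" and T: "open T" and f: "smooth_fun_on \<B> T f"
  shows "smooth_fun_on \<A> (S \<inter> h -` T) (\<lambda>p. f (h p))"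
proof -
  interpret A: manifold \<A> by fact
  interpret B: manifold \<B> by fact
  obtain C where C: "orthonormal_basis (C :: 'd set)" by (rule B.model_basis)
  have cont: "continuous_on S h" using h unfolding smooth_map_on_def by blast
  then have op: "open (S \<inter> h -` X)" if "open X" for X
    using continuous_on_open_vimage[OF S, THEN iffD1, rule_format, OF cont that]
    by (simp add: Int_commute)
  show ?thesis
  proof (rule A.smooth_fun_on_local)
    fix p assume p: "p \<in> S \<inter> h -` T"
    obtain W \<psi> where W: "(W, \<psi>) \<in> \<B>" "h p \<in> W" by (rule B.chart_at)
    define R where "R = S \<inter> h -` (W \<inter> T)"
    have R: "open R" unfolding R_def using B.chart_open(1)[OF W(1)] T by (intro op) auto
    have "smooth_fun_on \<A> R (\<lambda>p. f (h p))"
    proof (rule A.smooth_fun_onI)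
      fix U \<phi> assume c: "(U, \<phi>) \<in> \<A>"
      let ?S = "\<phi> ` (U \<inter> R)"
      have oS: "open ?S"
        using R A.chart_open(1)[OF c] by (intro A.chart_image_open[OF c]) auto
      have "smooth_on (\<phi> ` (U \<inter> S \<inter> h -` W)) (\<psi> \<circ> h \<circ> inv_into U \<phi>)"
        using h c W(1) unfolding smooth_map_on_def by blast
      then have 1: "smooth_on ?S (\<lambda>u. \<psi> (h (inv_into U \<phi> u)))"
        unfolding comp_def by (rule smooth_on_subset) (auto simp: R_def)
      have "smooth_on ?S (\<lambda>u. f (inv_into W \<psi> (\<psi> (h (inv_into U \<phi> u)))))"
      proof (rule smooth_on_compose[OF C oS _ _ 1 B.smooth_fun_onD[OF f W(1)]])
        show "open (\<psi> ` (W \<inter> T))"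
          using B.chart_open(1)[OF W(1)] T by (intro B.chart_image_open[OF W(1)]) auto
        show "(\<lambda>u. \<psi> (h (inv_into U \<phi> u))) ` ?S \<subseteq> \<psi> ` (W \<inter> T)"
          using A.chart_inv[OF c] by (auto simp: R_def)
      qed
      then show "smooth_on ?S (\<lambda>u. f (h (inv_into U \<phi> u)))"
        by (rule smooth_on_cong[OF oS, rotated])
          (use A.chart_inv[OF c] B.chart_inv[OF W(1)] in \<open>auto simp: R_def\<close>)
    qed
    then show "\<exists>T. open T \<and> p \<in> T \<and> smooth_fun_on \<A> T (\<lambda>p. f (h p))"
      using R p W(2) by (auto simp: R_def)
  qed
qed

lemma times_chart_inv:
  assumes "inj_on \<phi> U" "u \<in> \<phi> ` U"
  shows "inv_into (U \<times> UNIV) (\<lambda>(p, k). (\<phi> p, k)) (u, k) = (inv_into U \<phi> u, k)"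
proof -
  obtain p where p: "p \<in> U" "u = \<phi> p" using assms(2) by blast
  have "inj_on (\<lambda>(p, k). (\<phi> p, k)) (U \<times> UNIV)"
    using assms(1) by (auto simp: inj_on_def)
  from inv_into_f_f[OF this, of "(p, k)"] show ?thesis
    using p assms(1) by simp
qed

lemma times_chart_image: "(\<lambda>(p, k). (\<phi> p, k)) ` (U \<times> T) = \<phi> ` U \<times> T"
  by force

text \<open>Affine trivializations are diffeomorphisms onto products \<open>U \<times> UNIV\<close>
  with the product atlas; knowing this atlas to be a manifold makes the smoothness rules available
  on both sides of a trivialization.\<close>

lemma manifold_times_atlas:
  fixes \<A> :: "('m::{t2_space, second_countable_topology}, 'e::real_inner) chart set"
  assumes "manifold \<A>"
  shows "manifold (times_atlas \<A> :: ('m \<times> 'f::euclidean_space, 'e \<times> 'f) chart set)"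
proof -
  interpret manifold \<A> by fact
  obtain C where C: "orthonormal_basis (C :: 'e set)" by (rule model_basis)
  let ?D = "(\<lambda>b. (b, 0)) ` C \<union> Pair 0 ` (Basis :: 'f set)"
  have "finite ?D" using orthonormal_basis_finite[OF C] by simp
  moreover have "span ?D = UNIV"
  proof (intro equalityI subset_UNIV subsetI)
    fix z :: "'e \<times> 'f"
    have "(\<Sum>b\<in>C. (fst z \<bullet> b) *\<^sub>R (b, 0 :: 'f)) + (\<Sum>i\<in>Basis. (snd z \<bullet> i) *\<^sub>R (0 :: 'e, i)) = z"
      using orthonormal_expansion[OF C, of "fst z"] euclidean_representation[of "snd z"]
      by (auto simp: prod_eq_iff fst_sum snd_sum)
    moreover have "(\<Sum>b\<in>C. (fst z \<bullet> b) *\<^sub>R (b, 0 :: 'f)) + (\<Sum>i\<in>Basis. (snd z \<bullet> i) *\<^sub>R (0 :: 'e, i)) \<in> span ?D"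
      by (intro span_add span_sum span_scale span_base) auto
    ultimately show "z \<in> span ?D" by simp
  qed
  moreover have "(\<Union>(U, \<phi>)\<in>times_atlas \<A>. U) = (UNIV :: ('m \<times> 'f) set)"
  proof -
    have "\<exists>c\<in>times_atlas \<A>. (p, k) \<in> fst c" for p :: 'm and k :: 'f
    proof -
      obtain U \<phi> where "(U, \<phi>) \<in> \<A>" "p \<in> U" by (rule chart_at)
      then show ?thesis unfolding times_atlas_def by force
    qed
    then show ?thesis by (fastforce simp: split_beta)
  qed
  moreover have "open U' \<and> open (\<phi>' ` U') \<and> homeomorphism U' (\<phi>' ` U') \<phi>' (inv_into U' \<phi>')"
    if c': "(U', \<phi>') \<in> times_atlas \<A>" for U' :: "('m \<times> 'f) set" and \<phi>' :: "'m \<times> 'f \<Rightarrow> 'e \<times> 'f"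
  proof -
    obtain U \<phi> where c: "(U, \<phi>) \<in> \<A>" and [simp]: "U' = U \<times> UNIV" "\<phi>' = (\<lambda>(p, k). (\<phi> p, k))"
      using c' unfolding times_atlas_def by auto
    have inj: "inj_on \<phi> U" using chart_inv[OF c] by (metis inj_on_inverseI)
    have "continuous_on (U \<times> UNIV) (\<lambda>z. (\<phi> (fst z), snd z))"
      by (intro continuous_intros continuous_on_compose2[OF chart_continuous(1)[OF c]]) auto
    moreover have "continuous_on (\<phi> ` U \<times> UNIV) (\<lambda>z. (inv_into U \<phi> (fst z), snd z))"
      by (intro continuous_intros continuous_on_compose2[OF chart_continuous(2)[OF c]]) auto
    then have "continuous_on (\<phi> ` U \<times> UNIV) (inv_into (U \<times> UNIV) (\<lambda>(p, k). (\<phi> p, k :: 'f)))"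
      by (rule continuous_on_eq) (auto simp: times_chart_inv[OF inj])
    moreover have "inv_into (U \<times> UNIV) (\<lambda>(p, k). (\<phi> p, k :: 'f)) (\<phi> p, k) = (p, k)" if "p \<in> U" for p k
      using that by (subst times_chart_inv[OF inj]) (auto simp: chart_inv[OF c])
    ultimately have "homeomorphism (U \<times> UNIV) (\<phi> ` U \<times> UNIV) (\<lambda>(p, k). (\<phi> p, k :: 'f))
        (inv_into (U \<times> UNIV) (\<lambda>(p, k). (\<phi> p, k)))"
      by (intro homeomorphismI) (auto simp: split_beta)
    then show ?thesis
      using chart_open[OF c] by (auto simp: times_chart_image intro: open_Times)
  qed
  moreover have "smooth_on (\<phi>' ` (U' \<inter> W')) (\<psi>' \<circ> inv_into U' \<phi>')"
    if c': "(U', \<phi>') \<in> times_atlas \<A>" and d': "(W', \<psi>') \<in> times_atlas \<A>"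
    for U' W' :: "('m \<times> 'f) set" and \<phi>' \<psi>' :: "'m \<times> 'f \<Rightarrow> 'e \<times> 'f"
  proof -
    obtain U \<phi> where c: "(U, \<phi>) \<in> \<A>" and [simp]: "U' = U \<times> UNIV" "\<phi>' = (\<lambda>(p, k). (\<phi> p, k))"
      using c' unfolding times_atlas_def by auto
    obtain W \<psi> where d: "(W, \<psi>) \<in> \<A>" and [simp]: "W' = W \<times> UNIV" "\<psi>' = (\<lambda>(p, k). (\<psi> p, k))"
      using d' unfolding times_atlas_def by auto
    have inj: "inj_on \<phi> U" using chart_inv[OF c] by (metis inj_on_inverseI)
    let ?S = "\<phi> ` (U \<inter> W)"
    have oS: "open ?S"
      using chart_open(1)[OF c] chart_open(1)[OF d] by (intro chart_image_open[OF c]) auto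
    then have oSU: "open (?S \<times> (UNIV :: 'f set))" by (intro open_Times) auto
    have "smooth_on (?S \<times> UNIV) (\<lambda>z::'e \<times> 'f. (\<psi> \<circ> inv_into U \<phi>) (fst z))"
      by (rule smooth_on_compose[OF C oSU oS _ smooth_on_linear_comp[OF bounded_linear_fst oSU smooth_on_id[OF oSU]]
            chart_transition[OF c d]]) auto
    then have "smooth_on (?S \<times> UNIV) (\<lambda>z::'e \<times> 'f. ((\<psi> \<circ> inv_into U \<phi>) (fst z), snd z))"
      by (intro smooth_on_Pair oSU smooth_on_linear_comp[OF bounded_linear_snd oSU smooth_on_id[OF oSU]])
    then have "smooth_on (?S \<times> UNIV) (\<psi>' \<circ> inv_into U' \<phi>')"
      by (rule smooth_on_cong[OF oSU, rotated]) (auto simp: times_chart_inv[OF inj])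
    moreover have "\<phi>' ` (U' \<inter> W') = ?S \<times> UNIV"
      using times_chart_image[of \<phi> "U \<inter> W" UNIV] by (simp add: Times_Int_Times)
    ultimately show ?thesis by simp
  qed
  ultimately show ?thesis
    unfolding manifold_def smooth_manifold_def
    by (intro conjI exI[of _ ?D] ballI; clarify?) blast+
qed

section \<open>Tangent vectors\<close>

context manifold
begin

lemma tangent_add_fun:
  "v \<in> tangent_space \<A> x \<Longrightarrow> f \<in> C_infinity \<A> \<Longrightarrow> g \<in> C_infinity \<A> \<Longrightarrow> v (\<lambda>q. f q + g q) = v f + v g"
  and tangent_scale_fun: "v \<in> tangent_space \<A> x \<Longrightarrow> f \<in> C_infinity \<A> \<Longrightarrow> v (\<lambda>q. c * f q) = c * v f"
  and tangent_mult_fun: "v \<in> tangent_space \<A> x \<Longrightarrow> f \<in> C_infinity \<A> \<Longrightarrow> g \<in> C_infinity \<A>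
    \<Longrightarrow> v (\<lambda>q. f q * g q) = f x * v g + g x * v f"
  by (simp_all add: tangent_space_def)

lemma tangent_outside: "v \<in> tangent_space \<A> x \<Longrightarrow> f \<notin> C_infinity \<A> \<Longrightarrow> v f = undefined"
  unfolding tangent_space_def mem_Collect_eq by (elim conjE) (rule PiE_arb[of v])

lemma tangent_spaceI:
  assumes "\<And>f. f \<notin> C_infinity \<A> \<Longrightarrow> v f = undefined"
    and "\<And>f g. f \<in> C_infinity \<A> \<Longrightarrow> g \<in> C_infinity \<A> \<Longrightarrow> v (\<lambda>q. f q + g q) = v f + v g"
    and "\<And>c f. f \<in> C_infinity \<A> \<Longrightarrow> v (\<lambda>q. c * f q) = c * v f"
    and "\<And>f g. f \<in> C_infinity \<A> \<Longrightarrow> g \<in> C_infinity \<A> \<Longrightarrow> v (\<lambda>q. f q * g q) = f x * v g + g x * v f"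
  shows "v \<in> tangent_space \<A> x"
  unfolding tangent_space_def by (simp add: assms PiE_iff extensional_def)

lemma tangent_eqI:
  assumes "v \<in> tangent_space \<A> x" "w \<in> tangent_space \<A> y" "\<And>f. f \<in> C_infinity \<A> \<Longrightarrow> v f = w f"
  shows "v = w"
  using assms(3) tangent_outside[OF assms(1)] tangent_outside[OF assms(2)] by (intro ext) fastforce

lemma tangent_const: "v \<in> tangent_space \<A> x \<Longrightarrow> v (\<lambda>_. c) = 0"
proof -
  assume v: "v \<in> tangent_space \<A> x"
  have "v (\<lambda>_. 1) = 0" using tangent_mult_fun[OF v C_const[of 1] C_const[of 1]] by simp
  then show ?thesis using tangent_scale_fun[OF v C_const[of 1], of c] by simp
qed

lemma tangent_diff_fun:
  "v \<in> tangent_space \<A> x \<Longrightarrow> f \<in> C_infinity \<A> \<Longrightarrow> g \<in> C_infinity \<A> \<Longrightarrow> v (\<lambda>q. f q - g q) = v f - v g"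
  using tangent_add_fun[of v x f "\<lambda>q. (-1) * g q"] tangent_scale_fun[of v x g "-1"] C_scale[of g "-1"]
  by simp

lemma tangent_sum_fun:
  assumes v: "v \<in> tangent_space \<A> x" and "\<And>i. i \<in> I \<Longrightarrow> f i \<in> C_infinity \<A>"
  shows "v (\<lambda>q. \<Sum>i\<in>I. f i q) = (\<Sum>i\<in>I. v (f i))"
  using assms(2)
proof (induction I rule: infinite_finite_induct)
  case (insert i I)
  then show ?case
    using tangent_add_fun[OF v, of "f i" "\<lambda>q. \<Sum>i\<in>I. f i q"] by (simp add: C_sum)
qed (use tangent_const[OF v] in auto)

text \<open>For a cutoff \<beta> supported in V with \<beta> = 1 near x one has \<beta> f = \<beta>,
  and the Leibniz rule turns this into v \<beta> = v f + v \<beta>.\<close>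

lemma tangent_locally_const:
  assumes v: "v \<in> tangent_space \<A> x" and V: "open V" "x \<in> V"
    and f: "f \<in> C_infinity \<A>" "\<And>q. q \<in> V \<Longrightarrow> f q = 1"
  shows "v f = 0"
proof -
  obtain \<beta> K W where \<beta>: "\<beta> \<in> C_infinity \<A>" "closed K" "K \<subseteq> V" "\<And>q. q \<notin> K \<Longrightarrow> \<beta> q = 0"
    "open W" "x \<in> W" "W \<subseteq> K" "\<And>q. q \<in> W \<Longrightarrow> \<beta> q = 1"
    by (rule bump_exists[OF V]) (rule that)
  have "\<beta> q * f q = \<beta> q" for q
    using \<beta>(3) \<beta>(4)[of q] f(2)[of q] by (cases "q \<in> K") auto
  then have "(\<lambda>q. \<beta> q * f q) = \<beta>" by blast
  then show ?thesis
    using tangent_mult_fun[OF v \<beta>(1) f(1)] \<beta>(6,8) f(2)[OF V(2)] by simp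
qed

text \<open>
  Multiplying \<open>f\<close> by the square of a cutoff function turns Hadamard's decomposition of \<open>F\<close> into an
  identity between globally defined smooth functions, to which the derivation can be applied.
\<close>

lemma tangent_hadamard:
  fixes y :: "'m \<Rightarrow> 'g::real_inner"
  assumes v: "v \<in> tangent_space \<A> x" and C: "orthonormal_basis C" and S: "open S" "convex S"
    and y: "\<And>z. z \<in> N \<Longrightarrow> y z \<in> S" and x: "x \<in> N"
    and extend: "\<And>G. smooth_on S G \<Longrightarrow> (\<lambda>z. if z \<in> N then \<beta> z * G (y z) else 0) \<in> C_infinity \<A>"
    and \<beta>: "\<beta> x = 1" "v (\<lambda>z. if z \<in> N then \<beta> z else 0) = 0"
    and f: "f \<in> C_infinity \<A>" "smooth_on S F" "\<And>z. z \<in> N \<Longrightarrow> f z = F (y z)"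
  shows "v f = (\<Sum>b\<in>C. frechet_derivative F (at (y x)) b * v (\<lambda>z. if z \<in> N then \<beta> z * (y z \<bullet> b) else 0))"
proof -
  define e where "e G z = (if z \<in> N then \<beta> z * G (y z) else 0)" for G z
  define e1 where "e1 = e (\<lambda>_. 1)"
  have e: "e G \<in> C_infinity \<A>" if "smooth_on S G" for G
    unfolding e_def using extend[OF that] .
  have e1: "e1 \<in> C_infinity \<A>" "e1 x = 1" "v e1 = 0"
  proof -
    have e1_eq: "e1 = (\<lambda>z. if z \<in> N then \<beta> z else 0)"
      by (simp add: e1_def e_def fun_eq_iff)
    show "v e1 = 0" "e1 x = 1" using \<beta> x by (simp_all add: e1_eq)
    show "e1 \<in> C_infinity \<A>" using e[of "\<lambda>_. 1"] S by (simp add: e1_def)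
  qed
  obtain G where G: "\<And>b. smooth_on S (G b)" "\<And>b. G b (y x) = frechet_derivative F (at (y x)) b"
    "\<And>u. u \<in> S \<Longrightarrow> F u = F (y x) + (\<Sum>b\<in>C. ((u - y x) \<bullet> b) * G b u)"
    using hadamard[OF S y[OF x] C f(2)] by metis
  have lin: "smooth_on S (\<lambda>u. u \<bullet> b)" "smooth_on S (\<lambda>u. (u - y x) \<bullet> b)" for b
  proof -
    show *: "smooth_on S (\<lambda>u. u \<bullet> b)"
      by (rule smooth_on_linear_comp[OF bounded_linear_inner_left S(1) smooth_on_id[OF S(1)]])
    show "smooth_on S (\<lambda>u. (u - y x) \<bullet> b)"
      using smooth_on_add[OF S(1) * smooth_on_const[OF S(1), of "- (y x \<bullet> b)"]]
      by (simp add: inner_diff_left)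
  qed
  let ?l = "\<lambda>b. e (\<lambda>u. (u - y x) \<bullet> b)"
  have vl: "v (?l b) = v (e (\<lambda>u. u \<bullet> b))" for b
  proof -
    have "?l b = (\<lambda>z. e (\<lambda>u. u \<bullet> b) z - (y x \<bullet> b) * e1 z)"
      by (rule ext) (simp add: e_def e1_def inner_diff_left algebra_simps)
    then show ?thesis
      using tangent_diff_fun[OF v e[OF lin(1)] C_scale[OF e1(1)]] tangent_scale_fun[OF v e1(1)] e1(3)
      by simp
  qed
  have e1sq: "v (\<lambda>z. e1 z * e1 z) = 0" "(\<lambda>z. e1 z * e1 z) \<in> C_infinity \<A>"
    using tangent_mult_fun[OF v e1(1) e1(1)] e1(3) C_mult[OF e1(1) e1(1)] by auto
  have "(\<lambda>z. f z * (e1 z * e1 z)) = (\<lambda>z. F (y x) * (e1 z * e1 z) + (\<Sum>b\<in>C. ?l b z * e (G b) z))"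
  proof
    fix z
    show "f z * (e1 z * e1 z) = F (y x) * (e1 z * e1 z) + (\<Sum>b\<in>C. ?l b z * e (G b) z)"
    proof (cases "z \<in> N")
      case True
      then have "f z * (e1 z * e1 z) =
          (F (y x) + (\<Sum>b\<in>C. ((y z - y x) \<bullet> b) * G b (y z))) * (\<beta> z * \<beta> z)"
        using f(3) G(3)[OF y[OF True]] by (simp add: e1_def e_def)
      also have "\<dots> = F (y x) * (\<beta> z * \<beta> z) + (\<Sum>b\<in>C. ?l b z * e (G b) z)"
        using True by (simp add: e_def algebra_simps sum_distrib_left)
      finally show ?thesis using True by (simp add: e1_def e_def)
    qed (simp add: e_def e1_def)
  qed
  then have "v (\<lambda>z. f z * (e1 z * e1 z)) =
      v (\<lambda>z. F (y x) * (e1 z * e1 z) + (\<Sum>b\<in>C. ?l b z * e (G b) z))"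
    by simp
  moreover have "v (\<lambda>z. f z * (e1 z * e1 z)) = v f"
    using tangent_mult_fun[OF v f(1) e1sq(2)] e1sq(1) e1(2) by simp
  moreover have "v (\<lambda>z. F (y x) * (e1 z * e1 z) + (\<Sum>b\<in>C. ?l b z * e (G b) z)) =
      (\<Sum>b\<in>C. v (\<lambda>z. ?l b z * e (G b) z))"
    using tangent_add_fun[OF v C_scale[OF e1sq(2)] C_sum, of C "\<lambda>b z. ?l b z * e (G b) z" "F (y x)"]
      tangent_scale_fun[OF v e1sq(2)] tangent_sum_fun[OF v, of C "\<lambda>b z. ?l b z * e (G b) z"] e1sq(1)
    by (simp add: C_mult e lin G(1))
  moreover have "v (\<lambda>z. ?l b z * e (G b) z) = frechet_derivative F (at (y x)) b * v (e (\<lambda>u. u \<bullet> b))" for b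
    using tangent_mult_fun[OF v e[OF lin(2)] e[OF G(1)]] x \<beta>(1) G(2) vl[of b]
    by (simp add: e_def[of _ x])
  ultimately show ?thesis by (simp add: e_def[abs_def])
qed

end

section \<open>Affine bundles\<close>

locale affine_bdl =
  fixes B :: "('a::{t2_space, second_countable_topology}, 'm::{t2_space, second_countable_topology},
               'v, 'e::real_inner, 'f::euclidean_space) abundle"
    and n :: nat
  assumes affine_bundle: "affine_bundle n B"
begin

abbreviation "bA \<equiv> base_atlas B"
abbreviation "tA \<equiv> total_atlas B"
abbreviation "aff \<equiv> aff_dual B"
abbreviation "\<pi> \<equiv> proj B"
abbreviation "CM \<equiv> C_infinity bA"
abbreviation "CA \<equiv> C_infinity tA"
abbreviation "AF \<equiv> affine_functions B"

lemma base_manifold: "smooth_manifold bA"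
  and total_manifold: "smooth_manifold tA"
  and proj_smooth: "smooth_map_on tA bA UNIV \<pi>"
  and model_bundle: "vector_bundle bA (model B)"
  and triv_at: "\<exists>U \<tau>. p \<in> U \<and> affine_triv B (U, \<tau>)"
  using affine_bundle unfolding affine_bundle_def by simp_all

lemma transl_props:
  assumes "x \<in> afibre B p"
  shows "v \<in> fibre (model B) p \<Longrightarrow> transl B x v \<in> afibre B p"
    and "y \<in> afibre B p \<Longrightarrow> \<exists>v. v \<in> fibre (model B) p \<and> transl B x v = y"
proof -
  have "\<forall>v\<in>fibre (model B) p. transl B x v \<in> afibre B p"
    and ex1: "\<forall>y\<in>afibre B p. \<exists>!v. v \<in> fibre (model B) p \<and> transl B x v = y"
    using affine_bundle assms unfolding affine_bundle_def by simp_all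
  then show "v \<in> fibre (model B) p \<Longrightarrow> transl B x v \<in> afibre B p" by blast
  show "\<exists>v. v \<in> fibre (model B) p \<and> transl B x v = y" if "y \<in> afibre B p"
    using ex1[rule_format, OF that] by (rule ex1_implies_ex)
qed

lemma model_closed:
  "x \<in> fibre (model B) p \<Longrightarrow> y \<in> fibre (model B) p \<Longrightarrow> vadd (model B) p x y \<in> fibre (model B) p"
  "x \<in> fibre (model B) p \<Longrightarrow> vscale (model B) p c x \<in> fibre (model B) p"
  using model_bundle unfolding vector_bundle_def by simp_all

sublocale M: manifold bA by unfold_locales (rule base_manifold)
sublocale T: manifold tA by unfold_locales (rule total_manifold)

lemma times_manifold: "manifold (times_atlas bA :: ('m \<times> 'f, 'e \<times> 'f) chart set)"
  by (rule manifold_times_atlas) unfold_locales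

lemma proj_continuous: "continuous_on UNIV \<pi>"
  using proj_smooth unfolding smooth_map_on_def by blast

lemma open_proj_vimage: "open S \<Longrightarrow> open (\<pi> -` S)"
  using proj_continuous by (simp add: continuous_on_open_vimage)

lemma closed_proj_vimage: "closed S \<Longrightarrow> closed (\<pi> -` S)"
  using proj_continuous by (simp add: continuous_on_closed_vimage)

lemma smooth_pullback:
  assumes "open S" "smooth_fun_on bA S f"
  shows "smooth_fun_on tA (\<pi> -` S) (\<lambda>x. f (\<pi> x))"
  using smooth_fun_on_map_compose[OF T.manifold_axioms M.manifold_axioms proj_smooth open_UNIV assms]
  by simp

lemma CM_pullback: "f \<in> CM \<Longrightarrow> (\<lambda>x. f (\<pi> x)) \<in> CA"
  using smooth_pullback[OF open_UNIV M.C_infinityD] by (intro T.C_infinityI) simp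

lemma afibre_iff [simp]: "x \<in> afibre B p \<longleftrightarrow> \<pi> x = p"
  unfolding afibre_def by simp

section \<open>Affine trivializations in coordinates\<close>

context
  fixes U \<tau>
  assumes triv: "affine_triv B (U, \<tau>)"
begin

definition "lift p k = inv_into (\<pi> -` U) (\<lambda>x. (\<pi> x, \<tau> x)) (p, k)"

lemma triv_open: "open U"
  using triv unfolding affine_triv_def by simp

lemma triv_diffeo:
  "diffeomorphism_on tA (times_atlas bA) (\<pi> -` U) (U \<times> UNIV) (\<lambda>x. (\<pi> x, \<tau> x))"
  using triv unfolding affine_triv_def by simp

lemma triv_linear:
  obtains t where "linear_triv (model B) (U, t)"
    "\<And>p x v. p \<in> U \<Longrightarrow> x \<in> afibre B p \<Longrightarrow> v \<in> fibre (model B) p \<Longrightarrow> \<tau> (transl B x v) = \<tau> x + t p v"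
  using triv unfolding affine_triv_def vb_triv_def by auto

lemma triv_bij: "bij_betw (\<lambda>x. (\<pi> x, \<tau> x)) (\<pi> -` U) (U \<times> UNIV)"
  using triv_diffeo unfolding diffeomorphism_on_def by simp

lemma lift_props:
  assumes "p \<in> U" shows "\<pi> (lift p k) = p" "\<tau> (lift p k) = k"
proof -
  have "(p, k) \<in> (\<lambda>x. (\<pi> x, \<tau> x)) ` (\<pi> -` U)"
    using assms triv_bij unfolding bij_betw_def by simp
  from f_inv_into_f[OF this] show "\<pi> (lift p k) = p" "\<tau> (lift p k) = k"
    unfolding lift_def by simp_all
qed

lemma lift_eq: "\<pi> x \<in> U \<Longrightarrow> lift (\<pi> x) (\<tau> x) = x"
  using inv_into_f_f[OF bij_betw_imp_inj_on[OF triv_bij], of x] unfolding lift_def by simp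

lemma triv_smooth: "smooth_fun_on tA (\<pi> -` U) \<tau>"
proof -
  interpret X: manifold "times_atlas bA :: ('m \<times> 'f, 'e \<times> 'f) chart set"
    by (rule times_manifold)
  have "smooth_fun_on (times_atlas bA) UNIV (snd :: 'm \<times> 'f \<Rightarrow> 'f)"
  proof (rule X.smooth_fun_on_local)
    fix z :: "'m \<times> 'f"
    obtain W \<psi> where c: "(W, \<psi>) \<in> bA" "fst z \<in> W" by (rule M.chart_at)
    have c': "(W \<times> UNIV, \<lambda>(p, k::'f). (\<psi> p, k)) \<in> times_atlas bA"
      using c(1) unfolding times_atlas_def by force
    have op: "open (W \<times> (UNIV :: 'f set))" using X.chart_open(1)[OF c'] .
    from X.smooth_fun_on_linear_comp[OF bounded_linear_snd op X.smooth_fun_on_chart[OF c']]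
    have "smooth_fun_on (times_atlas bA) (W \<times> UNIV) (snd :: 'm \<times> 'f \<Rightarrow> 'f)"
      by (simp add: split_beta)
    then show "\<exists>T. open T \<and> z \<in> T \<and> smooth_fun_on (times_atlas bA) T (snd :: 'm \<times> 'f \<Rightarrow> 'f)"
      using op c(2) by (intro exI[of _ "W \<times> UNIV"]) (auto simp: mem_Times_iff)
  qed
  moreover have "smooth_map_on tA (times_atlas bA) (\<pi> -` U) (\<lambda>x. (\<pi> x, \<tau> x))"
    using triv_diffeo unfolding diffeomorphism_on_def by simp
  ultimately show ?thesis
    using smooth_fun_on_map_compose[OF T.manifold_axioms X.manifold_axioms _ open_proj_vimage[OF triv_open] open_UNIV]
    by fastforce
qed

text \<open>The atlas of A need not contain product charts. But the trivialization is a
  diffeomorphism onto a product, so a smooth function on A may be read in a base chart together with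
  the fibre coordinate.\<close>

lemma triv_coords_smooth:
  assumes g: "smooth_fun_on tA (\<pi> -` U) g" and c: "(W, \<psi>) \<in> bA"
  shows "smooth_on (\<psi> ` (W \<inter> U) \<times> UNIV) (\<lambda>z. g (lift (inv_into W \<psi> (fst z)) (snd z)))"
proof -
  interpret X: manifold "times_atlas bA :: ('m \<times> 'f, 'e \<times> 'f) chart set"
    by (rule times_manifold)
  let ?h = "\<lambda>x. (\<pi> x, \<tau> x)"
  have "smooth_map_on (times_atlas bA) tA (U \<times> UNIV) (inv_into (\<pi> -` U) ?h)"
    and op: "open (U \<times> (UNIV :: 'f set))"
    using triv_diffeo unfolding diffeomorphism_on_def by simp_all
  from smooth_fun_on_map_compose[OF X.manifold_axioms T.manifold_axioms this open_proj_vimage[OF triv_open] g]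
  have "smooth_fun_on (times_atlas bA) (U \<times> UNIV \<inter> inv_into (\<pi> -` U) ?h -` \<pi> -` U)
    (\<lambda>z. g (inv_into (\<pi> -` U) ?h z))" .
  moreover have "U \<times> UNIV \<inter> inv_into (\<pi> -` U) ?h -` \<pi> -` U = U \<times> UNIV"
    using lift_props(1) unfolding lift_def by auto
  ultimately have "smooth_fun_on (times_atlas bA) (U \<times> UNIV) (\<lambda>z. g (lift (fst z) (snd z)))"
    by (simp add: lift_def)
  moreover have c': "(W \<times> UNIV, \<lambda>(p, k::'f). (\<psi> p, k)) \<in> times_atlas bA"
    using c unfolding times_atlas_def by force
  ultimately have "smooth_on ((\<lambda>(p, k::'f). (\<psi> p, k)) ` (W \<times> UNIV \<inter> U \<times> UNIV))
      (\<lambda>u. g (lift (fst (inv_into (W \<times> UNIV) (\<lambda>(p, k). (\<psi> p, k)) u))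
        (snd (inv_into (W \<times> UNIV) (\<lambda>(p, k). (\<psi> p, k)) u))))"
    by (rule X.smooth_fun_onD)
  moreover have "(\<lambda>(p, k::'f). (\<psi> p, k)) ` (W \<times> UNIV \<inter> U \<times> UNIV) = \<psi> ` (W \<inter> U) \<times> UNIV"
    using times_chart_image[of \<psi> "W \<inter> U" UNIV] by (simp add: Times_Int_Times)
  ultimately have s: "smooth_on (\<psi> ` (W \<inter> U) \<times> (UNIV :: 'f set))
      (\<lambda>u. g (lift (fst (inv_into (W \<times> UNIV) (\<lambda>(p, k). (\<psi> p, k)) u))
        (snd (inv_into (W \<times> UNIV) (\<lambda>(p, k). (\<psi> p, k)) u))))"
    by simp
  have inj: "inj_on \<psi> W" using M.chart_inv[OF c] by (rule inj_on_inverseI)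
  have "open (\<psi> ` (W \<inter> U))"
    using M.chart_open(1)[OF c] triv_open by (intro M.chart_image_open[OF c]) auto
  then have op: "open (\<psi> ` (W \<inter> U) \<times> (UNIV :: 'f set))" by (intro open_Times) auto
  show ?thesis
    by (rule smooth_on_cong[OF op _ s]) (auto simp: times_chart_inv[OF inj])
qed

lemma lift_smooth:
  assumes g: "smooth_fun_on tA (\<pi> -` U) g"
  shows "smooth_fun_on bA U (\<lambda>p. g (lift p k))"
proof (rule M.smooth_fun_onI)
  fix W \<psi> assume c: "(W, \<psi>) \<in> bA"
  let ?S = "\<psi> ` (W \<inter> U)"
  obtain C where C: "orthonormal_basis (C :: ('e \<times> 'f) set)" by (rule T.model_basis)
  have oS: "open ?S"
    using M.chart_open(1)[OF c] triv_open by (intro M.chart_image_open[OF c]) auto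
  have "smooth_on ?S (\<lambda>u. (u, k))"
    by (intro smooth_on_Pair smooth_on_id smooth_on_const oS)
  from smooth_on_compose[OF C oS _ _ this triv_coords_smooth[OF g c]]
  show "smooth_on ?S (\<lambda>u. g (lift (inv_into W \<psi> u) k))"
    using oS by (auto intro: open_Times)
qed

text \<open>Through \<open>t p\<close> the linear part l becomes a linear functional on the typical
  fibre, hence the inner product with some w; the constant is the value at the point of fibre
  coordinate 0.\<close>

lemma affine_on_fibre_iff:
  assumes p: "p \<in> U"
  shows "affine_on_fibre B p a \<longleftrightarrow> (\<exists>w c. \<forall>x. \<pi> x = p \<longrightarrow> a x = w \<bullet> \<tau> x + c)"
proof -
  obtain t where "linear_triv (model B) (U, t)" and
    t: "\<And>p x v. p \<in> U \<Longrightarrow> x \<in> afibre B p \<Longrightarrow> v \<in> fibre (model B) p \<Longrightarrow> \<tau> (transl B x v) = \<tau> x + t p v"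
    by (rule triv_linear) blast
  then have bij: "bij_betw (t p) (fibre (model B) p) UNIV"
    and add: "\<And>x y. x \<in> fibre (model B) p \<Longrightarrow> y \<in> fibre (model B) p \<Longrightarrow>
      t p (vadd (model B) p x y) = t p x + t p y"
    and scale: "\<And>c x. x \<in> fibre (model B) p \<Longrightarrow> t p (vscale (model B) p c x) = c *\<^sub>R t p x"
    using p unfolding linear_triv_def by auto
  show ?thesis
  proof
    assume "affine_on_fibre B p a"
    then obtain l where
      l: "\<forall>v\<in>fibre (model B) p. \<forall>w\<in>fibre (model B) p. l (vadd (model B) p v w) = l v + l w"
        "\<forall>c. \<forall>v\<in>fibre (model B) p. l (vscale (model B) p c v) = c * l v"
        "\<forall>x\<in>afibre B p. \<forall>v\<in>fibre (model B) p. a (transl B x v) = a x + l v"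
      unfolding affine_on_fibre_def by blast
    note ladd = l(1)[rule_format] and lscale = l(2)[rule_format]
    have la: "a (transl B x v) = a x + l v" if "\<pi> x = p" "v \<in> fibre (model B) p" for x v
      using l(3) that by simp
    define s where "s = inv_into (fibre (model B) p) (t p)"
    have s: "s u \<in> fibre (model B) p" "t p (s u) = u" for u
      using bij unfolding s_def bij_betw_def by (auto intro: inv_into_into f_inv_into_f)
    have s_t: "s (t p v) = v" if "v \<in> fibre (model B) p" for v
      unfolding s_def using bij that by (simp add: bij_betw_def inv_into_f_f)
    have "linear (\<lambda>u. l (s u))"
    proof (rule linearI)
      show "l (s (u + w)) = l (s u) + l (s w)" for u w
        using s_t[OF model_closed(1)[OF s(1)[of u] s(1)[of w]]] add[OF s(1)[of u] s(1)[of w]] ladd s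
        by simp
      show "l (s (c *\<^sub>R u)) = c *\<^sub>R l (s u)" for c u
        using s_t[OF model_closed(2)[OF s(1)[of u], of c]] scale[OF s(1)[of u], of c] lscale s
        by simp
    qed
    then have L: "l (s u) = (\<Sum>i\<in>Basis. l (s i) *\<^sub>R i) \<bullet> u" for u
      using linear_orthonormal_expansion[OF orthonormal_basis_Basis, of "\<lambda>u. l (s u)" u]
      by (simp add: linear_conv_bounded_linear inner_sum_left inner_commute[of u] mult.commute)
    let ?x0 = "lift p 0"
    have "a x = (\<Sum>i\<in>Basis. l (s i) *\<^sub>R i) \<bullet> \<tau> x + a ?x0" if x: "\<pi> x = p" for x
    proof -
      obtain v where v: "v \<in> fibre (model B) p" "transl B ?x0 v = x"
        using transl_props(2)[of ?x0 p x] lift_props(1)[OF p] x by auto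
      have "\<tau> x = t p v"
        using t[OF p _ v(1), of ?x0] lift_props[OF p] v(2) by simp
      moreover have "a x = a ?x0 + l v"
        using la[of ?x0 v] lift_props(1)[OF p] v by simp
      ultimately show ?thesis using L[of "t p v"] s_t[OF v(1)] by simp
    qed
    then show "\<exists>w c. \<forall>x. \<pi> x = p \<longrightarrow> a x = w \<bullet> \<tau> x + c" by blast
  next
    assume "\<exists>w c. \<forall>x. \<pi> x = p \<longrightarrow> a x = w \<bullet> \<tau> x + c"
    then obtain w c where a: "\<And>x. \<pi> x = p \<Longrightarrow> a x = w \<bullet> \<tau> x + c" by blast
    have "a (transl B x v) = a x + w \<bullet> t p v" if "\<pi> x = p" "v \<in> fibre (model B) p" for x v
      using a[of x] a[of "transl B x v"] transl_props(1)[of x p v] t[OF p, of x v] that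
      by (simp add: inner_add_right)
    then show "affine_on_fibre B p a"
      unfolding affine_on_fibre_def
      by (intro exI[of _ "\<lambda>v. w \<bullet> t p v"]) (auto simp: add scale inner_add_right)
  qed
qed

lemma affine_coeffs_unique:
  assumes p: "p \<in> U" and "\<And>x. \<pi> x = p \<Longrightarrow> w \<bullet> \<tau> x + c = w' \<bullet> \<tau> x + c'"
  shows "w = w'" "c = c'"
proof -
  show c: "c = c'" using assms(2)[of "lift p 0"] lift_props[OF p] by simp
  \<comment> \<open>At the point with fibre coordinate w - w' the difference of the two affine
    expressions is the squared length of w - w'.\<close>
  have "(w - w') \<bullet> (w - w') = 0"
    using assms(2)[of "lift p (w - w')"] lift_props[OF p] c by (simp add: inner_diff_left)
  then show "w = w'" by simp
qed

definition "affine_coeffs p \<alpha> = (THE (w, c). \<forall>x\<in>afibre B p. \<alpha> x = w \<bullet> \<tau> x + c)"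

lemma affine_coeffs_eq:
  assumes "p \<in> U" "\<And>x. \<pi> x = p \<Longrightarrow> \<alpha> x = w \<bullet> \<tau> x + c"
  shows "affine_coeffs p \<alpha> = (w, c)"
  unfolding affine_coeffs_def
proof (rule the_equality)
  fix z assume z: "case z of (w, c) \<Rightarrow> \<forall>x\<in>afibre B p. \<alpha> x = w \<bullet> \<tau> x + c"
  obtain w' c' where "z = (w', c')" by (cases z)
  then show "z = (w, c)" using z affine_coeffs_unique[OF assms(1), of w c w' c'] assms(2) by auto
qed (use assms in auto)

text \<open>The coefficients are expressed by the values of a at the points whose coordinate is 0 or
  a basis vector. These values depend smoothly on p when a is smooth, which is how
  \<open>affine_coeffs_smooth\<close> is obtained.\<close>

lemma affine_coeffs_explicit:
  assumes p: "p \<in> U" and a: "affine_on_fibre B p a" and "\<And>x. \<pi> x = p \<Longrightarrow> \<alpha> x = a x"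
  shows "affine_coeffs p \<alpha> = (\<Sum>i\<in>Basis. (a (lift p i) - a (lift p 0)) *\<^sub>R i, a (lift p 0))"
proof -
  obtain w c where wc: "\<And>x. \<pi> x = p \<Longrightarrow> a x = w \<bullet> \<tau> x + c"
    using a affine_on_fibre_iff[OF p] by blast
  then have "affine_coeffs p \<alpha> = (w, c)" using assms(3) by (intro affine_coeffs_eq[OF p]) simp
  moreover have "a (lift p i) = w \<bullet> i + c" for i
    using wc lift_props[OF p] by simp_all
  ultimately show ?thesis by (simp add: euclidean_representation)
qed

end

lemma fibre_nonempty: obtains x where "\<pi> x = p"
  using triv_at[of p] lift_props(1) by blast

end

context affine_bdl
begin

section \<open>Affine and basic functions\<close>

lemma affine_fibre_add:
  assumes "affine_on_fibre B p a" "affine_on_fibre B p b"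
  shows "affine_on_fibre B p (\<lambda>x. a x + b x)"
proof -
  obtain U \<tau> where t: "p \<in> U" "affine_triv B (U, \<tau>)" using triv_at by blast
  obtain w c w' c' where "\<forall>x. \<pi> x = p \<longrightarrow> a x = w \<bullet> \<tau> x + c" "\<forall>x. \<pi> x = p \<longrightarrow> b x = w' \<bullet> \<tau> x + c'"
    using assms unfolding affine_on_fibre_iff[OF t(2,1)] by blast
  then show ?thesis
    unfolding affine_on_fibre_iff[OF t(2,1)]
    by (intro exI[of _ "w + w'"] exI[of _ "c + c'"]) (simp add: inner_add_left)
qed

lemma affine_fibre_scale:
  assumes "affine_on_fibre B p a"
  shows "affine_on_fibre B p (\<lambda>x. g (\<pi> x) * a x)"
proof -
  obtain U \<tau> where t: "p \<in> U" "affine_triv B (U, \<tau>)" using triv_at by blast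
  obtain w c where "\<forall>x. \<pi> x = p \<longrightarrow> a x = w \<bullet> \<tau> x + c"
    using assms unfolding affine_on_fibre_iff[OF t(2,1)] by blast
  then show ?thesis
    unfolding affine_on_fibre_iff[OF t(2,1)]
    by (intro exI[of _ "g p *\<^sub>R w"] exI[of _ "g p * c"]) (simp add: algebra_simps)
qed

lemma affine_fibre_basic: "affine_on_fibre B p (\<lambda>x. g (\<pi> x))"
proof -
  obtain U \<tau> where t: "p \<in> U" "affine_triv B (U, \<tau>)" using triv_at by blast
  show ?thesis
    unfolding affine_on_fibre_iff[OF t(2,1)]
    by (intro exI[of _ 0] exI[of _ "g p"]) simp
qed

lemma affine_fibre_cong:
  assumes "\<And>x. \<pi> x = p \<Longrightarrow> a x = b x"
  shows "affine_on_fibre B p a \<longleftrightarrow> affine_on_fibre B p b"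
proof -
  obtain U \<tau> where t: "p \<in> U" "affine_triv B (U, \<tau>)" using triv_at by blast
  show ?thesis
    unfolding affine_on_fibre_iff[OF t(2,1)] using assms by auto
qed

text \<open>On the line through the point of coordinate 0 in the direction of the linear part w, the
  function a is r |w|^2 + c. Its square can be affine in r only if w = 0.\<close>

lemma affine_square_const:
  assumes "affine_on_fibre B p a" "affine_on_fibre B p (\<lambda>x. a x * a x)"
    and "\<pi> x = p" "\<pi> y = p"
  shows "a x = a y"
proof -
  obtain U \<tau> where t: "p \<in> U" "affine_triv B (U, \<tau>)" using triv_at by blast
  obtain w c where a: "\<forall>x. \<pi> x = p \<longrightarrow> a x = w \<bullet> \<tau> x + c"
    using assms(1) unfolding affine_on_fibre_iff[OF t(2,1)] by blast
  obtain w' c' where b: "\<forall>x. \<pi> x = p \<longrightarrow> a x * a x = w' \<bullet> \<tau> x + c'"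
    using assms(2) unfolding affine_on_fibre_iff[OF t(2,1)] by blast
  have *: "(r * (w \<bullet> w) + c) * (r * (w \<bullet> w) + c) = r * (w' \<bullet> w) + c'" for r
  proof -
    let ?y = "lift U \<tau> p (r *\<^sub>R w)"
    have "a ?y = r * (w \<bullet> w) + c" "a ?y * a ?y = r * (w' \<bullet> w) + c'"
      using a[rule_format, of ?y] b[rule_format, of ?y] lift_props[OF t(2,1), of "r *\<^sub>R w"]
      by simp_all
    then show ?thesis by simp
  qed
  \<comment> \<open>The second difference at r = 1, 0, -1: it leaves 2 |w|^4 on the side of the
    square and annihilates the affine side.\<close>
  have "2 * ((w \<bullet> w) * (w \<bullet> w)) = (1 * (w \<bullet> w) + c) * (1 * (w \<bullet> w) + c) +
      ((- 1) * (w \<bullet> w) + c) * ((- 1) * (w \<bullet> w) + c) - 2 * ((0 * (w \<bullet> w) + c) * (0 * (w \<bullet> w) + c))"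
    by algebra
  also have "\<dots> = 0" unfolding * by simp
  finally have "(w \<bullet> w) * (w \<bullet> w) = 0" by (simp only: mult_eq_0_iff) simp
  then have "w = 0" by simp
  then show ?thesis using a assms(3,4) by simp
qed

lemma AF_D: "a \<in> AF \<Longrightarrow> a \<in> CA" "a \<in> AF \<Longrightarrow> affine_on_fibre B p a"
  unfolding affine_functions_def by auto

lemma AF_I: "a \<in> CA \<Longrightarrow> (\<And>p. affine_on_fibre B p a) \<Longrightarrow> a \<in> AF"
  unfolding affine_functions_def by auto

lemma AF_basic: "f \<in> CM \<Longrightarrow> (\<lambda>x. f (\<pi> x)) \<in> AF"
  by (intro AF_I CM_pullback affine_fibre_basic)

lemma AF_const [simp]: "(\<lambda>_. c) \<in> AF"
  using AF_basic[OF M.C_const, of c] .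

lemma AF_add: "a \<in> AF \<Longrightarrow> b \<in> AF \<Longrightarrow> (\<lambda>x. a x + b x) \<in> AF"
  by (intro AF_I T.C_add affine_fibre_add) (auto dest: AF_D)

lemma AF_mult_basic: "f \<in> CM \<Longrightarrow> a \<in> AF \<Longrightarrow> (\<lambda>x. f (\<pi> x) * a x) \<in> AF"
  by (rule AF_I[OF T.C_mult[OF CM_pullback] affine_fibre_scale]) (auto dest: AF_D)

lemma AF_scale: "a \<in> AF \<Longrightarrow> (\<lambda>x. c * a x) \<in> AF"
  using AF_mult_basic[OF M.C_const, of a c] .

lemma AF_diff: "a \<in> AF \<Longrightarrow> b \<in> AF \<Longrightarrow> (\<lambda>x. a x - b x) \<in> AF"
  using AF_add[OF _ AF_scale[of b "-1"], of a] by simp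

lemma AF_sum: "(\<And>i. i \<in> I \<Longrightarrow> f i \<in> AF) \<Longrightarrow> (\<lambda>x. \<Sum>i\<in>I. f i x) \<in> AF"
  by (induction I rule: infinite_finite_induct) (auto intro: AF_add)

text \<open>Smoothness of f: over a trivialization it is the composition of a with the smooth local
  section \<open>lift U \<tau> p 0\<close>.\<close>

lemma fibre_const_basic:
  assumes a: "a \<in> CA" and const: "\<And>x y. \<pi> x = \<pi> y \<Longrightarrow> a x = a y"
  obtains f where "f \<in> CM" "a = (\<lambda>x. f (\<pi> x))"
proof
  define f where "f p = a (SOME x. \<pi> x = p)" for p
  have f: "f (\<pi> x) = a x" for x
    unfolding f_def by (rule const) (rule someI[of "\<lambda>y. \<pi> y = \<pi> x" x], simp)
  then show "a = (\<lambda>x. f (\<pi> x))" by simp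
  show "f \<in> CM"
  proof (rule M.C_local)
    fix p
    obtain U \<tau> where t: "p \<in> U" "affine_triv B (U, \<tau>)" using triv_at by blast
    have "smooth_fun_on bA U (\<lambda>p. a (lift U \<tau> p 0))"
      by (rule lift_smooth[OF t(2) T.C_infinityD[OF a]])
    then have "smooth_fun_on bA U f"
      by (rule M.smooth_fun_on_cong[OF triv_open[OF t(2)], rotated])
        (use f lift_props(1)[OF t(2)] in metis)
    then show "\<exists>T. open T \<and> p \<in> T \<and> smooth_fun_on bA T f"
      using t triv_open by blast
  qed
qed

lemma affine_square_basic:
  assumes "a \<in> AF" "(\<lambda>x. a x * a x) \<in> AF"
  obtains f where "f \<in> CM" "a = (\<lambda>x. f (\<pi> x))"
  using fibre_const_basic[of a] affine_square_const AF_D assms by metis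

subsection \<open>Sections of the bundle of affine functions\<close>

abbreviation "SA \<equiv> sections bA aff"

definition "untilde X = (\<lambda>x. X (\<pi> x) x)"

lemma fibre_aff_dual:
  "\<alpha> \<in> fibre aff p \<longleftrightarrow> \<alpha> \<in> extensional (afibre B p) \<and> affine_on_fibre B p \<alpha>"
  by (auto simp: aff_dual_def PiE_def)

lemma trivs_aff_dual: "trivs aff = {(U, affine_coeffs \<tau>) | U \<tau>. affine_triv B (U, \<tau>)}"
proof -
  have *: "affine_coeffs \<tau> = (\<lambda>p \<alpha>. THE (w, c). \<forall>x\<in>afibre B p. \<alpha> x = w \<bullet> \<tau> x + c)"
    if "affine_triv B (U, \<tau>)" for U \<tau>
    by (intro ext) (rule affine_coeffs_def[OF that])
  show ?thesis
    unfolding aff_dual_def vbundle.simps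
    by (intro Collect_cong iff_exI) (simp add: * cong: rev_conj_cong)
qed

lemma sections_iff:
  "X \<in> SA \<longleftrightarrow> (\<forall>p. X p \<in> fibre aff p) \<and>
    (\<forall>U \<tau>. affine_triv B (U, \<tau>) \<longrightarrow> smooth_fun_on bA U (\<lambda>p. affine_coeffs \<tau> p (X p)))"
  unfolding sections_def trivs_aff_dual by auto

lemma affine_coeffs_smooth:
  assumes t: "affine_triv B (U, \<tau>)" and a: "a \<in> AF"
  shows "smooth_fun_on bA U (\<lambda>p. affine_coeffs \<tau> p (tilde B a p))"
proof -
  note U = triv_open[OF t]
  note l = lift_smooth[OF t T.C_infinityD[OF AF_D(1)[OF a]]]
  have "smooth_fun_on bA U (\<lambda>p. a (lift U \<tau> p i) + - a (lift U \<tau> p 0))" for i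
    by (intro M.smooth_fun_on_add U l M.smooth_fun_on_linear_comp[OF bounded_linear_minus[OF bounded_linear_ident]])
  then have "smooth_fun_on bA U
      (\<lambda>p. (\<Sum>i\<in>Basis. (a (lift U \<tau> p i) + - a (lift U \<tau> p 0)) *\<^sub>R i, a (lift U \<tau> p 0)))"
    by (intro M.smooth_fun_on_Pair M.smooth_fun_on_sum M.smooth_fun_on_scaleR M.smooth_fun_on_const U l)
  then show ?thesis
    by (rule M.smooth_fun_on_cong[OF U, rotated])
      (simp add: affine_coeffs_explicit[OF t _ AF_D(2)[OF a]] tilde_def)
qed

lemma tilde_section:
  assumes "a \<in> AF"
  shows "tilde B a \<in> SA"
  unfolding sections_iff fibre_aff_dual
proof (intro conjI allI impI)
  show "tilde B a p \<in> extensional (afibre B p)" for p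
    by (simp add: tilde_def)
  show "affine_on_fibre B p (tilde B a p)" for p
    using affine_fibre_cong[of p a "tilde B a p"] AF_D(2)[OF assms] by (simp add: tilde_def)
qed (rule affine_coeffs_smooth[OF _ assms])

lemma untilde_tilde [simp]: "untilde (tilde B a) = a"
  by (simp add: untilde_def tilde_def)

lemma tilde_untilde [simp]: "X \<in> SA \<Longrightarrow> tilde B (untilde X) = X"
  unfolding sections_iff fibre_aff_dual tilde_def untilde_def
  by (intro ext) (auto simp: restrict_def extensional_def)

lemma tilde_inj: "tilde B a = tilde B b \<Longrightarrow> a = b"
  using untilde_tilde by metis

text \<open>Over a trivialization the function is \<open>w \<bullet> \<tau> x + c\<close>, where (w,
  c) is the coordinate expression of X, smooth because X is a section, pulled back along the
  projection.\<close>

lemma untilde_AF: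
  assumes X: "X \<in> SA"
  shows "untilde X \<in> AF"
proof (rule AF_I)
  have fib: "affine_on_fibre B p (X p)" for p
    using X unfolding sections_iff fibre_aff_dual by blast
  then show "affine_on_fibre B p (untilde X)" for p
    using affine_fibre_cong[of p "X p" "untilde X"] by (simp add: untilde_def)
  show "untilde X \<in> CA"
  proof (rule T.C_local)
    fix x0
    obtain U \<tau> where t: "\<pi> x0 \<in> U" "affine_triv B (U, \<tau>)" using triv_at by blast
    let ?V = "\<pi> -` U"
    have oV: "open ?V" using open_proj_vimage[OF triv_open[OF t(2)]] .
    have "smooth_fun_on bA U (\<lambda>p. affine_coeffs \<tau> p (X p))"
      using X t(2) unfolding sections_iff by blast
    from smooth_pullback[OF triv_open[OF t(2)] this]
    have c: "smooth_fun_on tA ?V (\<lambda>x. affine_coeffs \<tau> (\<pi> x) (X (\<pi> x)))" .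
    have "smooth_fun_on tA ?V
      (\<lambda>x. fst (affine_coeffs \<tau> (\<pi> x) (X (\<pi> x))) \<bullet> \<tau> x + snd (affine_coeffs \<tau> (\<pi> x) (X (\<pi> x))))"
      by (intro T.smooth_fun_on_add T.smooth_fun_on_inner oV triv_smooth[OF t(2)]
          T.smooth_fun_on_linear_comp[OF bounded_linear_fst oV c]
          T.smooth_fun_on_linear_comp[OF bounded_linear_snd oV c])
    then have "smooth_fun_on tA ?V (untilde X)"
    proof (rule T.smooth_fun_on_cong[OF oV, rotated])
      fix x assume "x \<in> ?V"
      then have x: "\<pi> x \<in> U" by simp
      obtain w c where wc: "\<And>y. \<pi> y = \<pi> x \<Longrightarrow> X (\<pi> x) y = w \<bullet> \<tau> y + c"
        using fib[of "\<pi> x"] affine_on_fibre_iff[OF t(2) x] by blast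
      then have "affine_coeffs \<tau> (\<pi> x) (X (\<pi> x)) = (w, c)"
        by (intro affine_coeffs_eq[OF t(2) x]) auto
      then show "fst (affine_coeffs \<tau> (\<pi> x) (X (\<pi> x))) \<bullet> \<tau> x + snd (affine_coeffs \<tau> (\<pi> x) (X (\<pi> x)))
          = untilde X x"
        using wc[of x] by (simp add: untilde_def)
    qed
    then show "\<exists>T. open T \<and> x0 \<in> T \<and> smooth_fun_on tA T (untilde X)"
      using oV t(1) by blast
  qed
qed

lemma sections_eq: "SA = tilde B ` AF"
proof (intro equalityI subsetI)
  fix X assume "X \<in> SA"
  then show "X \<in> tilde B ` AF"
    using untilde_AF tilde_untilde by (intro image_eqI[of _ _ "untilde X"]) auto
qed (use tilde_section in auto)

lemma sec_add_tilde: "sec_add aff (tilde B a) (tilde B b) = tilde B (\<lambda>x. a x + b x)"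
  by (auto simp: sec_add_def aff_dual_def tilde_def fun_eq_iff)

lemma sec_scale_tilde: "sec_scale aff f (tilde B a) = tilde B (\<lambda>x. f (\<pi> x) * a x)"
  by (auto simp: sec_scale_def aff_dual_def tilde_def fun_eq_iff)

lemma vzero_tilde: "vzero aff = tilde B (\<lambda>_. 0)"
  by (auto simp: aff_dual_def tilde_def fun_eq_iff)

lemma vadd_tilde: "vadd aff p (tilde B a p) (tilde B b p) = tilde B (\<lambda>x. a x + b x) p"
  by (auto simp: aff_dual_def tilde_def fun_eq_iff)

lemma vscale_tilde: "vscale aff p c (tilde B a p) = tilde B (\<lambda>x. c * a x) p"
  by (auto simp: aff_dual_def tilde_def fun_eq_iff)

lemma tilde_eq_iff: "tilde B a p = tilde B b p \<longleftrightarrow> (\<forall>x. \<pi> x = p \<longrightarrow> a x = b x)"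
  by (auto simp: tilde_def fun_eq_iff restrict_def)

end

subsection \<open>Adapted charts\<close>

text \<open>The sets are nested as V \<subseteq> K \<subseteq> N: coordinates are used over N, the
  cutoff \<beta> vanishes off the closed set K and equals 1 on V. S is convex because Hadamard's
  lemma integrates along segments. Only the base is cut down, so that in A the coordinates range
  over \<open>S \<times> UNIV\<close> and whole fibres are kept.\<close>

locale adapted = affine_bdl B n
  for B :: "('a::{t2_space, second_countable_topology}, 'm::{t2_space, second_countable_topology},
               'v, 'e::real_inner, 'f::euclidean_space) abundle"
    and n :: nat +
  fixes U :: "'m set" and \<tau> :: "'a \<Rightarrow> 'f" and W :: "'m set" and \<psi> :: "'m \<Rightarrow> 'e"
    and S :: "'e set" and N K V :: "'m set" and \<beta> :: "'m \<Rightarrow> real"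
    and C :: "('e \<times> 'f) set" and D :: "'e set"
  assumes tr: "affine_triv B (U, \<tau>)" and ch: "(W, \<psi>) \<in> bA"
    and S: "open S" "convex S" "S \<subseteq> \<psi> ` (W \<inter> U)"
    and N: "N \<subseteq> W \<inter> U" "\<And>p. p \<in> N \<Longrightarrow> \<psi> p \<in> S" "open N"
    and \<beta>: "\<beta> \<in> CM" "closed K" "K \<subseteq> N" "\<And>p. p \<notin> K \<Longrightarrow> \<beta> p = 0"
    and V: "open V" "V \<subseteq> K" "\<And>p. p \<in> V \<Longrightarrow> \<beta> p = 1"
    and C: "orthonormal_basis C" and D: "orthonormal_basis D"
begin

definition "\<Phi> x = (\<psi> (\<pi> x), \<tau> x)"
text \<open>Over V this is the coordinate \<open>\<Phi> x \<bullet> z\<close>. The cutoff makes it a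
  global function, as an argument of a derivation must be; since the cutoff depends on the base
  point alone, \<open>Y z\<close> is affine on fibres.\<close>

definition "Y z = (\<lambda>x. if \<pi> x \<in> N then \<beta> (\<pi> x) * (\<Phi> x \<bullet> z) else 0)"
definition "u b = (\<lambda>p. if p \<in> N then \<beta> p * (\<psi> p \<bullet> b) else 0)"
definition "coords f = (\<lambda>z. f (lift U \<tau> (inv_into W \<psi> (fst z)) (snd z)))"

lemma extend_base:
  assumes "smooth_on S G"
  shows "(\<lambda>p. if p \<in> N then \<beta> p * G (\<psi> p) else 0) \<in> CM"
proof (rule M.bump_extend[OF \<beta>(1,2,3,4) N(3)])
  have \<psi>: "smooth_fun_on bA N \<psi>"
    using M.smooth_fun_on_subset[OF M.smooth_fun_on_chart[OF ch]] N(1) by blast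
  show "smooth_fun_on bA N (\<lambda>p. G (\<psi> p))"
    by (rule M.smooth_fun_on_compose[OF D N(3) S(1) _ \<psi> assms]) (use N(2) in blast)
qed

lemma \<Phi>_smooth: "smooth_fun_on tA (\<pi> -` N) \<Phi>"
proof -
  have "smooth_fun_on bA N \<psi>"
    using M.smooth_fun_on_subset[OF M.smooth_fun_on_chart[OF ch]] N(1) by blast
  moreover have "smooth_fun_on tA (\<pi> -` N) \<tau>"
    using T.smooth_fun_on_subset[OF triv_smooth[OF tr]] N(1) by blast
  ultimately show ?thesis
    unfolding \<Phi>_def[abs_def]
    by (intro T.smooth_fun_on_Pair smooth_pullback open_proj_vimage N(3))
qed

lemma S_UNIV: "open (S \<times> (UNIV :: 'f set))" "convex (S \<times> (UNIV :: 'f set))"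
  using S by (auto intro: open_Times convex_Times)

lemma \<Phi>_in: "\<pi> x \<in> N \<Longrightarrow> \<Phi> x \<in> S \<times> UNIV"
  using N(2) by (simp add: \<Phi>_def)

lemma extend_total:
  assumes "smooth_on (S \<times> UNIV) G"
  shows "(\<lambda>x. if \<pi> x \<in> N then \<beta> (\<pi> x) * G (\<Phi> x) else 0) \<in> CA"
proof -
  have "smooth_fun_on tA (\<pi> -` N) (\<lambda>x. G (\<Phi> x))"
    by (rule T.smooth_fun_on_compose[OF C open_proj_vimage[OF N(3)] S_UNIV(1) _ \<Phi>_smooth assms])
      (use \<Phi>_in in blast)
  from T.bump_extend[OF CM_pullback[OF \<beta>(1)] closed_proj_vimage[OF \<beta>(2)] _ _ open_proj_vimage[OF N(3)] this]
  show ?thesis using \<beta>(3,4) by (simp add: vimage_mono)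
qed

lemma smooth_inner: "open X \<Longrightarrow> smooth_on X (\<lambda>u. u \<bullet> b)"
  by (rule smooth_on_linear_comp[OF bounded_linear_inner_left _ smooth_on_id])

lemma Y_AF: "Y z \<in> AF"
proof (rule AF_I)
  show "Y z \<in> CA"
    unfolding Y_def by (rule extend_total[OF smooth_inner[OF S_UNIV(1)]])
  fix p
  show "affine_on_fibre B p (Y z)"
  proof (cases "p \<in> N")
    case True
    then have "p \<in> U" using N(1) by blast
    then show ?thesis
      unfolding affine_on_fibre_iff[OF tr \<open>p \<in> U\<close>]
      by (intro exI[of _ "\<beta> p *\<^sub>R snd z"] exI[of _ "\<beta> p * (\<psi> p \<bullet> fst z)"])
        (use True in \<open>auto simp: Y_def \<Phi>_def inner_prod_def algebra_simps inner_commute\<close>)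
  next
    case False
    then show ?thesis
      using affine_fibre_cong[of p "Y z" "\<lambda>x. 0"] affine_fibre_basic[of p "\<lambda>_. 0"]
      by (auto simp: Y_def)
  qed
qed

lemma u_CM: "u b \<in> CM"
  unfolding u_def by (rule extend_base[OF smooth_inner[OF S(1)]])

lemma Y_basic: "Y (b, 0) = (\<lambda>x. u b (\<pi> x))"
  by (auto simp: Y_def u_def \<Phi>_def inner_prod_def)

text \<open>C is an arbitrary orthonormal basis of the product and need not split into base and
  fibre directions; this relates the functions \<open>Y j\<close>, j in C, to the functions
  \<open>Y (b, 0)\<close> and \<open>Y (0, i)\<close>.\<close>

lemma Y_expansion: "Y z = (\<lambda>x. \<Sum>j\<in>C. (z \<bullet> j) * Y j x)"
proof
  fix x
  have "\<Phi> x \<bullet> z = \<Phi> x \<bullet> (\<Sum>j\<in>C. (z \<bullet> j) *\<^sub>R j)"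
    using orthonormal_expansion[OF C, of z] by simp
  then show "Y z x = (\<Sum>j\<in>C. (z \<bullet> j) * Y j x)"
    by (simp add: Y_def inner_sum_right sum_distrib_left mult.left_commute)
qed

lemma coords_smooth: "f \<in> CA \<Longrightarrow> smooth_on (S \<times> UNIV) (coords f)"
  unfolding coords_def
  by (rule smooth_on_subset[OF triv_coords_smooth[OF tr T.C_infinityD ch]]) (use S(3) in auto)

lemma coords_\<Phi>: "\<pi> x \<in> N \<Longrightarrow> coords f (\<Phi> x) = f x"
proof -
  assume "\<pi> x \<in> N"
  then have "\<pi> x \<in> W" "\<pi> x \<in> U" using N(1) by auto
  then show ?thesis
    by (simp add: coords_def \<Phi>_def M.chart_inv[OF ch] lift_eq[OF tr])
qed

lemma V_N: "p \<in> V \<Longrightarrow> p \<in> N" "p \<in> V \<Longrightarrow> \<beta> p = 1"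
  using V \<beta>(3) by auto

text \<open>Hadamard's lemma on the base. It will be applied to the tangent vector of M that an
  affine derivation induces through basic functions.\<close>

lemma tangent_base_vanish:
  assumes \<theta>: "\<theta> \<in> tangent_space bA p" and p: "p \<in> V" and u: "\<And>b. \<theta> (u b) = 0"
    and f: "f \<in> CM"
  shows "\<theta> f = 0"
proof -
  have 1: "(\<lambda>z. if z \<in> N then \<beta> z else 0) \<in> CM"
    using extend_base[OF smooth_on_const[OF S(1), of 1]] by (simp cong: if_cong)
  have "\<theta> f = (\<Sum>b\<in>D. frechet_derivative (\<lambda>y. f (inv_into W \<psi> y)) (at (\<psi> p)) b * \<theta> (u b))"
    unfolding u_def
  proof (rule M.tangent_hadamard[where y = \<psi> and N = N and \<beta> = \<beta>,
        OF \<theta> D S(1,2) N(2) V_N(1)[OF p] extend_base V_N(2)[OF p] _ f])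
    show "\<theta> (\<lambda>z. if z \<in> N then \<beta> z else 0) = 0"
      by (rule M.tangent_locally_const[OF \<theta> V(1) p 1]) (simp add: V_N)
    show "smooth_on S (\<lambda>y. f (inv_into W \<psi> y))"
      using smooth_on_subset[OF M.smooth_fun_onD[OF M.C_infinityD[OF f, of U] ch] S(3)] .
    show "f z = f (inv_into W \<psi> (\<psi> z))" if "z \<in> N" for z
      using M.chart_inv[OF ch, of z] N(1) that by auto
  qed
  then show ?thesis using u by simp
qed

text \<open>As the functions \<open>Y j\<close> are affine, a tangent vector of A is determined by
  its values on affine functions, indeed on finitely many of them.\<close>

lemma tangent_total:
  assumes v: "v \<in> tangent_space tA x" and x: "\<pi> x \<in> V" and f: "f \<in> CA"
  shows "v f = (\<Sum>j\<in>C. frechet_derivative (coords f) (at (\<Phi> x)) j * v (Y j))"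
proof -
  have 1: "(\<lambda>z. if z \<in> \<pi> -` N then \<beta> (\<pi> z) else 0) \<in> CA"
    using extend_total[OF smooth_on_const[OF S_UNIV(1), of 1]] by (simp cong: if_cong)
  have "v f = (\<Sum>j\<in>C. frechet_derivative (coords f) (at (\<Phi> x)) j *
      v (\<lambda>z. if z \<in> \<pi> -` N then \<beta> (\<pi> z) * (\<Phi> z \<bullet> j) else 0))"
  proof (rule T.tangent_hadamard[where y = \<Phi> and \<beta> = "\<lambda>z. \<beta> (\<pi> z)" and N = "\<pi> -` N",
        OF v C S_UNIV])
    show "v (\<lambda>z. if z \<in> \<pi> -` N then \<beta> (\<pi> z) else 0) = 0"
      by (rule T.tangent_locally_const[OF v open_proj_vimage[OF V(1)] _ 1]) (auto simp: V_N x)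
  qed (use \<Phi>_in V_N[OF x] extend_total coords_smooth[OF f] coords_\<Phi>[of _ f] f in auto)
  then show ?thesis by (simp add: Y_def)
qed

text \<open>The coefficients of \<open>tangent_total\<close>, extended to global smooth functions of
  x and independent of v, as is required for proving that vector fields are smooth.\<close>

lemma chain_rule:
  assumes f: "f \<in> CA"
  obtains d where "\<And>j. d j \<in> CA"
    "\<And>x v. \<pi> x \<in> V \<Longrightarrow> v \<in> tangent_space tA x \<Longrightarrow> v f = (\<Sum>j\<in>C. d j x * v (Y j))"
proof
  define d where "d j = (\<lambda>x. if \<pi> x \<in> N then \<beta> (\<pi> x) * frechet_derivative (coords f) (at (\<Phi> x)) j else 0)" for j
  show "d j \<in> CA" for j
    unfolding d_def by (rule extend_total[OF smooth_on_derivative[OF coords_smooth[OF f]]])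
  show "v f = (\<Sum>j\<in>C. d j x * v (Y j))" if "\<pi> x \<in> V" "v \<in> tangent_space tA x" for x v
    using tangent_total[OF that(2,1) f] V_N[OF that(1)] by (simp add: d_def)
qed

text \<open>Over V the cutoff is 1, so in coordinates \<open>Y k\<close> is linear on a
  neighbourhood of \<open>\<Phi> x\<close>.\<close>

lemma coords_Y:
  assumes x: "\<pi> x \<in> V"
  shows "frechet_derivative (coords (Y k)) (at (\<Phi> x)) h = h \<bullet> k"
proof -
  let ?O = "\<psi> ` V \<times> (UNIV :: 'f set)"
  have VW: "V \<subseteq> W" using V_N(1) N(1) by blast
  have O: "open ?O" "\<Phi> x \<in> ?O"
    using M.chart_image_open[OF ch V(1) VW] x by (auto intro: open_Times simp: \<Phi>_def)
  have "coords (Y k) z = z \<bullet> k" if zO: "z \<in> ?O" for z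
  proof -
    obtain q l where z: "z = (\<psi> q, l)" and q: "q \<in> V" using zO by auto
    then have "q \<in> U" "q \<in> W" "q \<in> N" "\<beta> q = 1" using V_N N(1) by auto
    then show ?thesis
      using lift_props[OF tr \<open>q \<in> U\<close>, of l] by (simp add: coords_def z Y_def \<Phi>_def M.chart_inv[OF ch])
  qed
  moreover have "((\<lambda>z. z \<bullet> k) has_derivative (\<lambda>h. h \<bullet> k)) (at (\<Phi> x))"
    by (auto intro!: derivative_eq_intros)
  ultimately have "(coords (Y k) has_derivative (\<lambda>h. h \<bullet> k)) (at (\<Phi> x))"
    using has_derivative_transform_within_open[OF _ O] by metis
  from frechet_derivative_at[OF this] show ?thesis by metis
qed

text \<open>The \<open>Y j\<close> are linear coordinates near x, so the combination of partial
  derivatives with coefficients \<open>t j\<close> takes the prescribed values on them.\<close>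

lemma tangent_exists:
  assumes x: "\<pi> x \<in> V"
  obtains v where "v \<in> tangent_space tA x" "\<And>j. j \<in> C \<Longrightarrow> v (Y j) = t j"
proof
  define v where "v = (\<lambda>f\<in>CA. \<Sum>j\<in>C. frechet_derivative (coords f) (at (\<Phi> x)) j * t j)"
  have xN: "\<pi> x \<in> N" using V_N(1)[OF x] .
  have D: "(coords f has_derivative frechet_derivative (coords f) (at (\<Phi> x))) (at (\<Phi> x))"
    if "f \<in> CA" for f
    using smooth_on_imp_differentiable[OF coords_smooth[OF that] \<Phi>_in[OF xN]]
    by (simp flip: frechet_derivative_works)
  show "v \<in> tangent_space tA x"
  proof (rule T.tangent_spaceI)
    fix f g assume f: "f \<in> CA" and g: "g \<in> CA"
    have "frechet_derivative (coords (\<lambda>q. f q + g q)) (at (\<Phi> x)) =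
        (\<lambda>h. frechet_derivative (coords f) (at (\<Phi> x)) h + frechet_derivative (coords g) (at (\<Phi> x)) h)"
      using has_derivative_add[OF D[OF f] D[OF g]]
      by (intro frechet_derivative_at[symmetric]) (simp add: coords_def)
    then show "v (\<lambda>q. f q + g q) = v f + v g"
      using f g by (simp add: v_def T.C_add sum.distrib algebra_simps)
    have "frechet_derivative (coords (\<lambda>q. f q * g q)) (at (\<Phi> x)) =
        (\<lambda>h. coords f (\<Phi> x) * frechet_derivative (coords g) (at (\<Phi> x)) h +
             frechet_derivative (coords f) (at (\<Phi> x)) h * coords g (\<Phi> x))"
      using has_derivative_mult[OF D[OF f] D[OF g]]
      by (intro frechet_derivative_at[symmetric]) (simp add: coords_def)
    then show "v (\<lambda>q. f q * g q) = f x * v g + g x * v f"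
      using f g by (simp add: v_def T.C_mult coords_\<Phi>[OF xN] sum.distrib algebra_simps sum_distrib_left)
  next
    fix c f assume f: "f \<in> CA"
    have "frechet_derivative (coords (\<lambda>q. c * f q)) (at (\<Phi> x)) =
        (\<lambda>h. c * frechet_derivative (coords f) (at (\<Phi> x)) h)"
      using has_derivative_mult_right[OF D[OF f], of c]
      by (intro frechet_derivative_at[symmetric]) (simp add: coords_def)
    then show "v (\<lambda>q. c * f q) = c * v f"
      using f by (simp add: v_def T.C_scale sum_distrib_left algebra_simps)
  qed (simp add: v_def)
  show "v (Y k) = t k" if k: "k \<in> C" for k
  proof -
    have "v (Y k) = (\<Sum>j\<in>C. (j \<bullet> k) * t j)"
      using AF_D(1)[OF Y_AF] by (simp add: v_def coords_Y[OF x])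
    also have "\<dots> = (\<Sum>j\<in>C. if j = k then t j else 0)"
      using orthonormal_basis_inner[OF C _ k] by (intro sum.cong) auto
    finally show ?thesis using k orthonormal_basis_finite[OF C] by simp
  qed
qed

lemma affine_through:
  assumes "p \<in> V"
  shows "\<exists>a. a \<in> AF \<and> (\<forall>x. \<pi> x = p \<longrightarrow> a x = w \<bullet> \<tau> x + c)"
proof (intro exI conjI allI impI)
  show "(\<lambda>x. Y (0, w) x + c) \<in> AF" by (rule AF_add[OF Y_AF AF_const])
  show "Y (0, w) x + c = w \<bullet> \<tau> x + c" if "\<pi> x = p" for x
    using V_N[OF assms] that by (simp add: Y_def \<Phi>_def inner_commute)
qed

text \<open>Two cutoffs occur on the left: one belongs to the coefficients, which have to be global
  functions on M, and the other is contained in \<open>Y (0, i)\<close>. Every term on the right is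
  a product of a basic with an affine function, so additivity and the restricted Leibniz rule
  suffice to evaluate functionals on it.\<close>

lemma affine_frame:
  assumes a: "a \<in> AF"
  obtains g g0 where "\<And>i. g i \<in> CM" "g0 \<in> CM"
    "(\<lambda>x. \<beta> (\<pi> x) * \<beta> (\<pi> x) * a x) = (\<lambda>x. (\<Sum>i\<in>Basis. g i (\<pi> x) * Y (0, i) x) + g0 (\<pi> x))"
    "\<And>p. (\<And>x. \<pi> x = p \<Longrightarrow> a x = 0) \<Longrightarrow> p \<in> V \<Longrightarrow> g0 p = 0 \<and> (\<forall>i. g i p = 0)"
proof
  define w c where "w p = fst (affine_coeffs \<tau> p (tilde B a p))"
    and "c p = snd (affine_coeffs \<tau> p (tilde B a p))" for p
  have NU: "N \<subseteq> U" using N(1) by blast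
  note ac = M.smooth_fun_on_subset[OF affine_coeffs_smooth[OF tr a] NU]
  have wc: "smooth_fun_on bA N w" "smooth_fun_on bA N c"
    unfolding w_def[abs_def] c_def[abs_def]
    by (rule M.smooth_fun_on_linear_comp[OF bounded_linear_fst N(3) ac],
        rule M.smooth_fun_on_linear_comp[OF bounded_linear_snd N(3) ac])
  have eq: "a x = w (\<pi> x) \<bullet> \<tau> x + c (\<pi> x)" if U: "\<pi> x \<in> U" for x
  proof -
    obtain w' c' where wc': "\<And>y. \<pi> y = \<pi> x \<Longrightarrow> a y = w' \<bullet> \<tau> y + c'"
      using AF_D(2)[OF a] affine_on_fibre_iff[OF tr U] by blast
    then have "affine_coeffs \<tau> (\<pi> x) (tilde B a (\<pi> x)) = (w', c')"
      by (intro affine_coeffs_eq[OF tr U]) (simp add: tilde_def)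
    then show ?thesis using wc'[of x] by (simp add: w_def c_def)
  qed
  define g where "g i p = (if p \<in> N then \<beta> p * (w p \<bullet> i) else 0)" for i p
  define g1 where "g1 p = (if p \<in> N then \<beta> p * c p else 0)" for p
  \<comment> \<open>The constant term carries no factor Y, so the second cutoff is inserted by
    hand.\<close>
  define g0 where "g0 p = \<beta> p * g1 p" for p
  show "g i \<in> CM" for i
    unfolding g_def[abs_def]
    by (rule M.bump_extend[OF \<beta>(1,2,3,4) N(3)
          M.smooth_fun_on_linear_comp[OF bounded_linear_inner_left N(3) wc(1)]])
  have "g1 \<in> CM"
    unfolding g1_def[abs_def] by (rule M.bump_extend[OF \<beta>(1,2,3,4) N(3) wc(2)])
  then show "g0 \<in> CM"
    unfolding g0_def[abs_def] by (rule M.C_mult[OF \<beta>(1)])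
  show "(\<lambda>x. \<beta> (\<pi> x) * \<beta> (\<pi> x) * a x) = (\<lambda>x. (\<Sum>i\<in>Basis. g i (\<pi> x) * Y (0, i) x) + g0 (\<pi> x))"
  proof
    fix x
    show "\<beta> (\<pi> x) * \<beta> (\<pi> x) * a x = (\<Sum>i\<in>Basis. g i (\<pi> x) * Y (0, i) x) + g0 (\<pi> x)"
    proof (cases "\<pi> x \<in> N")
      case True
      then have "a x = w (\<pi> x) \<bullet> \<tau> x + c (\<pi> x)" using eq N(1) by blast
      moreover have "(\<Sum>i\<in>Basis. g i (\<pi> x) * Y (0, i) x) =
          \<beta> (\<pi> x) * \<beta> (\<pi> x) * (w (\<pi> x) \<bullet> \<tau> x)"
        using True by (subst euclidean_inner)
          (simp add: g_def Y_def \<Phi>_def inner_prod_def sum_distrib_left algebra_simps)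
      ultimately show ?thesis using True by (simp add: g0_def g1_def algebra_simps)
    next
      case False
      then have "\<beta> (\<pi> x) = 0" using \<beta>(3,4) by blast
      then show ?thesis using False by (simp add: g_def g0_def)
    qed
  qed
  show "g0 p = 0 \<and> (\<forall>i. g i p = 0)" if "\<And>x. \<pi> x = p \<Longrightarrow> a x = 0" "p \<in> V" for p
  proof -
    have pU: "p \<in> U" using V_N(1)[OF that(2)] NU by blast
    have "w p \<bullet> \<tau> x + c p = 0 \<bullet> \<tau> x + 0" if "\<pi> x = p" for x
      using eq[of x] that pU \<open>\<And>x. \<pi> x = p \<Longrightarrow> a x = 0\<close>[of x] by simp
    from affine_coeffs_unique[OF tr pU this] have "w p = 0" "c p = 0" by simp_all
    then show ?thesis by (simp add: g0_def g1_def g_def)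
  qed
qed

end

text \<open>A ball inside the chart image serves as the convex set S; a bump function on its
  preimage N provides \<beta>, K and V.\<close>

lemma (in affine_bdl) adapted_at:
  obtains U \<tau> W \<psi> S N K V \<beta> C D where "adapted B n U \<tau> W \<psi> S N K V \<beta> C D" "p \<in> V"
proof -
  obtain C where C: "orthonormal_basis (C :: ('e \<times> 'f) set)" by (rule T.model_basis)
  obtain D where D: "orthonormal_basis (D :: 'e set)" by (rule M.model_basis)
  obtain U \<tau> where t: "p \<in> U" "affine_triv B (U, \<tau>)" using triv_at by blast
  obtain W \<psi> where c: "(W, \<psi>) \<in> bA" "p \<in> W" by (rule M.chart_at)
  have WU: "open (W \<inter> U)" using M.chart_open(1)[OF c(1)] triv_open[OF t(2)] by blast
  then have "open (\<psi> ` (W \<inter> U))" by (intro M.chart_image_open[OF c(1)]) auto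
  moreover have "\<psi> p \<in> \<psi> ` (W \<inter> U)" using c t by blast
  ultimately obtain r where r: "r > 0" "ball (\<psi> p) r \<subseteq> \<psi> ` (W \<inter> U)"
    using open_contains_ball by metis
  define N where "N = \<psi> -` ball (\<psi> p) r \<inter> W \<inter> U"
  have "open (\<psi> -` ball (\<psi> p) r \<inter> W)"
    using continuous_on_open_vimage[OF M.chart_open(1)[OF c(1)], THEN iffD1, rule_format,
        OF M.chart_continuous(1)[OF c(1)] open_ball] .
  then have N: "open N" "p \<in> N" unfolding N_def using triv_open[OF t(2)] r c t by auto
  obtain \<beta> K V where b: "\<beta> \<in> CM" "closed K" "K \<subseteq> N" "\<And>q. q \<notin> K \<Longrightarrow> \<beta> q = 0"
    "open V" "p \<in> V" "V \<subseteq> K" "\<And>q. q \<in> V \<Longrightarrow> \<beta> q = 1"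
    by (rule M.bump_exists[OF N]) (rule that)
  have "adapted B n U \<tau> W \<psi> (ball (\<psi> p) r) N K V \<beta> C D"
    by unfold_locales (use t c r N b C D in \<open>auto simp: N_def\<close>)
  then show ?thesis using that b(6) by blast
qed

section \<open>Brackets of smooth functions\<close>

context manifold
begin

lemma tangent_add_in:
  assumes v: "v \<in> tangent_space \<A> x" and w: "w \<in> tangent_space \<A> x"
  shows "tangent_add \<A> v w \<in> tangent_space \<A> x"
  by (rule tangent_spaceI)
    (auto simp: tangent_add_def C_add C_scale C_mult tangent_add_fun[OF v] tangent_add_fun[OF w]
      tangent_scale_fun[OF v] tangent_scale_fun[OF w] tangent_mult_fun[OF v] tangent_mult_fun[OF w]
      algebra_simps)

lemma tangent_scale_in:
  assumes v: "v \<in> tangent_space \<A> x"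
  shows "tangent_scale \<A> c v \<in> tangent_space \<A> x"
  by (rule tangent_spaceI)
    (auto simp: tangent_scale_def C_add C_scale C_mult tangent_add_fun[OF v]
      tangent_scale_fun[OF v] tangent_mult_fun[OF v] algebra_simps)

lemma tangent_add_apply: "f \<in> C_infinity \<A> \<Longrightarrow> tangent_add \<A> v w f = v f + w f"
  and tangent_scale_apply: "f \<in> C_infinity \<A> \<Longrightarrow> tangent_scale \<A> c v f = c * v f"
  by (simp_all add: tangent_add_def tangent_scale_def)

lemma cotangent_scale_apply:
  "v \<in> tangent_space \<A> x \<Longrightarrow> cotangent_scale \<A> x c \<alpha> v = c * \<alpha> v"
  by (simp add: cotangent_scale_def)

lemma differential_apply: "v \<in> tangent_space \<A> x \<Longrightarrow> differential \<A> f x v = v f"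
  by (simp add: differential_def)

lemma cotangent_spaceI:
  assumes "\<And>v. v \<notin> tangent_space \<A> x \<Longrightarrow> \<alpha> v = undefined"
    and "\<And>v w. v \<in> tangent_space \<A> x \<Longrightarrow> w \<in> tangent_space \<A> x \<Longrightarrow> \<alpha> (tangent_add \<A> v w) = \<alpha> v + \<alpha> w"
    and "\<And>c v. v \<in> tangent_space \<A> x \<Longrightarrow> \<alpha> (tangent_scale \<A> c v) = c * \<alpha> v"
  shows "\<alpha> \<in> cotangent_space \<A> x"
  unfolding cotangent_space_def by (simp add: assms PiE_iff extensional_def)

lemma cotangent_add_tangent: "\<alpha> \<in> cotangent_space \<A> x \<Longrightarrow> v \<in> tangent_space \<A> x \<Longrightarrow> w \<in> tangent_space \<A> x
    \<Longrightarrow> \<alpha> (tangent_add \<A> v w) = \<alpha> v + \<alpha> w"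
  and cotangent_scale_tangent: "\<alpha> \<in> cotangent_space \<A> x \<Longrightarrow> v \<in> tangent_space \<A> x
    \<Longrightarrow> \<alpha> (tangent_scale \<A> c v) = c * \<alpha> v"
  by (simp_all add: cotangent_space_def)

lemma cotangent_outside: "\<alpha> \<in> cotangent_space \<A> x \<Longrightarrow> v \<notin> tangent_space \<A> x \<Longrightarrow> \<alpha> v = undefined"
  unfolding cotangent_space_def mem_Collect_eq by (elim conjE) (rule PiE_arb[of \<alpha>])

lemma cotangent_eqI:
  assumes "\<alpha> \<in> cotangent_space \<A> x" "\<beta> \<in> cotangent_space \<A> x"
    "\<And>v. v \<in> tangent_space \<A> x \<Longrightarrow> \<alpha> v = \<beta> v"
  shows "\<alpha> = \<beta>"
  using assms(3) cotangent_outside[OF assms(1)] cotangent_outside[OF assms(2)] by (intro ext) fastforce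

lemma differential_in: "f \<in> C_infinity \<A> \<Longrightarrow> differential \<A> f x \<in> cotangent_space \<A> x"
  by (rule cotangent_spaceI)
    (simp_all add: differential_apply tangent_add_in tangent_scale_in tangent_add_apply
      tangent_scale_apply, simp add: differential_def)

lemma differential_add:
  "f \<in> C_infinity \<A> \<Longrightarrow> g \<in> C_infinity \<A> \<Longrightarrow>
    differential \<A> (\<lambda>q. f q + g q) x = cotangent_add \<A> x (differential \<A> f x) (differential \<A> g x)"
  by (auto simp: differential_def cotangent_add_def tangent_add_fun fun_eq_iff)

lemma differential_scale:
  "f \<in> C_infinity \<A> \<Longrightarrow>
    differential \<A> (\<lambda>q. c * f q) x = cotangent_scale \<A> x c (differential \<A> f x)"
  by (auto simp: differential_def cotangent_scale_def tangent_scale_fun fun_eq_iff)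

lemma differential_mult:
  "f \<in> C_infinity \<A> \<Longrightarrow> g \<in> C_infinity \<A> \<Longrightarrow>
    differential \<A> (\<lambda>q. f q * g q) x = cotangent_add \<A> x
      (cotangent_scale \<A> x (f x) (differential \<A> g x)) (cotangent_scale \<A> x (g x) (differential \<A> f x))"
  by (auto simp: differential_def cotangent_add_def cotangent_scale_def tangent_mult_fun fun_eq_iff)

lemma cotangent_scale_in:
  assumes "\<alpha> \<in> cotangent_space \<A> x"
  shows "cotangent_scale \<A> x c \<alpha> \<in> cotangent_space \<A> x"
  by (rule cotangent_spaceI)
    (simp_all add: cotangent_scale_apply tangent_add_in tangent_scale_in algebra_simps
      cotangent_add_tangent[OF assms(1)] cotangent_scale_tangent[OF assms(1)],
      simp add: cotangent_scale_def)

text \<open>Tangent vectors form a set of functionals and not a type with addition, so a linear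
  combination is written pointwise and the linearity of \<alpha> is extended to it by
  induction.\<close>

lemma tangent_combination:
  assumes "finite I" "I \<noteq> {}" "\<And>i. i \<in> I \<Longrightarrow> v i \<in> tangent_space \<A> x"
  shows "(\<lambda>f\<in>C_infinity \<A>. \<Sum>i\<in>I. c i * v i f) \<in> tangent_space \<A> x"
    and "\<alpha> \<in> cotangent_space \<A> x \<Longrightarrow> \<alpha> (\<lambda>f\<in>C_infinity \<A>. \<Sum>i\<in>I. c i * v i f) = (\<Sum>i\<in>I. c i * \<alpha> (v i))"
proof -
  have "(\<lambda>f\<in>C_infinity \<A>. \<Sum>i\<in>I. c i * v i f) \<in> tangent_space \<A> x \<and>
    (\<alpha> \<in> cotangent_space \<A> x \<longrightarrow> \<alpha> (\<lambda>f\<in>C_infinity \<A>. \<Sum>i\<in>I. c i * v i f) = (\<Sum>i\<in>I. c i * \<alpha> (v i)))"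
    using assms
  proof (induction I rule: finite_ne_induct)
    case (singleton i)
    then have v: "v i \<in> tangent_space \<A> x" by simp
    have "(\<lambda>f\<in>C_infinity \<A>. \<Sum>i\<in>{i}. c i * v i f) = tangent_scale \<A> (c i) (v i)"
      by (simp add: tangent_scale_def)
    then show ?case using tangent_scale_in[OF v] cotangent_scale_tangent[OF _ v] by simp
  next
    case (insert i I)
    let ?w = "\<lambda>f\<in>C_infinity \<A>. \<Sum>i\<in>I. c i * v i f"
    have IH: "?w \<in> tangent_space \<A> x \<and> (\<alpha> \<in> cotangent_space \<A> x \<longrightarrow> \<alpha> ?w = (\<Sum>i\<in>I. c i * \<alpha> (v i)))"
      using insert.prems by (intro insert.IH) blast
    have v: "v i \<in> tangent_space \<A> x" using insert.prems by blast
    have w: "?w \<in> tangent_space \<A> x" using IH by blast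
    have "(\<lambda>f\<in>C_infinity \<A>. \<Sum>i\<in>insert i I. c i * v i f) = tangent_add \<A> (tangent_scale \<A> (c i) (v i)) ?w"
      using insert.hyps by (auto simp: tangent_add_def tangent_scale_def fun_eq_iff)
    moreover have "\<alpha> (tangent_add \<A> (tangent_scale \<A> (c i) (v i)) ?w) = (\<Sum>i\<in>insert i I. c i * \<alpha> (v i))"
      if "\<alpha> \<in> cotangent_space \<A> x"
      using cotangent_add_tangent[OF that tangent_scale_in[OF v] w] cotangent_scale_tangent[OF that v]
        IH that insert.hyps by simp
    ultimately show ?case
      using tangent_add_in[OF tangent_scale_in[OF v] w] by (simp only:) blast
  qed
  then show "(\<lambda>f\<in>C_infinity \<A>. \<Sum>i\<in>I. c i * v i f) \<in> tangent_space \<A> x"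
    and "\<alpha> \<in> cotangent_space \<A> x \<Longrightarrow> \<alpha> (\<lambda>f\<in>C_infinity \<A>. \<Sum>i\<in>I. c i * v i f) = (\<Sum>i\<in>I. c i * \<alpha> (v i))"
    by auto
qed

lemma vector_fieldD: "X \<in> vector_fields \<A> \<Longrightarrow> X p \<in> tangent_space \<A> p"
  "X \<in> vector_fields \<A> \<Longrightarrow> f \<in> C_infinity \<A> \<Longrightarrow> (\<lambda>p. X p f) \<in> C_infinity \<A>"
  by (simp_all add: vector_fields_def)

lemma differential_one_form: "f \<in> C_infinity \<A> \<Longrightarrow> differential \<A> f \<in> one_forms \<A>"
  unfolding one_forms_def
  by (auto simp: differential_in differential_apply[OF vector_fieldD(1)] vector_fieldD(2))

context
  fixes \<Lambda> :: "'m bivector_field" and E :: "'m \<Rightarrow> ('m \<Rightarrow> real) \<Rightarrow> real"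
  assumes \<Lambda>: "\<Lambda> \<in> bivector_fields \<A>" and E: "E \<in> vector_fields \<A>"
begin

lemmas bivector_props = \<Lambda>[unfolded bivector_fields_def mem_Collect_eq, THEN conjunct2, THEN conjunct1,
    rule_format]

lemma bivector_skew:
  "\<alpha> \<in> cotangent_space \<A> p \<Longrightarrow> \<gamma> \<in> cotangent_space \<A> p \<Longrightarrow> \<Lambda> p \<alpha> \<gamma> = - \<Lambda> p \<gamma> \<alpha>"
  and bivector_add: "\<alpha> \<in> cotangent_space \<A> p \<Longrightarrow> \<alpha>' \<in> cotangent_space \<A> p \<Longrightarrow>
    \<gamma> \<in> cotangent_space \<A> p \<Longrightarrow> \<Lambda> p (cotangent_add \<A> p \<alpha> \<alpha>') \<gamma> = \<Lambda> p \<alpha> \<gamma> + \<Lambda> p \<alpha>' \<gamma>"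
  and bivector_scale: "\<alpha> \<in> cotangent_space \<A> p \<Longrightarrow> \<gamma> \<in> cotangent_space \<A> p \<Longrightarrow>
    \<Lambda> p (cotangent_scale \<A> p c \<alpha>) \<gamma> = c * \<Lambda> p \<alpha> \<gamma>"
  using bivector_props[of \<alpha> p \<gamma>] by blast+

lemma bivector_smooth:
  "\<alpha> \<in> one_forms \<A> \<Longrightarrow> \<gamma> \<in> one_forms \<A> \<Longrightarrow> (\<lambda>p. \<Lambda> p (\<alpha> p) (\<gamma> p)) \<in> C_infinity \<A>"
  using \<Lambda>[unfolded bivector_fields_def mem_Collect_eq, THEN conjunct2, THEN conjunct2] by blast

abbreviation "L f g p \<equiv> \<Lambda> p (differential \<A> f p) (differential \<A> g p)"
abbreviation "jb \<equiv> jacobi_bracket \<A> \<Lambda> E"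

context
  fixes f g :: "'m \<Rightarrow> real"
  assumes f: "f \<in> C_infinity \<A>" and g: "g \<in> C_infinity \<A>"
begin

lemma bivector_skew_fun: "L f g p = - L g f p"
  by (rule bivector_skew[OF differential_in[OF f] differential_in[OF g]])

lemma bivector_scale_fun: "L (\<lambda>q. c * f q) g p = c * L f g p"
  unfolding differential_scale[OF f] by (intro bivector_scale differential_in f g)

lemma bivector_smooth_fun: "L f g \<in> C_infinity \<A>"
  by (rule bivector_smooth[OF differential_one_form[OF f] differential_one_form[OF g]])

lemma jb_smooth: "jb f g \<in> C_infinity \<A>"
  unfolding jacobi_bracket_def
  by (intro C_diff C_add C_mult bivector_smooth_fun vector_fieldD(2)[OF E] f g)

lemma jb_skew: "jb f g p = - jb g f p"
  unfolding jacobi_bracket_def using bivector_skew_fun by simp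

end

context
  fixes f g h :: "'m \<Rightarrow> real"
  assumes f: "f \<in> C_infinity \<A>" and g: "g \<in> C_infinity \<A>" and h: "h \<in> C_infinity \<A>"
begin

lemma bivector_add_fun: "L (\<lambda>q. f q + g q) h p = L f h p + L g h p"
  unfolding differential_add[OF f g] by (intro bivector_add differential_in f g h)

lemma bivector_mult_fun: "L (\<lambda>q. f q * g q) h p = f p * L g h p + g p * L f h p"
  unfolding differential_mult[OF f g]
  by (simp add: bivector_add bivector_scale cotangent_scale_in differential_in f g h)

lemma bivector_add_fun2: "L h (\<lambda>q. f q + g q) p = L h f p + L h g p"
  using bivector_skew_fun[OF h C_add[OF f g], of p] bivector_add_fun[of p]
    bivector_skew_fun[OF h f, of p] bivector_skew_fun[OF h g, of p] by simp

lemma bivector_mult_fun2: "L h (\<lambda>q. f q * g q) p = f p * L h g p + g p * L h f p"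
  using bivector_skew_fun[OF h C_mult[OF f g], of p] bivector_mult_fun[of p]
    bivector_skew_fun[OF h f, of p] bivector_skew_fun[OF h g, of p] by simp

lemma jb_add: "jb h (\<lambda>q. f q + g q) p = jb h f p + jb h g p"
  unfolding jacobi_bracket_def bivector_add_fun2 tangent_add_fun[OF vector_fieldD(1)[OF E] f g]
  by (simp add: algebra_simps)

end

context
  fixes f h :: "'m \<Rightarrow> real"
  assumes f: "f \<in> C_infinity \<A>" and h: "h \<in> C_infinity \<A>"
begin

lemma bivector_scale_fun2: "L h (\<lambda>q. c * f q) p = c * L h f p"
  using bivector_skew_fun[OF h C_scale[OF f, of c], of p]
    bivector_scale_fun[OF f h, where c = c and p = p] bivector_skew_fun[OF h f, of p] by simp

lemma jb_scale: "jb h (\<lambda>q. c * f q) p = c * jb h f p"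
  unfolding jacobi_bracket_def bivector_scale_fun2 tangent_scale_fun[OF vector_fieldD(1)[OF E] f]
  by (simp add: algebra_simps)

end

lemma bivector_const2: "h \<in> C_infinity \<A> \<Longrightarrow> L h (\<lambda>_. c) p = 0"
proof -
  assume h: "h \<in> C_infinity \<A>"
  have one: "(\<lambda>_. 1) \<in> C_infinity \<A>" by simp
  have "L h (\<lambda>_. 1) p = 0"
    using bivector_mult_fun2[OF one one h, of p] by simp
  then show ?thesis
    using bivector_scale_fun2[OF one h, where c = c and p = p] by simp
qed

text \<open>E can thus be read off from the bracket, before anything is known about
  \<Lambda>.\<close>

lemma jb_one: "h \<in> C_infinity \<A> \<Longrightarrow> jb h (\<lambda>_. 1) p = - E p h"
  unfolding jacobi_bracket_def tangent_const[OF vector_fieldD(1)[OF E]] by (simp add: bivector_const2)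

text \<open>{h, -} is a first-order operator and not a derivation: its zero-order term {h, 1} = -
  E(h) would be counted twice by the Leibniz rule, and the last term corrects this.\<close>

lemma jb_mult:
  assumes f: "f \<in> C_infinity \<A>" and g: "g \<in> C_infinity \<A>" and h: "h \<in> C_infinity \<A>"
  shows "jb h (\<lambda>q. f q * g q) p = f p * jb h g p + g p * jb h f p - f p * g p * jb h (\<lambda>_. 1) p"
  unfolding jb_one[OF h] unfolding jacobi_bracket_def bivector_mult_fun2[OF f g h]
    tangent_mult_fun[OF vector_fieldD(1)[OF E] f g]
  by (simp add: algebra_simps)

text \<open>
  The Jacobiator, written as the defect of \<open>{f, -}\<close> and \<open>{g, -}\<close> from being a representation. Being
  assembled from commutators of first-order operators, it is of first order in its last argument.
\<close>

definition "jacobiator f g h p = jb f (jb g h) p - jb g (jb f h) p - jb (jb f g) h p"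

lemma jacobiator_add:
  assumes f: "f \<in> C_infinity \<A>" and g: "g \<in> C_infinity \<A>"
    and h: "h \<in> C_infinity \<A>" and k: "k \<in> C_infinity \<A>"
  shows "jacobiator f g (\<lambda>q. h q + k q) p = jacobiator f g h p + jacobiator f g k p"
proof -
  have e: "jb f (\<lambda>q. h q + k q) = (\<lambda>q. jb f h q + jb f k q)" if "f \<in> C_infinity \<A>" for f
    using jb_add[OF h k that] by blast
  show ?thesis
    unfolding jacobiator_def
    by (simp add: e f g jb_smooth[OF f g] jb_add[OF jb_smooth jb_smooth f] jb_add[OF jb_smooth jb_smooth g] h k)
qed

lemma jacobiator_scale:
  assumes f: "f \<in> C_infinity \<A>" and g: "g \<in> C_infinity \<A>" and h: "h \<in> C_infinity \<A>"
  shows "jacobiator f g (\<lambda>q. c * h q) p = c * jacobiator f g h p"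
proof -
  have e: "jb f (\<lambda>q. c * h q) = (\<lambda>q. c * jb f h q)" if "f \<in> C_infinity \<A>" for f
    using jb_scale[OF h that] by blast
  show ?thesis
    unfolding jacobiator_def
    by (simp add: e f g jb_smooth[OF f g] jb_scale[OF jb_smooth f] jb_scale[OF jb_smooth g] h algebra_simps)
qed

text \<open>In the expansion of {f, {g, h k}} the cross terms, such as {g, k} {f, h} + {g, h} {f,
  k}, are symmetric in f and g and cancel in the commutator. What remains is the product rule of a
  first-order operator.\<close>

lemma jacobiator_mult:
  assumes f: "f \<in> C_infinity \<A>" and g: "g \<in> C_infinity \<A>"
    and h: "h \<in> C_infinity \<A>" and k: "k \<in> C_infinity \<A>"
  shows "jacobiator f g (\<lambda>q. h q * k q) p =
    h p * jacobiator f g k p + k p * jacobiator f g h p - h p * k p * jacobiator f g (\<lambda>_. 1) p"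
proof -
  let ?one = "\<lambda>_::'m. 1::real"
  have expand: "jb f (jb g (\<lambda>q. h q * k q)) p =
      h p * jb f (jb g k) p + jb g k p * jb f h p - h p * jb g k p * jb f ?one p +
      (k p * jb f (jb g h) p + jb g h p * jb f k p - k p * jb g h p * jb f ?one p) -
      (h p * k p * jb f (jb g ?one) p +
        jb g ?one p * (h p * jb f k p + k p * jb f h p - h p * k p * jb f ?one p) -
        h p * k p * jb g ?one p * jb f ?one p)"
    if f: "f \<in> C_infinity \<A>" and g: "g \<in> C_infinity \<A>" for f g
  proof -
    have gh: "jb g h \<in> C_infinity \<A>" and gk: "jb g k \<in> C_infinity \<A>" and g1: "jb g ?one \<in> C_infinity \<A>"
      using jb_smooth[OF g] h k by simp_all
    have hk: "(\<lambda>q. h q * k q) \<in> C_infinity \<A>" by (rule C_mult[OF h k])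
    have "jb g (\<lambda>q. h q * k q) =
        (\<lambda>q. (h q * jb g k q + k q * jb g h q) + (- 1) * (h q * k q * jb g ?one q))"
      using jb_mult[OF h k g] by (simp add: fun_eq_iff)
    then have "jb f (jb g (\<lambda>q. h q * k q)) p =
        jb f (\<lambda>q. (h q * jb g k q + k q * jb g h q) + (- 1) * (h q * k q * jb g ?one q)) p"
      by simp
    also have "\<dots> = jb f (\<lambda>q. h q * jb g k q) p + jb f (\<lambda>q. k q * jb g h q) p +
        (- 1) * jb f (\<lambda>q. h q * k q * jb g ?one q) p"
      by (simp only: jb_add[OF C_add[OF C_mult[OF h gk] C_mult[OF k gh]] C_scale[OF C_mult[OF hk g1]] f]
          jb_add[OF C_mult[OF h gk] C_mult[OF k gh] f] jb_scale[OF C_mult[OF hk g1] f])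
    finally show ?thesis
      by (simp only: jb_mult[OF h gk f] jb_mult[OF k gh f] jb_mult[OF hk g1 f] jb_mult[OF h k f])
        (simp add: algebra_simps)
  qed
  show ?thesis
    unfolding jacobiator_def expand[OF f g] expand[OF g f] jb_mult[OF h k jb_smooth[OF f g]]
    by (simp add: algebra_simps)
qed

text \<open>A first-order operator that kills 1 is a derivation: the correction term in
  \<open>jacobiator_mult\<close> disappears.\<close>

lemma jacobiator_tangent:
  assumes f: "f \<in> C_infinity \<A>" and g: "g \<in> C_infinity \<A>" and 1: "jacobiator f g (\<lambda>_. 1) p = 0"
  shows "(\<lambda>h\<in>C_infinity \<A>. jacobiator f g h p) \<in> tangent_space \<A> p"
  by (rule tangent_spaceI)
    (simp_all add: C_add C_scale C_mult jacobiator_add jacobiator_scale jacobiator_mult f g 1)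

lemma jacobiator_cyclic:
  assumes f: "f \<in> C_infinity \<A>" and g: "g \<in> C_infinity \<A>" and h: "h \<in> C_infinity \<A>"
  shows "jacobiator f g h p = jb f (jb g h) p + jb g (jb h f) p + jb h (jb f g) p"
    and "jacobiator f g h p = jacobiator g h f p"
proof -
  have *: "jacobiator f g h p = jb f (jb g h) p + jb g (jb h f) p + jb h (jb f g) p"
    if f: "f \<in> C_infinity \<A>" and g: "g \<in> C_infinity \<A>" and h: "h \<in> C_infinity \<A>" for f g h
  proof -
    have "jb h f = (\<lambda>q. (- 1) * jb f h q)" using jb_skew[OF h f] by (simp add: fun_eq_iff)
    then have "jb g (jb h f) p = jb g (\<lambda>q. (- 1) * jb f h q) p" by simp
    also have "\<dots> = (- 1) * jb g (jb f h) p"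
      by (rule jb_scale[OF jb_smooth[OF f h] g])
    finally show ?thesis
      using jb_skew[OF h jb_smooth[OF f g], of p] by (simp add: jacobiator_def)
  qed
  show "jacobiator f g h p = jb f (jb g h) p + jb g (jb h f) p + jb h (jb f g) p"
    by (rule *[OF f g h])
  then show "jacobiator f g h p = jacobiator g h f p"
    using *[OF g h f] by simp
qed

lemma jacobi_structure_iff:
  "jacobi_structure \<A> \<Lambda> E \<longleftrightarrow> (\<forall>f\<in>C_infinity \<A>. \<forall>g\<in>C_infinity \<A>. \<forall>h\<in>C_infinity \<A>. \<forall>p. jacobiator f g h p = 0)"
  unfolding jacobi_structure_def using \<Lambda> E jacobiator_cyclic(1) by simp

end

end

section \<open>Derivations of the module of affine functions\<close>

context affine_bdl
begin

text \<open>Affine functions form a module over the basic ones but no algebra, so the Leibniz rule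
  is imposed with one basic factor only. Values off AF are left free.\<close>

definition affine_derivation :: "'a \<Rightarrow> (('a \<Rightarrow> real) \<Rightarrow> real) \<Rightarrow> bool" where
  "affine_derivation x \<theta> \<longleftrightarrow>
     (\<forall>a\<in>AF. \<forall>b\<in>AF. \<theta> (\<lambda>y. a y + b y) = \<theta> a + \<theta> b) \<and>
     (\<forall>c. \<forall>a\<in>AF. \<theta> (\<lambda>y. c * a y) = c * \<theta> a) \<and>
     (\<forall>f\<in>CM. \<forall>b\<in>AF. \<theta> (\<lambda>y. f (\<pi> y) * b y) = f (\<pi> x) * \<theta> b + b x * \<theta> (\<lambda>y. f (\<pi> y)))"

lemma affine_derivationD:
  assumes "affine_derivation x \<theta>"
  shows "a \<in> AF \<Longrightarrow> b \<in> AF \<Longrightarrow> \<theta> (\<lambda>y. a y + b y) = \<theta> a + \<theta> b"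
    and "a \<in> AF \<Longrightarrow> \<theta> (\<lambda>y. c * a y) = c * \<theta> a"
    and "f \<in> CM \<Longrightarrow> b \<in> AF \<Longrightarrow> \<theta> (\<lambda>y. f (\<pi> y) * b y) = f (\<pi> x) * \<theta> b + b x * \<theta> (\<lambda>y. f (\<pi> y))"
  using assms by (simp_all add: affine_derivation_def)

lemma additive_sum:
  fixes \<theta> :: "('a \<Rightarrow> real) \<Rightarrow> real"
  assumes add: "\<And>a b. a \<in> AF \<Longrightarrow> b \<in> AF \<Longrightarrow> \<theta> (\<lambda>y. a y + b y) = \<theta> a + \<theta> b"
    and "\<And>i. i \<in> I \<Longrightarrow> f i \<in> AF"
  shows "\<theta> (\<lambda>y. \<Sum>i\<in>I. f i y) = (\<Sum>i\<in>I. \<theta> (f i))"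
  using assms(2)
proof (induction I rule: infinite_finite_induct)
  case (insert i I)
  then show ?case using add[of "f i" "\<lambda>y. \<Sum>i\<in>I. f i y"] by (simp add: AF_sum)
qed (use add[of "\<lambda>_. 0" "\<lambda>_. 0"] in auto)

lemma tangent_affine_derivation:
  "v \<in> tangent_space tA x \<Longrightarrow> affine_derivation x v"
  unfolding affine_derivation_def
  using T.tangent_add_fun T.tangent_scale_fun T.tangent_mult_fun[OF _ CM_pullback AF_D(1)]
  by (simp add: AF_D(1))

end

text \<open>On basic functions \<theta> acts as a tangent vector of M, and it kills the base
  coordinates \<open>u b\<close>, whose pullbacks are the \<open>Y (b, 0)\<close>; so it kills all
  basic functions. Through \<open>affine_frame\<close> an affine function then reduces to the
  \<open>Y (0, i)\<close>, which are killed as well.\<close>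

lemma (in adapted) affine_derivation_vanish:
  assumes \<theta>: "affine_derivation x \<theta>" and x: "\<pi> x \<in> V" and Y: "\<And>j. j \<in> C \<Longrightarrow> \<theta> (Y j) = 0"
    and a: "a \<in> AF"
  shows "\<theta> a = 0"
proof -
  note D = affine_derivationD[OF \<theta>]
  have YY: "\<theta> (Y z) = 0" for z
  proof -
    have "\<theta> (\<lambda>x. \<Sum>j\<in>C. (z \<bullet> j) * Y j x) = (\<Sum>j\<in>C. \<theta> (\<lambda>x. (z \<bullet> j) * Y j x))"
      by (rule additive_sum[OF D(1)]) (auto intro: AF_scale Y_AF)
    also have "\<dots> = 0" using D(2)[OF Y_AF] Y by simp
    finally show ?thesis using Y_expansion[of z] by simp
  qed
  define \<eta> where "\<eta> = (\<lambda>f\<in>CM. \<theta> (\<lambda>y. f (\<pi> y)))"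
  have "\<eta> \<in> tangent_space bA (\<pi> x)"
  proof (rule M.tangent_spaceI)
    fix f g assume f: "f \<in> CM" and g: "g \<in> CM"
    show "\<eta> (\<lambda>q. f q * g q) = f (\<pi> x) * \<eta> g + g (\<pi> x) * \<eta> f"
      using D(3)[OF f AF_basic[OF g]] f g by (simp add: \<eta>_def M.C_mult)
    show "\<eta> (\<lambda>q. f q + g q) = \<eta> f + \<eta> g"
      using D(1)[OF AF_basic[OF f] AF_basic[OF g]] f g by (simp add: \<eta>_def M.C_add)
    show "\<eta> (\<lambda>q. c * f q) = c * \<eta> f" for c
      using D(2)[OF AF_basic[OF f], of c] f by (simp add: \<eta>_def M.C_scale)
  qed (simp add: \<eta>_def)
  moreover have "\<eta> (u b) = 0" for b
    using YY[of "(b, 0)"] u_CM by (simp add: \<eta>_def Y_basic)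
  ultimately have "\<eta> f = 0" if "f \<in> CM" for f
    using tangent_base_vanish x that by blast
  then have basic: "\<theta> (\<lambda>y. f (\<pi> y)) = 0" if "f \<in> CM" for f
    using that by (simp add: \<eta>_def)
  obtain g g0 where g: "\<And>i. g i \<in> CM" "g0 \<in> CM"
    "(\<lambda>x. \<beta> (\<pi> x) * \<beta> (\<pi> x) * a x) = (\<lambda>x. (\<Sum>i\<in>Basis. g i (\<pi> x) * Y (0, i) x) + g0 (\<pi> x))"
    by (rule affine_frame[OF a]) (rule that)
  have gY: "(\<lambda>x. g i (\<pi> x) * Y (0, i) x) \<in> AF" for i
    by (rule AF_mult_basic[OF g(1) Y_AF])
  have s: "(\<lambda>x. \<Sum>i\<in>Basis. g i (\<pi> x) * Y (0, i) x) \<in> AF"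
    by (rule AF_sum) (rule gY)
  \<comment> \<open>The Leibniz rule leaves only \<theta> a, since \<theta> kills the basic function
    \<beta>^2 and \<beta> = 1 at the base point of x.\<close>
  have "\<theta> (\<lambda>x. \<beta> (\<pi> x) * \<beta> (\<pi> x) * a x) = \<theta> a"
    using D(3)[OF M.C_mult[OF \<beta>(1) \<beta>(1)] a] basic[OF M.C_mult[OF \<beta>(1) \<beta>(1)]] V_N[OF x] by simp
  moreover have "\<theta> (\<lambda>x. (\<Sum>i\<in>Basis. g i (\<pi> x) * Y (0, i) x) + g0 (\<pi> x)) = 0"
  proof -
    have "\<theta> (\<lambda>x. g i (\<pi> x) * Y (0, i) x) = 0" for i
      unfolding D(3)[OF g(1) Y_AF] YY basic[OF g(1)] by simp
    note z = this
    have "\<theta> (\<lambda>x. \<Sum>i\<in>Basis. g i (\<pi> x) * Y (0, i) x) =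
        (\<Sum>i\<in>Basis. \<theta> (\<lambda>x. g i (\<pi> x) * Y (0, i) x))"
      by (rule additive_sum[OF D(1) gY])
    then show ?thesis
      unfolding D(1)[OF s AF_basic[OF g(2)]] basic[OF g(2)] by (simp add: z)
  qed
  ultimately show ?thesis using g(3) by simp
qed

context affine_bdl
begin

text \<open>Choose a tangent vector with the values of \<theta> on the \<open>Y j\<close>. Its
  difference with \<theta> is an affine derivation that kills all of them, hence vanishes on affine
  functions.\<close>

lemma affine_derivation_extend:
  assumes \<theta>: "affine_derivation x \<theta>"
  shows "\<exists>v. v \<in> tangent_space tA x \<and> (\<forall>a\<in>AF. v a = \<theta> a)"
proof -
  obtain U \<tau> W \<psi> S N K V \<beta> C D where "adapted B n U \<tau> W \<psi> S N K V \<beta> C D" and pV: "\<pi> x \<in> V"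
    by (rule adapted_at)
  then interpret adapted B n U \<tau> W \<psi> S N K V \<beta> C D by blast
  obtain v where v: "v \<in> tangent_space tA x" "\<And>j. j \<in> C \<Longrightarrow> v (Y j) = \<theta> (Y j)"
    by (rule tangent_exists[OF pV, of "\<lambda>j. \<theta> (Y j)"]) blast
  have "affine_derivation x (\<lambda>a. v a - \<theta> a)"
    using affine_derivationD[OF tangent_affine_derivation[OF v(1)]] affine_derivationD[OF \<theta>]
    unfolding affine_derivation_def by (simp add: algebra_simps)
  from affine_derivation_vanish[OF this pV] have "v a = \<theta> a" if "a \<in> AF" for a
    using v(2) that by simp
  then show ?thesis using v(1) by blast
qed

lemma tangent_eq_AF:
  assumes v: "v \<in> tangent_space tA x" and w: "w \<in> tangent_space tA x"
    and eq: "\<And>a. a \<in> AF \<Longrightarrow> v a = w a"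
  shows "v = w"
proof -
  obtain U \<tau> W \<psi> S N K V \<beta> C D where "adapted B n U \<tau> W \<psi> S N K V \<beta> C D" and pV: "\<pi> x \<in> V"
    by (rule adapted_at)
  then interpret adapted B n U \<tau> W \<psi> S N K V \<beta> C D by blast
  show ?thesis
    by (rule T.tangent_eqI[OF v w]) (simp add: tangent_total[OF v pV] tangent_total[OF w pV] eq Y_AF)
qed

text \<open>Near each point X f is a combination of the smooth functions X (Y j) with the smooth
  coefficients of \<open>chain_rule\<close>.\<close>

lemma vector_fieldI_AF:
  assumes X: "\<And>x. X x \<in> tangent_space tA x" and smooth: "\<And>a. a \<in> AF \<Longrightarrow> (\<lambda>x. X x a) \<in> CA"
  shows "X \<in> vector_fields tA"
  unfolding vector_fields_def
proof (intro CollectI conjI allI ballI X)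
  fix f assume f: "f \<in> CA"
  show "(\<lambda>x. X x f) \<in> CA"
  proof (rule T.C_local)
    fix x0
    obtain U \<tau> W \<psi> S N K V \<beta> C D where "adapted B n U \<tau> W \<psi> S N K V \<beta> C D" and pV: "\<pi> x0 \<in> V"
      by (rule adapted_at)
    then interpret adapted B n U \<tau> W \<psi> S N K V \<beta> C D by blast
    obtain d where d: "\<And>j. d j \<in> CA"
      "\<And>x v. \<pi> x \<in> V \<Longrightarrow> v \<in> tangent_space tA x \<Longrightarrow> v f = (\<Sum>j\<in>C. d j x * v (Y j))"
      by (rule chain_rule[OF f]) (rule that)
    have oV: "open (\<pi> -` V)" using open_proj_vimage[OF V(1)] .
    have "(\<lambda>x. \<Sum>j\<in>C. d j x * X x (Y j)) \<in> CA"
      by (intro T.C_sum T.C_mult d(1) smooth Y_AF)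
    then have "smooth_fun_on tA (\<pi> -` V) (\<lambda>x. \<Sum>j\<in>C. d j x * X x (Y j))"
      by (rule T.C_infinityD)
    then have "smooth_fun_on tA (\<pi> -` V) (\<lambda>x. X x f)"
      by (rule T.smooth_fun_on_cong[OF oV, rotated]) (simp add: d(2)[OF _ X])
    then show "\<exists>T. open T \<and> x0 \<in> T \<and> smooth_fun_on tA T (\<lambda>x. X x f)"
      using oV pV by blast
  qed
qed

text \<open>With tangent vectors \<open>e j\<close> dual to the functions \<open>Y j\<close>, the
  covector \<alpha> is the differential of the sum of the \<open>Y j\<close> with constant
  coefficients \<alpha> (e j).\<close>

lemma cotangent_repr:
  assumes \<alpha>: "\<alpha> \<in> cotangent_space tA x"
  shows "\<exists>a. a \<in> AF \<and> \<alpha> = differential tA a x"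
proof -
  obtain U \<tau> W \<psi> S N K V \<beta> C D where "adapted B n U \<tau> W \<psi> S N K V \<beta> C D" and pV: "\<pi> x \<in> V"
    by (rule adapted_at)
  then interpret adapted B n U \<tau> W \<psi> S N K V \<beta> C D by blast
  have "\<exists>v. v \<in> tangent_space tA x \<and> (\<forall>j\<in>C. v (Y j) = (if i = j then 1 else 0))" for i
    by (rule tangent_exists[OF pV, of "\<lambda>j. if i = j then 1 else 0"]) blast
  then obtain e where e: "\<And>i. e i \<in> tangent_space tA x"
    "\<And>i j. j \<in> C \<Longrightarrow> e i (Y j) = (if i = j then 1 else 0)" by metis
  have fin: "finite C" by (rule orthonormal_basis_finite[OF C])
  \<comment> \<open>\<open>tangent_combination\<close> asks for a nonempty index set. The typical
    fibre contains a basis vector, so the model space of A is not zero.\<close>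
  have "C \<noteq> {}"
  proof
    assume "C = {}"
    then have "z = 0" for z :: "'e \<times> 'f"
      using orthonormal_expansion[OF C, of z] by simp
    moreover obtain i :: 'f where i: "i \<in> Basis" using nonempty_Basis by blast
    ultimately have "(0 :: 'e, i) = 0" by blast
    then show False using nonzero_Basis[OF i] by (simp add: prod_eq_iff)
  qed
  note comb = T.tangent_combination[where v = e, OF fin \<open>C \<noteq> {}\<close> e(1)]
  let ?a = "\<lambda>y. \<Sum>j\<in>C. \<alpha> (e j) * Y j y"
  have "?a \<in> AF" by (intro AF_sum AF_scale Y_AF)
  moreover have "\<alpha> = differential tA ?a x"
  proof (rule T.cotangent_eqI[OF \<alpha> T.differential_in[OF AF_D(1)[OF \<open>?a \<in> AF\<close>]]])
    fix v assume v: "v \<in> tangent_space tA x"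
    let ?w = "\<lambda>f\<in>CA. \<Sum>i\<in>C. v (Y i) * e i f"
    have "v (Y j) = ?w (Y j)" if "j \<in> C" for j
    proof -
      have "?w (Y j) = (\<Sum>i\<in>C. v (Y i) * (if i = j then 1 else 0))"
        unfolding e(2)[OF that, symmetric] using AF_D(1)[OF Y_AF] by simp
      also have "\<dots> = v (Y j)" using that fin by (simp add: if_distrib cong: if_cong)
      finally show ?thesis by simp
    qed
    have "v = ?w"
    proof (rule T.tangent_eqI[OF v comb(1)])
      fix f assume "f \<in> CA"
      show "v f = ?w f"
        unfolding tangent_total[OF v pV \<open>f \<in> CA\<close>] tangent_total[OF comb(1) pV \<open>f \<in> CA\<close>]
        using \<open>\<And>j. j \<in> C \<Longrightarrow> v (Y j) = ?w (Y j)\<close> by (intro sum.cong) simp_all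
    qed
    then have "\<alpha> v = \<alpha> ?w" by (rule arg_cong)
    also have "\<dots> = (\<Sum>i\<in>C. v (Y i) * \<alpha> (e i))" by (rule comb(2)[OF \<alpha>])
    also have "\<dots> = (\<Sum>i\<in>C. v (\<lambda>y. \<alpha> (e i) * Y i y))"
      using T.tangent_scale_fun[OF v AF_D(1)[OF Y_AF]] by (simp add: mult.commute)
    also have "\<dots> = v ?a"
      by (rule T.tangent_sum_fun[OF v, symmetric]) (auto intro: AF_D AF_scale Y_AF)
    finally show "\<alpha> v = differential tA ?a x v" using T.differential_apply[OF v] by simp
  qed
  ultimately show ?thesis by blast
qed

text \<open>If a vanishes over p, then so do all coefficients of \<open>affine_frame\<close> at p,
  and \<theta> sees these coefficients only through their values at p. A functional of this kind
  therefore depends only on the restriction of a to the fibre.\<close>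

lemma tensorial:
  fixes \<theta> :: "('a \<Rightarrow> real) \<Rightarrow> real"
  assumes add: "\<And>a b. a \<in> AF \<Longrightarrow> b \<in> AF \<Longrightarrow> \<theta> (\<lambda>y. a y + b y) = \<theta> a + \<theta> b"
    and mult: "\<And>f b. f \<in> CM \<Longrightarrow> b \<in> AF \<Longrightarrow> \<theta> (\<lambda>y. f (\<pi> y) * b y) = f p * \<theta> b"
    and a: "a \<in> AF" "\<And>x. \<pi> x = p \<Longrightarrow> a x = 0"
  shows "\<theta> a = 0"
proof -
  obtain U \<tau> W \<psi> S N K V \<beta> C D where "adapted B n U \<tau> W \<psi> S N K V \<beta> C D" and pV: "p \<in> V"
    by (rule adapted_at)
  then interpret adapted B n U \<tau> W \<psi> S N K V \<beta> C D by blast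
  obtain g g0 where
    g3: "(\<lambda>x. \<beta> (\<pi> x) * \<beta> (\<pi> x) * a x) = (\<lambda>x. (\<Sum>i\<in>Basis. g i (\<pi> x) * Y (0, i) x) + g0 (\<pi> x))"
    and g: "\<And>i. g i \<in> CM" "g0 \<in> CM"
    "\<And>p. (\<And>x. \<pi> x = p \<Longrightarrow> a x = 0) \<Longrightarrow> p \<in> V \<Longrightarrow> g0 p = 0 \<and> (\<forall>i. g i p = 0)"
    by (rule affine_frame[OF a(1)]) (rule that, assumption+, simp)
  have g4: "g0 p = 0" "g i p = 0" for i using g(3)[OF a(2) pV] by auto
  have gY: "(\<lambda>x. g i (\<pi> x) * Y (0, i) x) \<in> AF" for i
    by (rule AF_mult_basic[OF g(1) Y_AF])
  have s: "(\<lambda>x. \<Sum>i\<in>Basis. g i (\<pi> x) * Y (0, i) x) \<in> AF"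
    by (rule AF_sum) (rule gY)
  have "\<theta> (\<lambda>x. \<beta> (\<pi> x) * \<beta> (\<pi> x) * a x) = \<theta> a"
    using mult[OF M.C_mult[OF \<beta>(1) \<beta>(1)] a(1)] V_N[OF pV] by simp
  moreover have "\<theta> (\<lambda>x. (\<Sum>i\<in>Basis. g i (\<pi> x) * Y (0, i) x) + g0 (\<pi> x)) = 0"
  proof -
    have "\<theta> (\<lambda>x. g i (\<pi> x) * Y (0, i) x) = 0" for i
      unfolding mult[OF g(1) Y_AF] g4 by simp
    note z = this
    have "\<theta> (\<lambda>x. \<Sum>i\<in>Basis. g i (\<pi> x) * Y (0, i) x) =
        (\<Sum>i\<in>Basis. \<theta> (\<lambda>x. g i (\<pi> x) * Y (0, i) x))"
      by (rule additive_sum[OF add gY])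
    moreover have "\<theta> (\<lambda>x. g0 (\<pi> x)) = 0"
      using mult[OF g(2) AF_const[of 1]] g4(1) by simp
    ultimately show ?thesis
      unfolding add[OF s AF_basic[OF g(2)]] by (simp add: z)
  qed
  ultimately show ?thesis using g3 by simp
qed

lemma fibre_extension:
  assumes "\<alpha> \<in> fibre aff p"
  shows "\<exists>a. a \<in> AF \<and> tilde B a p = \<alpha>"
proof -
  obtain U \<tau> W \<psi> S N K V \<beta> C D where "adapted B n U \<tau> W \<psi> S N K V \<beta> C D" and pV: "p \<in> V"
    by (rule adapted_at)
  then interpret adapted B n U \<tau> W \<psi> S N K V \<beta> C D by blast
  have p: "p \<in> U" using V_N(1)[OF pV] N(1) by blast
  obtain w c where wc: "\<And>x. \<pi> x = p \<Longrightarrow> \<alpha> x = w \<bullet> \<tau> x + c"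
    using assms affine_on_fibre_iff[OF tr p] unfolding fibre_aff_dual by blast
  obtain a where "a \<in> AF" "\<forall>x. \<pi> x = p \<longrightarrow> a x = w \<bullet> \<tau> x + c"
    using affine_through[OF pV] by blast
  moreover from this have "tilde B a p = \<alpha>"
    using wc assms unfolding fibre_aff_dual tilde_def
    by (auto simp: fun_eq_iff restrict_def extensional_def)
  ultimately show ?thesis by blast
qed

lemma affine_nonconstant:
  obtains a x y where "a \<in> AF" "\<pi> x = p" "\<pi> y = p" "a x \<noteq> a y"
proof -
  obtain U \<tau> W \<psi> S N K V \<beta> C D where "adapted B n U \<tau> W \<psi> S N K V \<beta> C D" and pV: "p \<in> V"
    by (rule adapted_at)
  then interpret adapted B n U \<tau> W \<psi> S N K V \<beta> C D by blast
  have p: "p \<in> U" using V_N(1)[OF pV] N(1) by blast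
  obtain i :: 'f where i: "i \<in> Basis" using nonempty_Basis by blast
  obtain a where a: "a \<in> AF" "\<forall>x. \<pi> x = p \<longrightarrow> a x = i \<bullet> \<tau> x + 0"
    using affine_through[OF pV] by blast
  \<comment> \<open>The values at the coordinates i and 0 are 1 and 0.\<close>
  have "a (lift U \<tau> p i) \<noteq> a (lift U \<tau> p 0)"
    using a(2) i lift_props[OF tr p] by simp
  then show ?thesis using that[OF a(1)] lift_props(1)[OF tr p] by blast
qed

end

section \<open>From Lie algebroids to Jacobi structures\<close>

lemma (in manifold) bivector_outside:
  assumes "\<Lambda> \<in> bivector_fields \<A>"
  shows "\<alpha> \<notin> cotangent_space \<A> p \<Longrightarrow> \<Lambda> p \<alpha> = undefined"
    and "\<alpha> \<in> cotangent_space \<A> p \<Longrightarrow> \<gamma> \<notin> cotangent_space \<A> p \<Longrightarrow> \<Lambda> p \<alpha> \<gamma> = undefined"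
proof -
  have 1: "\<Lambda> p \<in> cotangent_space \<A> p \<rightarrow>\<^sub>E cotangent_space \<A> p \<rightarrow>\<^sub>E UNIV"
    using assms[unfolded bivector_fields_def mem_Collect_eq, THEN conjunct1] by blast
  show "\<alpha> \<notin> cotangent_space \<A> p \<Longrightarrow> \<Lambda> p \<alpha> = undefined" by (rule PiE_arb[OF 1])
  show "\<Lambda> p \<alpha> \<gamma> = undefined" if "\<alpha> \<in> cotangent_space \<A> p" "\<gamma> \<notin> cotangent_space \<A> p"
    by (rule PiE_arb[OF PiE_mem[OF 1 that(1)] that(2)])
qed

context affine_bdl
begin

abbreviation "TA \<equiv> tangent_space tA"
abbreviation "TA' \<equiv> cotangent_space tA"
abbreviation "dA \<equiv> differential tA"
abbreviation "one \<equiv> (\<lambda>_::'a. 1::real)"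

text \<open>E is recovered from {a, 1}; with E known, the bracket determines \<Lambda> on
  differentials of affine functions, that is, on all covectors. Elsewhere both bivector fields have
  the same default value.\<close>

lemma jacobi_bracket_inj:
  assumes \<Lambda>: "\<Lambda> \<in> bivector_fields tA" "\<Lambda>' \<in> bivector_fields tA"
    and E: "E \<in> vector_fields tA" "E' \<in> vector_fields tA"
    and eq: "\<And>a b. a \<in> AF \<Longrightarrow> b \<in> AF \<Longrightarrow>
      jacobi_bracket tA \<Lambda> E a b = jacobi_bracket tA \<Lambda>' E' a b"
  shows "\<Lambda> = \<Lambda>'" "E = E'"
proof -
  show EE: "E = E'"
  proof
    fix x show "E x = E' x"
    proof (rule tangent_eq_AF[OF T.vector_fieldD(1)[OF E(1)] T.vector_fieldD(1)[OF E(2)]])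
      fix a assume a: "a \<in> AF"
      show "E x a = E' x a"
        using T.jb_one[OF \<Lambda>(1) E(1) AF_D(1)[OF a], of x] T.jb_one[OF \<Lambda>(2) E(2) AF_D(1)[OF a], of x]
          eq[OF a AF_const, of 1] by simp
    qed
  qed
  show "\<Lambda> = \<Lambda>'"
  proof (intro ext)
    fix x \<alpha> \<gamma>
    show "\<Lambda> x \<alpha> \<gamma> = \<Lambda>' x \<alpha> \<gamma>"
    proof (cases "\<alpha> \<in> TA' x \<and> \<gamma> \<in> TA' x")
      case True
      then obtain a b where ab: "a \<in> AF" "\<alpha> = dA a x" "b \<in> AF" "\<gamma> = dA b x"
        using cotangent_repr by blast
      then show ?thesis
        using fun_cong[OF eq[OF ab(1,3)], of x] unfolding jacobi_bracket_def EE by simp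
    next
      case False
      then show ?thesis
        using T.bivector_outside[OF \<Lambda>(1)] T.bivector_outside[OF \<Lambda>(2)] by metis
    qed
  qed
qed

section \<open>The bivector field and the vector field of a Lie algebroid\<close>

context
  fixes br \<rho>
  assumes algebroid: "lie_algebroid bA aff br \<rho>"
begin

lemma br_bracket: "lie_bracket bA aff br"
  and br_anchor: "anchor_map bA aff \<rho>"
  and br_leibniz: "\<forall>X\<in>SA. \<forall>Y\<in>SA. \<forall>f\<in>CM. br X (sec_scale aff f Y) =
        sec_add aff (sec_scale aff f (br X Y)) (sec_scale aff (\<lambda>p. \<rho> p (X p) f) Y)"
  using algebroid unfolding lie_algebroid_def by simp_all

lemmas br_props = br_bracket[unfolded lie_bracket_def, THEN conjunct2, rule_format]

lemma br_ext: "br \<in> SA \<rightarrow>\<^sub>E SA \<rightarrow>\<^sub>E SA"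
  using br_bracket[unfolded lie_bracket_def, THEN conjunct1] .

definition "ab a b = untilde (br (tilde B a) (tilde B b))"

lemma br_tilde: "a \<in> AF \<Longrightarrow> b \<in> AF \<Longrightarrow> br (tilde B a) (tilde B b) = tilde B (ab a b)"
  and ab_AF: "a \<in> AF \<Longrightarrow> b \<in> AF \<Longrightarrow> ab a b \<in> AF"
proof -
  assume a: "a \<in> AF" and b: "b \<in> AF"
  have "br (tilde B a) (tilde B b) \<in> SA"
    by (rule PiE_mem[OF PiE_mem[OF br_ext]]) (intro tilde_section a b)+
  then show "br (tilde B a) (tilde B b) = tilde B (ab a b)" "ab a b \<in> AF"
    unfolding ab_def by (simp_all add: untilde_AF)
qed

lemma ab_add: "a \<in> AF \<Longrightarrow> b \<in> AF \<Longrightarrow> c \<in> AF \<Longrightarrow> ab (\<lambda>x. a x + b x) c = (\<lambda>x. ab a c x + ab b c x)"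
  and ab_scale: "a \<in> AF \<Longrightarrow> c \<in> AF \<Longrightarrow> ab (\<lambda>x. r * a x) c = (\<lambda>x. r * ab a c x)"
  and ab_skew: "a \<in> AF \<Longrightarrow> b \<in> AF \<Longrightarrow> ab a b = (\<lambda>x. - ab b a x)"
  and ab_jacobi: "a \<in> AF \<Longrightarrow> b \<in> AF \<Longrightarrow> c \<in> AF \<Longrightarrow>
    ab a (ab b c) x + ab b (ab c a) x + ab c (ab a b) x = 0"
proof -
  show "ab (\<lambda>x. a x + b x) c = (\<lambda>x. ab a c x + ab b c x)"
    if "a \<in> AF" "b \<in> AF" "c \<in> AF" for a b c
  proof (rule tilde_inj)
    have "br (sec_add aff (tilde B a) (tilde B b)) (tilde B c) =
        sec_add aff (br (tilde B a) (tilde B c)) (br (tilde B b) (tilde B c))"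
      using br_props[of "tilde B a" "tilde B b" "tilde B c"] that tilde_section by blast
    then show "tilde B (ab (\<lambda>x. a x + b x) c) = tilde B (\<lambda>x. ab a c x + ab b c x)"
      using that by (simp add: sec_add_tilde br_tilde AF_add)
  qed
  show "ab (\<lambda>x. r * a x) c = (\<lambda>x. r * ab a c x)" if "a \<in> AF" "c \<in> AF" for a c
  proof (rule tilde_inj)
    have "br (sec_scale aff (\<lambda>_. r) (tilde B a)) (tilde B c) =
        sec_scale aff (\<lambda>_. r) (br (tilde B a) (tilde B c))"
      using br_props[of "tilde B a" "tilde B a" "tilde B c"] that tilde_section by blast
    then show "tilde B (ab (\<lambda>x. r * a x) c) = tilde B (\<lambda>x. r * ab a c x)"
      using that by (simp add: sec_scale_tilde br_tilde AF_scale)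
  qed
  show "ab a b = (\<lambda>x. - ab b a x)" if "a \<in> AF" "b \<in> AF" for a b
  proof (rule tilde_inj)
    have "br (tilde B a) (tilde B b) = sec_scale aff (\<lambda>_. - 1) (br (tilde B b) (tilde B a))"
      using br_props[of "tilde B a" "tilde B b" "tilde B a"] that tilde_section by blast
    then show "tilde B (ab a b) = tilde B (\<lambda>x. - ab b a x)"
      using that by (simp add: sec_scale_tilde br_tilde)
  qed
  show "ab a (ab b c) x + ab b (ab c a) x + ab c (ab a b) x = 0"
    if "a \<in> AF" "b \<in> AF" "c \<in> AF" for a b c
  proof -
    have "sec_add aff (br (tilde B a) (br (tilde B b) (tilde B c)))
        (sec_add aff (br (tilde B b) (br (tilde B c) (tilde B a)))
          (br (tilde B c) (br (tilde B a) (tilde B b)))) = vzero aff"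
      using br_props[of "tilde B a" "tilde B b" "tilde B c"] that tilde_section by blast
    then have "tilde B (\<lambda>x. ab a (ab b c) x + (ab b (ab c a) x + ab c (ab a b) x)) = tilde B (\<lambda>_. 0)"
      using that by (simp add: sec_add_tilde br_tilde ab_AF vzero_tilde)
    from fun_cong[OF tilde_inj[OF this], of x] show ?thesis by simp
  qed
qed

definition "anc a f p = \<rho> p (tilde B a p) f"

lemma ab_leibniz:
  assumes a: "a \<in> AF" and b: "b \<in> AF" and f: "f \<in> CM"
  shows "ab a (\<lambda>x. f (\<pi> x) * b x) = (\<lambda>x. f (\<pi> x) * ab a b x + anc a f (\<pi> x) * b x)"
proof (rule tilde_inj)
  have "br (tilde B a) (sec_scale aff f (tilde B b)) =
      sec_add aff (sec_scale aff f (br (tilde B a) (tilde B b)))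
        (sec_scale aff (\<lambda>p. \<rho> p (tilde B a p) f) (tilde B b))"
    using br_leibniz tilde_section a b f by blast
  then show "tilde B (ab a (\<lambda>x. f (\<pi> x) * b x)) =
      tilde B (\<lambda>x. f (\<pi> x) * ab a b x + anc a f (\<pi> x) * b x)"
    unfolding sec_scale_tilde br_tilde[OF a b] br_tilde[OF a AF_mult_basic[OF f b]] sec_add_tilde
    by (simp add: anc_def)
qed

text \<open>The Leibniz rule with b = 1. It exhibits the anchor in terms of the bracket, which later
  gives its uniqueness.\<close>

lemma ab_basic:
  assumes a: "a \<in> AF" and f: "f \<in> CM"
  shows "ab a (\<lambda>x. f (\<pi> x)) = (\<lambda>x. f (\<pi> x) * ab a one x + anc a f (\<pi> x))"
  using ab_leibniz[OF a AF_const[of 1] f] by simp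

lemma ab_one_one: "ab one one = (\<lambda>_. 0)"
  using ab_skew[OF AF_const[of 1] AF_const[of 1]] by (simp add: fun_eq_iff)

lemma ab_add2: "a \<in> AF \<Longrightarrow> b \<in> AF \<Longrightarrow> c \<in> AF \<Longrightarrow> ab c (\<lambda>x. a x + b x) = (\<lambda>x. ab c a x + ab c b x)"
  using ab_skew[of c "\<lambda>x. a x + b x"] ab_skew[of c a] ab_skew[of c b] ab_add[of a b c]
  by (simp add: AF_add)

lemma ab_scale2: "a \<in> AF \<Longrightarrow> c \<in> AF \<Longrightarrow> ab c (\<lambda>x. r * a x) = (\<lambda>x. r * ab c a x)"
  using ab_skew[of c "\<lambda>x. r * a x"] ab_skew[of c a] ab_scale[of a c r] by (simp add: AF_scale)

definition "P c a x = ab c a x - c x * ab one a x + a x * ab one c x"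

lemma P_skew: "a \<in> AF \<Longrightarrow> c \<in> AF \<Longrightarrow> P c a x = - P a c x"
  using ab_skew[of c a] by (simp add: P_def)

text \<open>On a basic f the zero-order terms of \<open>P c\<close> cancel by {c, 1} = - {1, c},
  which leaves \<rho>(c)(f) - c \<rho>(1)(f). For a product f b, the anchor terms of {c, -} and {1,
  -} add up to b times the same expression.\<close>

lemma P_derivation:
  assumes c: "c \<in> AF"
  shows "affine_derivation x (\<lambda>a. P c a x)"
proof -
  have "P c (\<lambda>y. f (\<pi> y) * b y) x = f (\<pi> x) * P c b x + b x * P c (\<lambda>y. f (\<pi> y)) x"
    if f: "f \<in> CM" and b: "b \<in> AF" for f b
    unfolding P_def ab_leibniz[OF c b f] ab_leibniz[OF AF_const b f] ab_basic[OF c f]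
      ab_basic[OF AF_const f] ab_one_one
    using ab_skew[OF AF_const[of 1] c] by (simp add: algebra_simps)
  then show ?thesis
    unfolding affine_derivation_def
    using c by (auto simp: P_def ab_add2 ab_scale2 AF_const algebra_simps)
qed

text \<open>{1, -} has no zero-order term on basic functions, because {1, 1} = 0.\<close>

lemma E_derivation: "affine_derivation x (\<lambda>a. ab one a x)"
proof -
  have "ab one (\<lambda>y. f (\<pi> y) * b y) x = f (\<pi> x) * ab one b x + b x * ab one (\<lambda>y. f (\<pi> y)) x"
    if f: "f \<in> CM" and b: "b \<in> AF" for f b
    unfolding ab_leibniz[OF AF_const b f] ab_basic[OF AF_const f] ab_one_one
    by (simp add: algebra_simps)
  then show ?thesis
    unfolding affine_derivation_def by (auto simp: ab_add2 ab_scale2 AF_const)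
qed

definition "ham c x = (SOME v. v \<in> TA x \<and> (\<forall>a\<in>AF. v a = P c a x))"
definition "reeb x = (SOME v. v \<in> TA x \<and> (\<forall>a\<in>AF. v a = ab one a x))"
text \<open>Only the covector \<alpha> at x is given, so an affine c with this differential is
  chosen; by \<open>ham_cong\<close> the choice does not matter.\<close>

definition "poisson x = (\<lambda>\<alpha>\<in>TA' x. \<lambda>\<gamma>\<in>TA' x. \<gamma> (ham (SOME c. c \<in> AF \<and> \<alpha> = dA c x) x))"

lemma ham: "c \<in> AF \<Longrightarrow> ham c x \<in> TA x" "c \<in> AF \<Longrightarrow> a \<in> AF \<Longrightarrow> ham c x a = P c a x"
  using someI_ex[OF affine_derivation_extend[OF P_derivation, of c x]] unfolding ham_def by auto

lemma reeb: "reeb x \<in> TA x" "a \<in> AF \<Longrightarrow> reeb x a = ab one a x"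
  using someI_ex[OF affine_derivation_extend[OF E_derivation, of x]] unfolding reeb_def by auto

lemma reeb_vf: "reeb \<in> vector_fields tA"
  using reeb(1) by (rule vector_fieldI_AF) (auto simp: reeb(2) intro!: AF_D(1) ab_AF)

lemma ham_vf: "c \<in> AF \<Longrightarrow> ham c \<in> vector_fields tA"
proof (rule vector_fieldI_AF)
  assume c: "c \<in> AF"
  show "(\<lambda>x. ham c x a) \<in> CA" if a: "a \<in> AF" for a
    unfolding ham(2)[OF c a] P_def
    by (intro T.C_add T.C_diff T.C_mult AF_D(1) ab_AF a c AF_const)
qed (rule ham(1))

text \<open>By skew-symmetry \<open>ham c x a\<close> is \<open>- dA c x (ham a x)\<close>, where c
  enters through its differential at x alone, although the formula for P involves the values and
  brackets of c.\<close>

lemma ham_cong: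
  assumes c: "c \<in> AF" "c' \<in> AF" and eq: "dA c x = dA c' x"
  shows "ham c x = ham c' x"
proof (rule tangent_eq_AF[OF ham(1)[OF c(1)] ham(1)[OF c(2)]])
  fix a assume a: "a \<in> AF"
  have "ham c x a = - dA c x (ham a x)" "ham c' x a = - dA c' x (ham a x)"
    using a c P_skew[OF a c(1)] P_skew[OF a c(2)] by (simp_all add: ham T.differential_apply)
  then show "ham c x a = ham c' x a" using eq by simp
qed

lemma poisson_eq:
  assumes c: "c \<in> AF" and \<gamma>: "\<gamma> \<in> TA' x"
  shows "poisson x (dA c x) \<gamma> = \<gamma> (ham c x)"
proof -
  let ?c = "SOME c'. c' \<in> AF \<and> dA c x = dA c' x"
  have "?c \<in> AF \<and> dA c x = dA ?c x" by (rule someI[of _ c]) (simp add: c)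
  then have "ham ?c x = ham c x" using ham_cong[OF _ c, of ?c x] by auto
  then show ?thesis
    using \<gamma> T.differential_in[OF AF_D(1)[OF c], of x] by (simp add: poisson_def)
qed

lemma poisson_AF: "a \<in> AF \<Longrightarrow> c \<in> AF \<Longrightarrow> poisson x (dA c x) (dA a x) = P c a x"
  by (simp add: poisson_eq T.differential_in[OF AF_D(1)] T.differential_apply ham)

lemma poisson_bivector: "poisson \<in> bivector_fields tA"
  unfolding bivector_fields_def
proof (intro CollectI conjI allI ballI)
  fix x show "poisson x \<in> TA' x \<rightarrow>\<^sub>E TA' x \<rightarrow>\<^sub>E UNIV" by (simp add: poisson_def)
next
  fix x \<alpha> \<gamma> assume "\<alpha> \<in> TA' x" "\<gamma> \<in> TA' x"
  then obtain a c where a: "a \<in> AF" "\<gamma> = dA a x" and c: "c \<in> AF" "\<alpha> = dA c x"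
    using cotangent_repr by metis
  show "poisson x \<alpha> \<gamma> = - poisson x \<gamma> \<alpha>"
    unfolding a(2) c(2) poisson_AF[OF a(1) c(1)] poisson_AF[OF c(1) a(1)] by (rule P_skew[OF a(1) c(1)])
  show "poisson x (cotangent_scale tA x r \<alpha>) \<gamma> = r * poisson x \<alpha> \<gamma>" for r
    unfolding a(2) c(2) T.differential_scale[OF AF_D(1)[OF c(1)], symmetric]
      poisson_AF[OF a(1) c(1)] poisson_AF[OF a(1) AF_scale[OF c(1)]]
    using a c by (simp add: P_def ab_scale ab_scale2 AF_const algebra_simps)
  fix \<delta> assume "\<delta> \<in> TA' x"
  then obtain e where e: "e \<in> AF" "\<delta> = dA e x" using cotangent_repr by metis
  show "poisson x (cotangent_add tA x \<alpha> \<delta>) \<gamma> = poisson x \<alpha> \<gamma> + poisson x \<delta> \<gamma>"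
    unfolding a(2) c(2) e(2) T.differential_add[OF AF_D(1)[OF c(1)] AF_D(1)[OF e(1)], symmetric]
      poisson_AF[OF a(1) c(1)] poisson_AF[OF a(1) e(1)] poisson_AF[OF a(1) AF_add[OF c(1) e(1)]]
    using a c e by (simp add: P_def ab_add ab_add2 AF_const algebra_simps)
next
  fix \<alpha> \<gamma> assume \<alpha>: "\<alpha> \<in> one_forms tA" and \<gamma>: "\<gamma> \<in> one_forms tA"
  have \<alpha>x: "\<alpha> x \<in> TA' x" and \<gamma>x: "\<gamma> x \<in> TA' x" for x
    using \<alpha> \<gamma> unfolding one_forms_def by blast+
  have "\<exists>c. \<forall>x. c x \<in> AF \<and> \<alpha> x = dA (c x) x"
    using cotangent_repr[OF \<alpha>x] by (intro choice) blast
  then obtain c where c: "\<And>x. c x \<in> AF" "\<And>x. \<alpha> x = dA (c x) x" by blast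
  \<comment> \<open>Here c x is chosen anew at each point without any regularity, so smoothness of
    the field is not evident. On an affine a, however, it is - \<alpha> (ham a), and both \<alpha>
    and \<open>ham a\<close> are smooth.\<close>
  have Z: "(\<lambda>x. ham (c x) x) \<in> vector_fields tA"
  proof (rule vector_fieldI_AF)
    show "ham (c x) x \<in> TA x" for x by (rule ham(1)[OF c(1)])
    fix a assume a: "a \<in> AF"
    have "ham (c x) x a = - \<alpha> x (ham a x)" for x
      using P_skew[OF a c(1)[of x]] by (simp add: ham a c T.differential_apply)
    moreover have "(\<lambda>x. \<alpha> x (ham a x)) \<in> CA"
      using \<alpha> ham_vf[OF a] unfolding one_forms_def by blast
    ultimately show "(\<lambda>x. ham (c x) x a) \<in> CA" using T.C_uminus by simp
  qed
  have "\<forall>X\<in>vector_fields tA. (\<lambda>x. \<gamma> x (X x)) \<in> CA"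
    using \<gamma> unfolding one_forms_def by blast
  from bspec[OF this Z] have "(\<lambda>x. \<gamma> x (ham (c x) x)) \<in> CA" .
  then show "(\<lambda>x. poisson x (\<alpha> x) (\<gamma> x)) \<in> CA"
    unfolding c(2) poisson_eq[OF c(1) \<gamma>x] .
qed

lemma poisson_jacobi_bracket:
  assumes "a \<in> AF" "b \<in> AF"
  shows "jacobi_bracket tA poisson reeb a b = ab a b"
  unfolding jacobi_bracket_def poisson_AF[OF assms(2,1)] reeb(2)[OF assms(1)] reeb(2)[OF assms(2)]
  by (simp add: P_def)

end

text \<open>
  The Jacobiator vanishes on smooth functions as soon as it does on affine functions: fixing two of
  its arguments, it is a tangent vector in the third, and tangent vectors are determined by their
  values on affine functions. Cyclic symmetry lets this be applied to one argument after the other.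
\<close>

lemma jacobi_structure_from_affine:
  assumes \<Lambda>: "\<Lambda> \<in> bivector_fields tA" and E: "E \<in> vector_fields tA"
    and AFJ: "\<And>a b c x. a \<in> AF \<Longrightarrow> b \<in> AF \<Longrightarrow> c \<in> AF \<Longrightarrow> T.jacobiator \<Lambda> E a b c x = 0"
  shows "jacobi_structure tA \<Lambda> E"
proof -
  let ?J = "T.jacobiator \<Lambda> E"
  have first: "?J f g h x = 0" if f: "f \<in> CA" and g: "g \<in> CA" and AF: "\<And>a. a \<in> AF \<Longrightarrow> ?J f g a x = 0" and h: "h \<in> CA"
    for f g h x
  proof -
    let ?v = "\<lambda>h\<in>CA. ?J f g h x"
    have v: "?v \<in> TA x" by (rule T.jacobiator_tangent[OF \<Lambda> E f g AF[OF AF_const]])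
    have w: "(\<lambda>h\<in>CA. 0) \<in> TA x" by (rule T.tangent_spaceI) (auto simp: T.C_add T.C_scale T.C_mult)
    have "?v = (\<lambda>h\<in>CA. 0)" by (rule tangent_eq_AF[OF v w]) (simp add: AF AF_D(1))
    from fun_cong[OF this, of h] h show ?thesis by simp
  qed
  note cyc = T.jacobiator_cyclic(2)[OF \<Lambda> E]
  have 1: "?J f g h x = 0" if "f \<in> AF" "g \<in> AF" "h \<in> CA" for f g h x
    by (rule first[OF AF_D(1)[OF that(1)] AF_D(1)[OF that(2)] AFJ[OF that(1,2)] that(3)])
  have 2: "?J f g h x = 0" if "f \<in> CA" "g \<in> AF" "h \<in> CA" for f g h x
  proof (rule first[OF that(1) AF_D(1)[OF that(2)] _ that(3)])
    fix a assume a: "a \<in> AF"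
    have "?J f g a x = ?J g a f x" using cyc[OF that(1) AF_D(1)[OF that(2)] AF_D(1)[OF a]] .
    then show "?J f g a x = 0" using 1[OF that(2) a that(1)] by simp
  qed
  have 3: "?J f g h x = 0" if "f \<in> CA" "g \<in> CA" "h \<in> CA" for f g h x
  proof (rule first[OF that(1,2) _ that(3)])
    fix a assume a: "a \<in> AF"
    have "?J f g a x = ?J g a f x" using cyc[OF that(1,2) AF_D(1)[OF a]] .
    then show "?J f g a x = 0" using 2[OF that(2) a that(1)] by simp
  qed
  show ?thesis unfolding T.jacobi_structure_iff[OF \<Lambda> E] using 3 by blast
qed

lemma hamiltonian_vf_apply:
  "b \<in> CA \<Longrightarrow> hamiltonian_vf tA \<Lambda> E a x b = \<Lambda> x (dA a x) (dA b x) + a x * E x b"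
  by (simp add: hamiltonian_vf_def tangent_add_def tangent_scale_def sharp_def)

lemma jacobi_exists:
  assumes sp: "almost_special B br \<rho>"
  shows "\<exists>\<Lambda> E. strongly_affine_jacobi B \<Lambda> E \<and>
    (\<forall>a\<in>AF. \<forall>b\<in>AF. tilde B (jacobi_bracket tA \<Lambda> E a b) = br (tilde B a) (tilde B b))"
proof -
  have L: "lie_algebroid bA aff br \<rho>"
    using sp unfolding almost_special_def by blast
  note \<Lambda> = poisson_bivector[OF L] and E = reeb_vf[OF L] and jb = poisson_jacobi_bracket[OF L]
  let ?\<Lambda> = "poisson br" and ?E = "reeb br"
  have "jacobi_structure tA ?\<Lambda> ?E"
  proof (rule jacobi_structure_from_affine[OF \<Lambda> E])
    fix a b c x assume "a \<in> AF" "b \<in> AF" "c \<in> AF"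
    then show "T.jacobiator ?\<Lambda> ?E a b c x = 0"
      unfolding T.jacobiator_cyclic(1)[OF \<Lambda> E AF_D(1)[OF \<open>a \<in> AF\<close>] AF_D(1)[OF \<open>b \<in> AF\<close>] AF_D(1)[OF \<open>c \<in> AF\<close>]]
      using ab_jacobi[OF L, of a b c x] by (simp add: jb ab_AF[OF L])
  qed
  moreover have "jacobi_bracket tA ?\<Lambda> ?E a b \<in> AF" if "a \<in> AF" "b \<in> AF" for a b
    unfolding jb[OF that] by (rule ab_AF[OF L that])
  moreover have "(\<lambda>x. hamiltonian_vf tA ?\<Lambda> ?E a x b) \<in> AF" if a: "a \<in> AF" and b: "b \<in> AF" for a b
  proof -
    have one: "tilde B one \<in> generated_submodule bA aff (tilde B (\<lambda>_. 1))"
      unfolding generated_submodule_def sec_scale_tilde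
      using M.C_const[of 1] by (intro CollectI exI[of _ "\<lambda>_. 1"]) simp
    \<comment> \<open>The ideal property is applied to the bracket {a, 1} = - E(a). It makes E(a)
      basic, so that the summand b E(a) of the hamiltonian derivative of b is affine.\<close>
    have "br (tilde B a) (tilde B one) \<in> generated_submodule bA aff (tilde B (\<lambda>_. 1))"
      using sp one tilde_section[OF a] unfolding almost_special_def Let_def by blast
    then obtain f where f: "f \<in> CM" "br (tilde B a) (tilde B one) = tilde B (\<lambda>x. f (\<pi> x) * 1)"
      unfolding generated_submodule_def sec_scale_tilde by blast
    have "ab br a one = (\<lambda>x. f (\<pi> x))"
      using tilde_inj[OF trans[OF br_tilde[OF L a AF_const, symmetric] f(2)]] by simp
    then have Ea: "?E x a = - f (\<pi> x)" for x
      using ab_skew[OF L AF_const[of 1] a] reeb(2)[OF L a] by simp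
    have "hamiltonian_vf tA ?\<Lambda> ?E a x b = ab br a b x + - f (\<pi> x) * b x" for x
      using fun_cong[OF jb[OF a b], of x] Ea[of x]
      by (simp add: hamiltonian_vf_apply[OF AF_D(1)[OF b]] jacobi_bracket_def algebra_simps)
    then show ?thesis
      using AF_add[OF ab_AF[OF L a b] AF_mult_basic[OF M.C_uminus[OF f(1)] b]] by simp
  qed
  ultimately have "strongly_affine_jacobi B ?\<Lambda> ?E"
    unfolding strongly_affine_jacobi_def affine_jacobi_def by blast
  moreover have "tilde B (jacobi_bracket tA ?\<Lambda> ?E a b) = br (tilde B a) (tilde B b)"
    if "a \<in> AF" "b \<in> AF" for a b
    unfolding jb[OF that] br_tilde[OF L that] ..
  ultimately show ?thesis by blast
qed

end

section \<open>From Jacobi structures to Lie algebroids\<close>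

context affine_bdl
begin

lemma tilde_in_fibre: "a \<in> AF \<Longrightarrow> tilde B a p \<in> fibre aff p"
  using tilde_section unfolding sections_iff by blast

context
  fixes \<Lambda> E
  assumes strongly: "strongly_affine_jacobi B \<Lambda> E"
begin

lemma strong_jacobi: "jacobi_structure tA \<Lambda> E"
  and jbr_AF: "a \<in> AF \<Longrightarrow> b \<in> AF \<Longrightarrow> jacobi_bracket tA \<Lambda> E a b \<in> AF"
  and strong_hamiltonian: "a \<in> AF \<Longrightarrow> b \<in> AF \<Longrightarrow> (\<lambda>x. hamiltonian_vf tA \<Lambda> E a x b) \<in> AF"
  using strongly unfolding strongly_affine_jacobi_def affine_jacobi_def by simp_all

lemma strong_bivector: "\<Lambda> \<in> bivector_fields tA"
  and strong_reeb: "E \<in> vector_fields tA"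
  using strong_jacobi unfolding jacobi_structure_def by simp_all

abbreviation "jbr \<equiv> jacobi_bracket tA \<Lambda> E"
abbreviation "L a b x \<equiv> \<Lambda> x (dA a x) (dA b x)"

text \<open>This is X_a(b) as a plain formula, free of the domain restriction that
  \<open>hamiltonian_vf\<close> carries as a functional; both agree for smooth b.\<close>

definition "hm a b x = L a b x + a x * E x b"

lemmas EV = T.vector_fieldD(1)[OF strong_reeb]

lemma hm_AF: "a \<in> AF \<Longrightarrow> b \<in> AF \<Longrightarrow> (\<lambda>x. hm a b x) \<in> AF"
  using strong_hamiltonian[of a b] by (simp add: hm_def hamiltonian_vf_apply AF_D(1))

lemma jbr_eq: "jbr a b x = hm a b x - b x * E x a"
  by (simp add: jacobi_bracket_def hm_def)

lemma hm_add2: "a \<in> CA \<Longrightarrow> b \<in> CA \<Longrightarrow> c \<in> CA \<Longrightarrow> hm a (\<lambda>q. b q + c q) x = hm a b x + hm a c x"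
  unfolding hm_def T.tangent_add_fun[OF EV]
  by (simp add: T.bivector_add_fun2[OF strong_bivector strong_reeb] algebra_simps)

lemma hm_scale2: "a \<in> CA \<Longrightarrow> b \<in> CA \<Longrightarrow> hm a (\<lambda>q. r * b q) x = r * hm a b x"
  unfolding hm_def T.tangent_scale_fun[OF EV]
  by (simp add: T.bivector_scale_fun2[OF strong_bivector strong_reeb] algebra_simps)

lemma hm_mult2: "a \<in> CA \<Longrightarrow> b \<in> CA \<Longrightarrow> c \<in> CA \<Longrightarrow> hm a (\<lambda>q. b q * c q) x = b x * hm a c x + c x * hm a b x"
  using T.bivector_mult_fun2[OF strong_bivector strong_reeb, of b c a x] T.tangent_mult_fun[OF EV, of b c x]
  unfolding hm_def by (simp add: algebra_simps)

lemma hm_add1: "a \<in> CA \<Longrightarrow> b \<in> CA \<Longrightarrow> c \<in> CA \<Longrightarrow> hm (\<lambda>q. a q + b q) c x = hm a c x + hm b c x"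
  unfolding hm_def
  by (simp add: T.bivector_add_fun[OF strong_bivector strong_reeb] algebra_simps)

lemma hm_mult1: "f \<in> CA \<Longrightarrow> a \<in> CA \<Longrightarrow> c \<in> CA \<Longrightarrow> hm (\<lambda>q. f q * a q) c x = f x * hm a c x + a x * L f c x"
  using T.bivector_mult_fun[OF strong_bivector strong_reeb, of f a c x]
  unfolding hm_def by (simp add: algebra_simps)

text \<open>Put e = E(a) = {1, a}. Then X_a(e) - {a, e} = e E(a) = e^2, so e and its square are both
  affine.\<close>

lemma reeb_basic:
  assumes a: "a \<in> AF"
  obtains g where "g \<in> CM" "\<And>x. E x a = g (\<pi> x)"
proof -
  have "jbr one a = (\<lambda>x. E x a)"
    using T.jb_skew[OF strong_bivector strong_reeb T.C_const[of 1] AF_D(1)[OF a]]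
      T.jb_one[OF strong_bivector strong_reeb AF_D(1)[OF a]] by (simp add: fun_eq_iff)
  then have e: "(\<lambda>x. E x a) \<in> AF" using jbr_AF[OF AF_const[of 1] a] by simp
  have "(\<lambda>x. hm a (\<lambda>x. E x a) x - jbr a (\<lambda>x. E x a) x) \<in> AF"
    by (intro AF_diff hm_AF jbr_AF a e)
  then have "(\<lambda>x. E x a * E x a) \<in> AF" by (simp add: jbr_eq)
  from affine_square_basic[OF e this] obtain g where "g \<in> CM" "(\<lambda>x. E x a) = (\<lambda>x. g (\<pi> x))" .
  then show ?thesis using that by (simp add: fun_eq_iff)
qed

lemma hm_basic:
  assumes a: "a \<in> AF" and f: "f \<in> CM"
  shows "\<exists>g. g \<in> CM \<and> (\<forall>x. hm a (\<lambda>y. f (\<pi> y)) x = g (\<pi> x))"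
proof -
  let ?k = "\<lambda>x. hm a (\<lambda>y. f (\<pi> y)) x"
  have k: "?k \<in> AF" by (rule hm_AF[OF a AF_basic[OF f]])
  have "(\<lambda>x. hm a (\<lambda>y. f (\<pi> y) * ?k y) x - f (\<pi> x) * hm a ?k x) \<in> AF"
    by (intro AF_diff hm_AF AF_mult_basic a f k)
  moreover have "hm a (\<lambda>y. f (\<pi> y) * ?k y) x - f (\<pi> x) * hm a ?k x = ?k x * ?k x" for x
    using hm_mult2[OF AF_D(1)[OF a] CM_pullback[OF f] AF_D(1)[OF k], of x] by simp
  ultimately have "(\<lambda>x. ?k x * ?k x) \<in> AF" by simp
  from affine_square_basic[OF k this] obtain g where "g \<in> CM" "?k = (\<lambda>x. g (\<pi> x))" .
  then show ?thesis by (auto simp: fun_eq_iff)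
qed

text \<open>The future anchor applied to f, as a function on M. It is unique because the projection
  is onto.\<close>

definition "G a f = (SOME g. g \<in> CM \<and> (\<forall>x. hm a (\<lambda>y. f (\<pi> y)) x = g (\<pi> x)))"

lemma G:
  assumes "a \<in> AF" "f \<in> CM"
  shows "G a f \<in> CM" and "hm a (\<lambda>y. f (\<pi> y)) x = G a f (\<pi> x)"
proof -
  have *: "G a f \<in> CM \<and> (\<forall>x. hm a (\<lambda>y. f (\<pi> y)) x = G a f (\<pi> x))"
    using someI_ex[OF hm_basic[OF assms]] unfolding G_def .
  show "G a f \<in> CM" by (rule conjunct1[OF *])
  show "hm a (\<lambda>y. f (\<pi> y)) x = G a f (\<pi> x)" by (rule conjunct2[OF *, rule_format])
qed

text \<open>This is where the positive rank of the bundle enters: affine functions separate points of the fibres.\<close>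

lemma bivector_basic_zero:
  assumes f: "f \<in> CM" and g: "g \<in> CM"
  shows "L (\<lambda>y. f (\<pi> y)) (\<lambda>y. g (\<pi> y)) x = 0"
proof -
  let ?l = "\<lambda>x. L (\<lambda>y. f (\<pi> y)) (\<lambda>y. g (\<pi> y)) x"
  have al: "a x * ?l x = G (\<lambda>y. f (\<pi> y) * a y) g (\<pi> x) - f (\<pi> x) * G a g (\<pi> x)" if "a \<in> AF" for a x
    using hm_mult1[OF CM_pullback[OF f] AF_D(1)[OF that] CM_pullback[OF g], of x]
      G(2)[OF that g, of x] G(2)[OF AF_mult_basic[OF f that] g, of x] by simp
  obtain a y z where a: "a \<in> AF" "\<pi> y = \<pi> x" "\<pi> z = \<pi> x" "a y \<noteq> a z"
    by (rule affine_nonconstant)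
  have "?l y = ?l x" "?l z = ?l x"
    using al[OF AF_const[of 1], of x] al[OF AF_const[of 1], of y] al[OF AF_const[of 1], of z] a by simp_all
  moreover have "a y * ?l y = a z * ?l z"
    using al[OF a(1), of y] al[OF a(1), of z] a by simp
  ultimately show ?thesis using a(4) by simp
qed

lemma G_add: "a \<in> AF \<Longrightarrow> b \<in> AF \<Longrightarrow> f \<in> CM \<Longrightarrow> G (\<lambda>y. a y + b y) f p = G a f p + G b f p"
proof -
  assume a: "a \<in> AF" and b: "b \<in> AF" and f: "f \<in> CM"
  obtain x where x: "\<pi> x = p" by (rule fibre_nonempty)
  show ?thesis
    using hm_add1[OF AF_D(1)[OF a] AF_D(1)[OF b] CM_pullback[OF f], of x]
      G(2)[OF a f, of x] G(2)[OF b f, of x] G(2)[OF AF_add[OF a b] f, of x] x by simp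
qed

lemma G_mult: "a \<in> AF \<Longrightarrow> f \<in> CM \<Longrightarrow> g \<in> CM \<Longrightarrow> G (\<lambda>y. g (\<pi> y) * a y) f p = g p * G a f p"
proof -
  assume a: "a \<in> AF" and f: "f \<in> CM" and g: "g \<in> CM"
  obtain x where x: "\<pi> x = p" by (rule fibre_nonempty)
  show ?thesis
    using hm_mult1[OF CM_pullback[OF g] AF_D(1)[OF a] CM_pullback[OF f], of x]
      bivector_basic_zero[OF g f, of x] G(2)[OF a f, of x] G(2)[OF AF_mult_basic[OF g a] f, of x] x
    by simp
qed

text \<open>G is additive in a and linear over functions on M, so at p it depends only on the
  restriction of a to the fibre over p. This makes \<open>rho\<close> independent of the affine
  function chosen to extend a given fibre element.\<close>

lemma G_cong:
  assumes a: "a \<in> AF" and b: "b \<in> AF" and f: "f \<in> CM" and eq: "tilde B a p = tilde B b p"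
  shows "G a f p = G b f p"
proof -
  have "G (\<lambda>y. a y - b y) f p = 0"
  proof (rule tensorial[where \<theta> = "\<lambda>a. G a f p" and p = p])
    show "a x - b x = 0" if "\<pi> x = p" for x using eq that unfolding tilde_eq_iff by simp
  qed (use f a b in \<open>auto intro: G_add G_mult AF_diff\<close>)
  then show ?thesis using G_add[OF AF_diff[OF a b] b f, of p] by simp
qed

definition "rho p = (\<lambda>\<alpha>\<in>fibre aff p. \<lambda>f\<in>CM. G (SOME a. a \<in> AF \<and> tilde B a p = \<alpha>) f p)"

lemma rho_tilde:
  assumes a: "a \<in> AF"
  shows "rho p (tilde B a p) = (\<lambda>f\<in>CM. G a f p)"
proof -
  let ?a = "SOME a'. a' \<in> AF \<and> tilde B a' p = tilde B a p"
  have "?a \<in> AF \<and> tilde B ?a p = tilde B a p" by (rule someI[of _ a]) (simp add: a)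
  then have "G ?a f p = G a f p" if "f \<in> CM" for f using G_cong[OF _ a that, of ?a p] by blast
  then show ?thesis
    using tilde_in_fibre[OF a, of p] by (auto simp: rho_def fun_eq_iff restrict_def)
qed

lemma G_tangent:
  assumes a: "a \<in> AF"
  shows "(\<lambda>f\<in>CM. G a f p) \<in> tangent_space bA p"
proof (rule M.tangent_spaceI)
  obtain x where x: "\<pi> x = p" by (rule fibre_nonempty)
  note aC = AF_D(1)[OF a]
  fix f g assume f: "f \<in> CM" and g: "g \<in> CM"
  note fC = CM_pullback[OF f] and gC = CM_pullback[OF g]
  show "(\<lambda>f\<in>CM. G a f p) (\<lambda>q. f q + g q) = (\<lambda>f\<in>CM. G a f p) f + (\<lambda>f\<in>CM. G a f p) g"
    using hm_add2[OF aC fC gC, of x] G(2)[OF a f, of x] G(2)[OF a g, of x] G(2)[OF a M.C_add[OF f g], of x] x f g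
    by (simp add: M.C_add)
  show "(\<lambda>f\<in>CM. G a f p) (\<lambda>q. f q * g q) = f p * (\<lambda>f\<in>CM. G a f p) g + g p * (\<lambda>f\<in>CM. G a f p) f"
    using hm_mult2[OF aC fC gC, of x] G(2)[OF a f, of x] G(2)[OF a g, of x] G(2)[OF a M.C_mult[OF f g], of x] x f g
    by (simp add: M.C_mult)
  show "(\<lambda>f\<in>CM. G a f p) (\<lambda>q. c * f q) = c * (\<lambda>f\<in>CM. G a f p) f" for c
    using hm_scale2[OF aC fC, of c x] G(2)[OF a f, of x] G(2)[OF a M.C_scale[OF f, of c], of x] x f
    by (simp add: M.C_scale)
qed simp

definition "brk = (\<lambda>X\<in>SA. \<lambda>Y\<in>SA. tilde B (jbr (untilde X) (untilde Y)))"

lemma brk_tilde: "a \<in> AF \<Longrightarrow> b \<in> AF \<Longrightarrow> brk (tilde B a) (tilde B b) = tilde B (jbr a b)"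
  by (simp add: brk_def tilde_section)

lemma rho_anchor: "anchor_map bA aff rho"
  unfolding anchor_map_def
proof (intro conjI allI ballI)
  fix p
  show "rho p \<in> fibre aff p \<rightarrow>\<^sub>E tangent_space bA p"
  proof (rule PiE_I)
    fix \<alpha> assume "\<alpha> \<in> fibre aff p"
    then obtain a where "a \<in> AF" "tilde B a p = \<alpha>" using fibre_extension by blast
    then show "rho p \<alpha> \<in> tangent_space bA p" using rho_tilde[of a p] G_tangent[of a p] by simp
  qed (simp add: rho_def)
  fix \<alpha> assume "\<alpha> \<in> fibre aff p"
  then obtain a where a: "a \<in> AF" "tilde B a p = \<alpha>" using fibre_extension by blast
  show "rho p (vscale aff p c \<alpha>) = tangent_scale bA c (rho p \<alpha>)" for c
    unfolding a(2)[symmetric] vscale_tilde rho_tilde[OF a(1)] rho_tilde[OF AF_scale[OF a(1)]] tangent_scale_def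
    using G_mult[OF a(1) _ M.C_const] by (auto simp: fun_eq_iff restrict_def)
  fix \<gamma> assume "\<gamma> \<in> fibre aff p"
  then obtain b where b: "b \<in> AF" "tilde B b p = \<gamma>" using fibre_extension by blast
  show "rho p (vadd aff p \<alpha> \<gamma>) = tangent_add bA (rho p \<alpha>) (rho p \<gamma>)"
    unfolding a(2)[symmetric] b(2)[symmetric] vadd_tilde rho_tilde[OF a(1)] rho_tilde[OF b(1)]
      rho_tilde[OF AF_add[OF a(1) b(1)]] tangent_add_def
    using G_add[OF a(1) b(1)] by (auto simp: fun_eq_iff restrict_def)
next
  fix X assume "X \<in> SA"
  then obtain a where a: "a \<in> AF" "X = tilde B a" unfolding sections_eq by blast
  show "(\<lambda>p. rho p (X p)) \<in> vector_fields bA"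
    unfolding vector_fields_def a(2) rho_tilde[OF a(1)]
    using G_tangent[OF a(1)] G(1)[OF a(1)] by auto
qed

text \<open>In {a, f} = X_a(f) - f E(a) both terms are basic. Read in terms of sections, this is the
  ideal property of the multiples of 1.\<close>

lemma jbr_basic:
  assumes a: "a \<in> AF" and f: "f \<in> CM"
  obtains g where "g \<in> CM" "jbr a (\<lambda>x. f (\<pi> x)) = (\<lambda>x. g (\<pi> x))"
proof -
  obtain e where e: "e \<in> CM" "\<And>x. E x a = e (\<pi> x)" by (rule reeb_basic[OF a]) (rule that)
  show ?thesis
  proof
    show "(\<lambda>p. G a f p - f p * e p) \<in> CM" by (intro M.C_diff M.C_mult G(1) a f e(1))
    show "jbr a (\<lambda>x. f (\<pi> x)) = (\<lambda>x. G a f (\<pi> x) - f (\<pi> x) * e (\<pi> x))"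
      by (rule ext) (simp add: jbr_eq G(2)[OF a f] e(2))
  qed
qed

lemma brk_lie_bracket: "lie_bracket bA aff brk"
  unfolding lie_bracket_def
proof (intro conjI ballI allI)
  show "brk \<in> SA \<rightarrow>\<^sub>E SA \<rightarrow>\<^sub>E SA"
    unfolding brk_def by (auto intro!: tilde_section jbr_AF untilde_AF)
  fix X Y Z assume "X \<in> SA" "Y \<in> SA" "Z \<in> SA"
  then obtain a b c where a: "a \<in> AF" "X = tilde B a" and b: "b \<in> AF" "Y = tilde B b"
    and c: "c \<in> AF" "Z = tilde B c" unfolding sections_eq by blast
  note C = AF_D(1)[OF a(1)] AF_D(1)[OF b(1)] AF_D(1)[OF c(1)]
  note sb = strong_bivector strong_reeb
  have "jbr (\<lambda>x. a x + b x) c x = jbr a c x + jbr b c x" for x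
    using T.jb_add[OF sb C(1,2,3), of x] T.jb_skew[OF sb T.C_add[OF C(1,2)] C(3), of x]
      T.jb_skew[OF sb C(1,3), of x] T.jb_skew[OF sb C(2,3), of x] by simp
  then have "jbr (\<lambda>x. a x + b x) c = (\<lambda>x. jbr a c x + jbr b c x)" by blast
  then show "brk (sec_add aff X Y) Z = sec_add aff (brk X Z) (brk Y Z)"
    unfolding a(2) b(2) c(2) sec_add_tilde
    by (simp add: brk_tilde a b c AF_add sec_add_tilde)
  show "brk (sec_scale aff (\<lambda>_. r) X) Z = sec_scale aff (\<lambda>_. r) (brk X Z)" for r
  proof -
    have "jbr (\<lambda>x. r * a x) c x = r * jbr a c x" for x
      using T.jb_scale[OF sb C(1,3), of r x] T.jb_skew[OF sb T.C_scale[OF C(1), of r] C(3), of x]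
        T.jb_skew[OF sb C(1,3), of x] by simp
    then have "jbr (\<lambda>x. r * a x) c = (\<lambda>x. r * jbr a c x)" by blast
    then show ?thesis
      unfolding a(2) c(2) sec_scale_tilde by (simp add: brk_tilde a c AF_scale sec_scale_tilde)
  qed
  show "brk X Y = sec_scale aff (\<lambda>_. - 1) (brk Y X)"
  proof -
    have "jbr a b = (\<lambda>x. - jbr b a x)" using T.jb_skew[OF sb C(1,2)] by blast
    then show ?thesis
      unfolding a(2) b(2) by (simp add: brk_tilde a b sec_scale_tilde)
  qed
  have "jbr a (jbr b c) x + jbr b (jbr c a) x + jbr c (jbr a b) x = 0" for x
    using strong_jacobi C unfolding jacobi_structure_def by blast
  then have "jbr a (jbr b c) x + (jbr b (jbr c a) x + jbr c (jbr a b) x) = 0" for x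
    by (simp add: add.assoc)
  then show "sec_add aff (brk X (brk Y Z))
      (sec_add aff (brk Y (brk Z X)) (brk Z (brk X Y))) = vzero aff"
    unfolding a(2) b(2) c(2) by (simp add: brk_tilde a b c jbr_AF sec_add_tilde vzero_tilde)
qed

text \<open>{a, -} is not a derivation of functions, but its zero-order term - b E(a) is linear in b
  over all functions; a factor f therefore contributes exactly X_a(f) b, the anchor term.\<close>

lemma brk_lie_algebroid: "lie_algebroid bA aff brk rho"
  unfolding lie_algebroid_def
proof (intro conjI ballI brk_lie_bracket rho_anchor)
  fix X Y f assume "X \<in> SA" "Y \<in> SA" and f: "f \<in> CM"
  then obtain a b where a: "a \<in> AF" "X = tilde B a" and b: "b \<in> AF" "Y = tilde B b"
    unfolding sections_eq by blast
  have "jbr a (\<lambda>x. f (\<pi> x) * b x) x = f (\<pi> x) * jbr a b x + G a f (\<pi> x) * b x" for x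
    using hm_mult2[OF AF_D(1)[OF a(1)] CM_pullback[OF f] AF_D(1)[OF b(1)], of x] G(2)[OF a(1) f, of x]
    by (simp add: jbr_eq algebra_simps)
  then have "jbr a (\<lambda>x. f (\<pi> x) * b x) = (\<lambda>x. f (\<pi> x) * jbr a b x + G a f (\<pi> x) * b x)" by blast
  then show "brk X (sec_scale aff f Y) =
      sec_add aff (sec_scale aff f (brk X Y)) (sec_scale aff (\<lambda>p. rho p (X p) f) Y)"
    unfolding a(2) b(2) rho_tilde[OF a(1)] sec_scale_tilde brk_tilde[OF a(1) b(1)]
      brk_tilde[OF a(1) AF_mult_basic[OF f b(1)]] sec_add_tilde
    using f by simp
qed

lemma brk_almost_special: "almost_special B brk rho"
  unfolding almost_special_def Let_def
proof (intro conjI ballI brk_lie_algebroid)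
  fix X Y assume "X \<in> SA" and "Y \<in> generated_submodule bA aff (tilde B (\<lambda>_. 1))"
  then obtain a f where a: "a \<in> AF" "X = tilde B a" and f: "f \<in> CM" "Y = tilde B (\<lambda>x. f (\<pi> x))"
    unfolding sections_eq generated_submodule_def sec_scale_tilde by auto
  obtain g where g: "g \<in> CM" "jbr a (\<lambda>x. f (\<pi> x)) = (\<lambda>x. g (\<pi> x))"
    by (rule jbr_basic[OF a(1) f(1)]) (rule that)
  have "brk X Y = sec_scale aff g (tilde B (\<lambda>_. 1))"
    unfolding a(2) f(2) brk_tilde[OF a(1) AF_basic[OF f(1)]] g(2) sec_scale_tilde by simp
  then show "brk X Y \<in> generated_submodule bA aff (tilde B (\<lambda>_. 1))"
    unfolding generated_submodule_def using g(1) by blast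
qed

end

section \<open>Uniqueness and the correspondence\<close>

text \<open>The anchor is no independent datum: {a, f} = f {a, 1} + \<rho>(a)(f) for basic f, and
  every element of a fibre is the restriction of an affine function.\<close>

lemma algebroid_inj:
  assumes L: "lie_algebroid bA aff br \<rho>" and L': "lie_algebroid bA aff br' \<rho>'"
    and eq: "\<And>a b. a \<in> AF \<Longrightarrow> b \<in> AF \<Longrightarrow> br (tilde B a) (tilde B b) = br' (tilde B a) (tilde B b)"
  shows "br = br'" "\<rho> = \<rho>'"
proof -
  show bb: "br = br'"
  proof (rule PiE_ext[OF br_ext[OF L] br_ext[OF L']])
    fix X assume X: "X \<in> SA"
    show "br X = br' X"
    proof (rule PiE_ext[OF PiE_mem[OF br_ext[OF L] X] PiE_mem[OF br_ext[OF L'] X]])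
      fix Y assume "Y \<in> SA"
      then show "br X Y = br' X Y" using X eq unfolding sections_eq by blast
    qed
  qed
  have \<rho>: "\<forall>p. \<rho> p \<in> fibre aff p \<rightarrow>\<^sub>E tangent_space bA p"
    and \<rho>': "\<forall>p. \<rho>' p \<in> fibre aff p \<rightarrow>\<^sub>E tangent_space bA p"
    using br_anchor[OF L] br_anchor[OF L'] unfolding anchor_map_def by blast+
  show "\<rho> = \<rho>'"
  proof
    fix p show "\<rho> p = \<rho>' p"
    proof (rule PiE_ext[OF \<rho>[rule_format] \<rho>'[rule_format]])
      fix \<alpha> assume \<alpha>: "\<alpha> \<in> fibre aff p"
      then obtain a where a: "a \<in> AF" "tilde B a p = \<alpha>" using fibre_extension by blast
      obtain x where x: "\<pi> x = p" by (rule fibre_nonempty)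
      show "\<rho> p \<alpha> = \<rho>' p \<alpha>"
      proof (rule M.tangent_eqI[OF PiE_mem[OF \<rho>[rule_format] \<alpha>] PiE_mem[OF \<rho>'[rule_format] \<alpha>]])
        fix f assume f: "f \<in> CM"
        show "\<rho> p \<alpha> f = \<rho>' p \<alpha> f"
          using fun_cong[OF ab_basic[OF L a(1) f], of x] fun_cong[OF ab_basic[OF L' a(1) f], of x] x a(2)
          by (simp add: bb anc_def[OF L] anc_def[OF L'])
      qed
    qed
  qed
qed

end

text \<open>The correspondence is described by a relation and not by a formula, so the bijection is
  extracted from unique existence in both directions.\<close>

lemma bij_betw_unique_relation:
  assumes "\<And>x. x \<in> S \<Longrightarrow> \<exists>!y. y \<in> T \<and> R x y" and "\<And>y. y \<in> T \<Longrightarrow> \<exists>!x. x \<in> S \<and> R x y"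
  shows "\<exists>f. bij_betw f S T \<and> (\<forall>x\<in>S. \<forall>y\<in>T. f x = y \<longleftrightarrow> R x y)"
proof -
  define f where "f x = (THE y. y \<in> T \<and> R x y)" for x
  have f: "f x \<in> T \<and> R x (f x)" if "x \<in> S" for x
    unfolding f_def by (rule theI'[OF assms(1)[OF that]])
  have iff: "f x = y \<longleftrightarrow> R x y" if "x \<in> S" "y \<in> T" for x y
    using f assms(1) that by blast
  have "inj_on f S"
  proof (rule inj_onI)
    fix x x' assume x: "x \<in> S" "x' \<in> S" "f x = f x'"
    then show "x = x'" using f[OF x(1)] f[OF x(2)] assms(2)[of "f x"] by auto
  qed
  moreover have "f ` S = T"
  proof (intro equalityI subsetI)
    fix y assume y: "y \<in> T"
    then obtain x where "x \<in> S" "R x y" using assms(2) by blast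
    then show "y \<in> f ` S" using iff y by blast
  qed (use f in auto)
  ultimately show ?thesis using iff unfolding bij_betw_def by blast
qed

theorem corollary5p11:
  fixes B :: "('a::{t2_space, second_countable_topology}, 'm::{t2_space, second_countable_topology},
               'v, 'e::real_inner, 'f::euclidean_space) abundle"
    and n :: nat
  assumes "affine_bundle n B" and "n > 0"
  shows "\<exists>\<Phi>.
    bij_betw \<Phi> {(\<Lambda>, E). strongly_affine_jacobi B \<Lambda> E} {(br, \<rho>). almost_special B br \<rho>} \<and>
    (\<forall>\<Lambda> E br \<rho>. strongly_affine_jacobi B \<Lambda> E \<longrightarrow> almost_special B br \<rho> \<longrightarrow>
       (\<Phi> (\<Lambda>, E) = (br, \<rho>) \<longleftrightarrow>
        (\<forall>a\<in>affine_functions B. \<forall>b\<in>affine_functions B.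
           tilde B (jacobi_bracket (total_atlas B) \<Lambda> E a b) = br (tilde B a) (tilde B b))))"
proof -
  interpret affine_bdl B n by unfold_locales (rule assms(1))
  let ?J = "{(\<Lambda>, E). strongly_affine_jacobi B \<Lambda> E}" and ?L = "{(br, \<rho>). almost_special B br \<rho>}"
  \<comment> \<open>The relation sees \<Lambda> and E only through their bracket, and the anchor not
    at all; \<open>jacobi_bracket_inj\<close> and \<open>algebroid_inj\<close> recover all
    three.\<close>
  define R where "R J A \<longleftrightarrow> (\<forall>a\<in>AF. \<forall>b\<in>AF.
    tilde B (jacobi_bracket (total_atlas B) (fst J) (snd J) a b) = fst A (tilde B a) (tilde B b))"
    for J and A :: "_ \<times> ('m \<Rightarrow> ('a \<Rightarrow> real) \<Rightarrow> ('m \<Rightarrow> real) \<Rightarrow> real)"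
  have "\<exists>f. bij_betw f ?J ?L \<and> (\<forall>J\<in>?J. \<forall>A\<in>?L. f J = A \<longleftrightarrow> R J A)"
  proof (rule bij_betw_unique_relation)
    fix J assume "J \<in> ?J"
    then obtain \<Lambda> E where J: "J = (\<Lambda>, E)" and s: "strongly_affine_jacobi B \<Lambda> E" by auto
    show "\<exists>!A. A \<in> ?L \<and> R J A"
    proof (rule ex1I[of _ "(brk \<Lambda> E, rho \<Lambda> E)"])
      show "(brk \<Lambda> E, rho \<Lambda> E) \<in> ?L \<and> R J (brk \<Lambda> E, rho \<Lambda> E)"
        using brk_almost_special[OF s] brk_tilde[OF s] by (simp add: R_def J)
      fix A assume A: "A \<in> ?L \<and> R J A"
      then obtain br \<rho> where A': "A = (br, \<rho>)" and sp: "almost_special B br \<rho>" by auto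
      have "lie_algebroid (base_atlas B) (aff_dual B) br \<rho>"
        using sp unfolding almost_special_def by blast
      from algebroid_inj[OF this brk_lie_algebroid[OF s]]
      show "A = (brk \<Lambda> E, rho \<Lambda> E)"
        using A brk_tilde[OF s] by (simp add: A' R_def J)
    qed
  next
    fix A assume "A \<in> ?L"
    then obtain br \<rho> where A: "A = (br, \<rho>)" and sp: "almost_special B br \<rho>" by auto
    obtain \<Lambda> E where s: "strongly_affine_jacobi B \<Lambda> E"
      and r: "\<forall>a\<in>AF. \<forall>b\<in>AF. tilde B (jacobi_bracket (total_atlas B) \<Lambda> E a b) = br (tilde B a) (tilde B b)"
      using jacobi_exists[OF sp] by blast
    show "\<exists>!J. J \<in> ?J \<and> R J A"
    proof (rule ex1I[of _ "(\<Lambda>, E)"])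
      show "(\<Lambda>, E) \<in> ?J \<and> R (\<Lambda>, E) A" using s r by (simp add: R_def A)
      fix J assume J: "J \<in> ?J \<and> R J A"
      then obtain \<Lambda>' E' where J': "J = (\<Lambda>', E')" and s': "strongly_affine_jacobi B \<Lambda>' E'" by auto
      have "jacobi_bracket (total_atlas B) \<Lambda>' E' a b = jacobi_bracket (total_atlas B) \<Lambda> E a b"
        if "a \<in> AF" "b \<in> AF" for a b
        using J r that by (intro tilde_inj) (simp add: R_def J' A)
      from jacobi_bracket_inj[OF strong_bivector[OF s'] strong_bivector[OF s] strong_reeb[OF s'] strong_reeb[OF s] this]
      show "J = (\<Lambda>, E)" by (simp add: J')
    qed
  qed
  then obtain f where f: "bij_betw f ?J ?L" "\<forall>J\<in>?J. \<forall>A\<in>?L. f J = A \<longleftrightarrow> R J A" by blast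
  have "f (\<Lambda>, E) = (br, \<rho>) \<longleftrightarrow> (\<forall>a\<in>AF. \<forall>b\<in>AF.
      tilde B (jacobi_bracket (total_atlas B) \<Lambda> E a b) = br (tilde B a) (tilde B b))"
    if "strongly_affine_jacobi B \<Lambda> E" "almost_special B br \<rho>" for \<Lambda> E br \<rho>
    using f(2)[rule_format, of "(\<Lambda>, E)" "(br, \<rho>)"] that by (simp add: R_def)
  then show ?thesis using f(1) by blast
qed

end
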